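(* Let $G$ be a compact abelian group, let $A=\mathbb C[G]$ be its weakly complete commutative symmetric group Hopf algebra over $\mathbb C$, and let $\hat G=\mathrm{Hom}(G,\mathbb T)$ be its character group. (i) $A$ may be identified (as a weakly complete algebra) with $\mathbb C^{\hat G}$ (componentwise operations) in such a way that each $g\in G\subseteq A^{-1}$ is the function on $\hat G$ given by $$g(\chi)=e^{2\pi i\langle\chi,g\rangle}\in\mathbb S^1\quad\text{for all }\chi\in\hat G.$$ The natural image of $G$ in $A^{-1}$ is $G=\mathrm{Hom}(\hat G,\mathbb S^1)\cong\hat{\hat G}$, and $$G=\mathrm{Hom}(\hat G,\mathbb S^1)\subseteq\mathbb R[G]\subseteq\mathbb C[G]=\mathbb C^{\hat G}.$$ (ii) If the weakly complete vector spaces $A\otimes_{\mathcal W}A$ and $\mathbb C^{\hat G\times\hat G}$ are identified, then the comultiplication $\gamma_G\colon A\to A\otimes_{\mathcal W}A$ of $A$ is given by $$\gamma_G(\phi)(\chi_1,\chi_2)=\phi(\chi_1+\chi_2)\in\mathbb C\quad\text{for all }\phi\colon\hat G\to\mathbb C,\ \chi_1,\chi_2\in\hat G.$$ (iii) The group of grouplike elements of $A$ is $\mathbb G(A)=\mathrm{Hom}(\hat G,\mathbb C^\times)\subseteq\mathbb C^{\hat G}$. (iv) The weakly complete Lie algebra of primitive elements of $A$ is $\mathbb P(A)=\mathrm{Hom}(\hat G,\mathbb C)\subseteq\mathbb C^{\hat G}$.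
   Context: Compact groups are Hausdorff. For $\mathbb K\in\{\mathbb R,\mathbb C\}$, a topological $\mathbb K$-vector space is weakly complete if it is isomorphic to $\mathbb K^J$ for some set $J$. A weakly complete algebra is an associative unital $\mathbb K$-algebra on a weakly complete vector space with continuous multiplication; morphisms are continuous unital homomorphisms; $A^{-1}$ is its topological group of units. The tensor product $\otimes_{\mathcal W}$ of weakly complete vector spaces is the one universal for continuous bilinear maps into weakly complete vector spaces, so $\mathbb K^I\otimes_{\mathcal W}\mathbb K^J\cong\mathbb K^{I\times J}$; here $\phi\otimes\psi$ is identified with $(\chi_1,\chi_2)\mapsto\phi(\chi_1)\psi(\chi_2)$. Weakly complete group algebra: $G\mapsto\mathbb K[G]$ is left adjoint to $A\mapsto A^{-1}$ (from weakly complete algebras to topological groups), with unit $\eta_G\colon G\to\mathbb K[G]^{-1}$. For compact $G$ the map $\eta_G$ is an embedding and $G$ is identified with its image. There are natural inclusions $G\subseteq\mathbb R[G]\subseteq\mathbb C[G]\cong\mathbb C\otimes\mathbb R[G]$, and $\mathbb R[G]$ is the closed real linear span of $G$ in $\mathbb C[G]$. The comultiplication $\gamma_G\colon\mathbb K[G]\to\mathbb K[G]\otimes_{\mathcal W}\mathbb K[G]$ is the morphism of weakly complete algebras with $\gamma_G(g)=g\otimes g$ for $g\in G$, and the coidentity $k\colon\mathbb K[G]\to\mathbb K$ is the one with $k(g)=1$ for $g\in G$. An element $a\in A$ is grouplike if $\gamma_G(a)=a\otimes a$ and $k(a)=1$; $\mathbb G(A)$ denotes the group of grouplike elements. An element $a$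 is primitive if $\gamma_G(a)=a\otimes1+1\otimes a$; $\mathbb P(A)$ is the Lie algebra of primitive elements with bracket $[a,b]=ab-ba$. $\mathbb T=\mathbb R/\mathbb Z$; $\hat G$ is the discrete group of continuous homomorphisms $G\to\mathbb T$, written additively, $\langle\chi,g\rangle=\chi(g)$; $\hat{\hat G}=\mathrm{Hom}(\hat G,\mathbb T)$; $\mathbb S^1=\{z\in\mathbb C:|z|=1\}$; $\mathbb C^\times=(\mathbb C\setminus\{0\},\cdot)$; $\mathrm{Hom}(\hat G,\mathbb C)$ means homomorphisms into $(\mathbb C,+)$. *)

theory Defs
  imports "HOL-Analysis.Analysis" "HOL-Algebra.Module" "HOL-Algebra.Coset"
begin

section \<open>Topological groups\<close>

record 'g top_group = "'g monoid" +
  gtop :: "'g topology"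

definition topological_group :: "'g top_group \<Rightarrow> bool" where
  "topological_group G \<longleftrightarrow>
     Group.group G \<and> topspace (gtop G) = carrier G \<and>
     continuous_map (prod_topology (gtop G) (gtop G)) (gtop G) (\<lambda>(x, y). x \<otimes>\<^bsub>G\<^esub> y) \<and>
     continuous_map (gtop G) (gtop G) (\<lambda>x. inv\<^bsub>G\<^esub> x)"

definition compact_abelian_group :: "'g top_group \<Rightarrow> bool" where
  "compact_abelian_group G \<longleftrightarrow>
     topological_group G \<and> comm_group G \<and> compact_space (gtop G) \<and> Hausdorff_space (gtop G)"

definition continuous_hom :: "'g top_group \<Rightarrow> 'h top_group \<Rightarrow> ('g \<Rightarrow> 'h) set" where
  "continuous_hom G H = {f \<in> hom G H. continuous_map (gtop G) (gtop H) f}"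

definition top_group_iso :: "'g top_group \<Rightarrow> 'h top_group \<Rightarrow> ('g \<Rightarrow> 'h) set" where
  "top_group_iso G H = {f \<in> iso G H. homeomorphic_map (gtop G) (gtop H) f}"

text \<open>\<open>Hom(D, H)\<close> for a discrete group \<open>D\<close>: pointwise operations and the topology of
  pointwise convergence. Its elements are extensional functions on \<open>carrier D\<close>, so that
  for \<open>H\<close> inside \<open>\<complex>\<close> it is literally a subset of the carrier of \<open>\<complex>\<close> to the
  power \<open>D\<close> below.\<close>

definition hom_group :: "'d monoid \<Rightarrow> 'h top_group \<Rightarrow> ('d \<Rightarrow> 'h) top_group" where
  "hom_group D H =
     \<lparr>carrier = {f \<in> extensional (carrier D). f \<in> hom D H},
      monoid.mult = (\<lambda>f g. \<lambda>x\<in>carrier D. f x \<otimes>\<^bsub>H\<^esub> g x),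
      one = (\<lambda>x\<in>carrier D. \<one>\<^bsub>H\<^esub>),
      gtop = subtopology (product_topology (\<lambda>_. gtop H) (carrier D))
               {f \<in> extensional (carrier D). f \<in> hom D H}\<rparr>"

subsection \<open>The groups \<open>\<real>/\<int>\<close>, \<open>S\<^sup>1\<close>, \<open>\<complex>\<^sup>\<times>\<close>, \<open>\<complex>\<close>\<close>

definition real_additive :: "real monoid" where
  "real_additive = \<lparr>carrier = UNIV, monoid.mult = (+), one = 0\<rparr>"

text \<open>\<open>\<real>/\<int>\<close>: the elements are the cosets of \<open>\<int>\<close>, the topology is the quotient topology.\<close>

definition RmodZ :: "real set top_group" where
  "RmodZ =
     \<lparr>carrier = carrier (real_additive Mod \<int>),
      monoid.mult = monoid.mult (real_additive Mod \<int>),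
      one = one (real_additive Mod \<int>),
      gtop = topology (\<lambda>U. U \<subseteq> carrier (real_additive Mod \<int>) \<and> open {x. \<int> #>\<^bsub>real_additive\<^esub> x \<in> U})\<rparr>"

text \<open>\<open>exp (2 \<pi> i t)\<close> for \<open>t \<in> \<real>/\<int>\<close>; the set whose element is taken is a singleton.\<close>

definition exp_RmodZ :: "real set \<Rightarrow> complex" where
  "exp_RmodZ t = the_elem ((\<lambda>x. exp (2 * of_real pi * \<i> * of_real x)) ` t)"

definition circle_S1 :: "complex top_group" where
  "circle_S1 = \<lparr>carrier = {z. norm z = 1}, monoid.mult = (*), one = 1,
                gtop = top_of_set {z. norm z = 1}\<rparr>"

definition complex_units :: "complex top_group" where
  "complex_units = \<lparr>carrier = UNIV - {0}, monoid.mult = (*), one = 1,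
                    gtop = top_of_set (UNIV - {0})\<rparr>"

definition complex_additive :: "complex top_group" where
  "complex_additive = \<lparr>carrier = UNIV, monoid.mult = (+), one = 0, gtop = euclidean\<rparr>"

text \<open>The character group, with its addition of characters as the monoid operation.
  It is discrete, so no topology is recorded.\<close>

definition char_group :: "'g top_group \<Rightarrow> ('g \<Rightarrow> real set) monoid" where
  "char_group G =
     \<lparr>carrier = {\<xi> \<in> extensional (carrier G). \<xi> \<in> continuous_hom G RmodZ},
      monoid.mult = (\<lambda>\<xi> \<psi>. \<lambda>g\<in>carrier G. \<xi> g \<otimes>\<^bsub>RmodZ\<^esub> \<psi> g),
      one = (\<lambda>g\<in>carrier G. \<one>\<^bsub>RmodZ\<^esub>)\<rparr>"

section \<open>Weakly complete vector spaces and algebras over \<open>\<complex>\<close>\<close>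

text \<open>As with modules in HOL-Algebra, the same record serves for vector spaces, where
  \<open>mult\<close> and \<open>one\<close> are ignored, and for algebras; for Lie algebras \<open>mult\<close> is the bracket.\<close>

record 'a top_algebra = "(complex, 'a) module" +
  vtop :: "'a topology"

definition complex_algebra :: "complex top_algebra" where
  "complex_algebra = \<lparr>carrier = UNIV, monoid.mult = (*), one = 1, ring.zero = 0, ring.add = (+),
                      smult = (*), vtop = euclidean\<rparr>"

text \<open>\<open>\<complex>\<close> to the power \<open>J\<close>: product topology and componentwise operations.\<close>

definition complex_power :: "'j set \<Rightarrow> ('j \<Rightarrow> complex) top_algebra" where
  "complex_power J =
     \<lparr>carrier = extensional J,
      monoid.mult = (\<lambda>f g. \<lambda>j\<in>J. f j * g j), one = (\<lambda>j\<in>J. 1),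
      ring.zero = (\<lambda>j\<in>J. 0), ring.add = (\<lambda>f g. \<lambda>j\<in>J. f j + g j),
      smult = (\<lambda>c f. \<lambda>j\<in>J. c * f j),
      vtop = product_topology (\<lambda>_. euclidean) J\<rparr>"

definition linear_maps :: "'a top_algebra \<Rightarrow> 'b top_algebra \<Rightarrow> ('a \<Rightarrow> 'b) set" where
  "linear_maps V W =
     {f \<in> hom (add_monoid V) (add_monoid W).
        \<forall>c. \<forall>v\<in>carrier V. f (c \<odot>\<^bsub>V\<^esub> v) = c \<odot>\<^bsub>W\<^esub> f v}"

definition continuous_linear :: "'a top_algebra \<Rightarrow> 'b top_algebra \<Rightarrow> ('a \<Rightarrow> 'b) set" where
  "continuous_linear V W = {f \<in> linear_maps V W. continuous_map (vtop V) (vtop W) f}"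

definition top_linear_iso :: "'a top_algebra \<Rightarrow> 'b top_algebra \<Rightarrow> ('a \<Rightarrow> 'b) set" where
  "top_linear_iso V W = {f \<in> linear_maps V W. homeomorphic_map (vtop V) (vtop W) f}"

definition continuous_bilinear ::
  "'a top_algebra \<Rightarrow> 'b top_algebra \<Rightarrow> 'c top_algebra \<Rightarrow> ('a \<Rightarrow> 'b \<Rightarrow> 'c) set" where
  "continuous_bilinear V W U =
     {b. (\<forall>v\<in>carrier V. b v \<in> linear_maps W U) \<and>
         (\<forall>w\<in>carrier W. (\<lambda>v. b v w) \<in> linear_maps V U) \<and>
         continuous_map (prod_topology (vtop V) (vtop W)) (vtop U) (\<lambda>(v, w). b v w)}"

definition topological_vector_space :: "'a top_algebra \<Rightarrow> bool" where
  "topological_vector_space V \<longleftrightarrow>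
     Module.module complex_algebra V \<and> topspace (vtop V) = carrier V \<and>
     continuous_map (prod_topology (vtop V) (vtop V)) (vtop V) (\<lambda>(v, w). v \<oplus>\<^bsub>V\<^esub> w) \<and>
     continuous_map (prod_topology euclidean (vtop V)) (vtop V) (\<lambda>(c, v). c \<odot>\<^bsub>V\<^esub> v)"

text \<open>Taking the index set \<open>J\<close> in the type of the elements of \<open>V\<close> is no restriction: the unit
  vectors embed \<open>J\<close> into the power of \<open>\<complex>\<close>, hence into \<open>carrier V\<close>.\<close>

definition weakly_complete_space :: "'a top_algebra \<Rightarrow> bool" where
  "weakly_complete_space V \<longleftrightarrow>
     topological_vector_space V \<and> (\<exists>J :: 'a set. top_linear_iso V (complex_power J) \<noteq> {})"

text \<open>The locale \<open>algebra\<close> of HOL-Algebra is confined to commutative algebras.\<close>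

definition weakly_complete_algebra :: "'a top_algebra \<Rightarrow> bool" where
  "weakly_complete_algebra A \<longleftrightarrow>
     weakly_complete_space A \<and> Ring.ring A \<and>
     (\<lambda>x y. x \<otimes>\<^bsub>A\<^esub> y) \<in> continuous_bilinear A A A"

definition algebra_hom :: "'a top_algebra \<Rightarrow> 'b top_algebra \<Rightarrow> ('a \<Rightarrow> 'b) set" where
  "algebra_hom A B = continuous_linear A B \<inter> ring_hom A B"

definition top_algebra_iso :: "'a top_algebra \<Rightarrow> 'b top_algebra \<Rightarrow> ('a \<Rightarrow> 'b) set" where
  "top_algebra_iso A B = top_linear_iso A B \<inter> ring_hom A B"

definition unit_group :: "'a top_algebra \<Rightarrow> 'a top_group" where
  "unit_group A = \<lparr>carrier = Units A, monoid.mult = monoid.mult A, one = one A,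
                   gtop = subtopology (vtop A) (Units A)\<rparr>"

section \<open>The weakly complete group algebra and its Hopf structure\<close>

text \<open>\<open>A\<close> with unit \<open>\<eta>\<close> is the value at \<open>G\<close> of the left adjoint of \<open>A \<mapsto> unit_group A\<close>.
  The test algebras \<open>B\<close> cannot range over all types. They range over all weakly complete algebras
  with elements in \<open>'a \<Rightarrow> complex\<close>, a type that contains copies of \<open>\<complex>\<close> and of everything
  living on \<open>'a\<close>, in particular of \<open>A\<close> itself. Being universal for these is at most a weaker
  condition on \<open>A\<close> than being universal for all weakly complete algebras.\<close>

definition group_algebra :: "'g top_group \<Rightarrow> 'a top_algebra \<Rightarrow> ('g \<Rightarrow> 'a) \<Rightarrow> bool" where
  "group_algebra G A \<eta> \<longleftrightarrow>
     weakly_complete_algebra A \<and> \<eta> \<in> continuous_hom G (unit_group A) \<and>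
     (\<forall>(B :: ('a \<Rightarrow> complex) top_algebra) f.
        weakly_complete_algebra B \<longrightarrow> f \<in> continuous_hom G (unit_group B) \<longrightarrow>
        (\<exists>!F. F \<in> algebra_hom A B \<and> F \<in> extensional (carrier A) \<and>
              (\<forall>g\<in>carrier G. F (\<eta> g) = f g)))"

text \<open>The universal weakly complete space for continuous bilinear maps. The test spaces are bounded
  as in the preceding definition.\<close>

definition tensor_product ::
  "'a top_algebra \<Rightarrow> 'b top_algebra \<Rightarrow> 'e top_algebra \<Rightarrow> ('a \<Rightarrow> 'b \<Rightarrow> 'e) \<Rightarrow> bool" where
  "tensor_product V W E t \<longleftrightarrow>
     weakly_complete_space E \<and> t \<in> continuous_bilinear V W E \<and>
     (\<forall>(U :: ('e \<Rightarrow> complex) top_algebra) b.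
        weakly_complete_space U \<longrightarrow> b \<in> continuous_bilinear V W U \<longrightarrow>
        (\<exists>!L. L \<in> continuous_linear E U \<and> L \<in> extensional (carrier E) \<and>
              (\<forall>v\<in>carrier V. \<forall>w\<in>carrier W. L (t v w) = b v w)))"

definition tensor_algebra ::
  "'a top_algebra \<Rightarrow> 'b top_algebra \<Rightarrow> 'e top_algebra \<Rightarrow> ('a \<Rightarrow> 'b \<Rightarrow> 'e) \<Rightarrow> bool" where
  "tensor_algebra A B E t \<longleftrightarrow>
     tensor_product A B E t \<and> weakly_complete_algebra E \<and> \<one>\<^bsub>E\<^esub> = t \<one>\<^bsub>A\<^esub> \<one>\<^bsub>B\<^esub> \<and>
     (\<forall>a\<in>carrier A. \<forall>a'\<in>carrier A. \<forall>b\<in>carrier B. \<forall>b'\<in>carrier B.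
        t a b \<otimes>\<^bsub>E\<^esub> t a' b' = t (a \<otimes>\<^bsub>A\<^esub> a') (b \<otimes>\<^bsub>B\<^esub> b'))"

definition comultiplication ::
  "'g top_group \<Rightarrow> 'a top_algebra \<Rightarrow> ('g \<Rightarrow> 'a) \<Rightarrow> 'e top_algebra \<Rightarrow> ('a \<Rightarrow> 'a \<Rightarrow> 'e) \<Rightarrow>
   ('a \<Rightarrow> 'e) \<Rightarrow> bool" where
  "comultiplication G A \<eta> E t \<gamma> \<longleftrightarrow>
     \<gamma> \<in> algebra_hom A E \<and> (\<forall>g\<in>carrier G. \<gamma> (\<eta> g) = t (\<eta> g) (\<eta> g))"

definition coidentity ::
  "'g top_group \<Rightarrow> 'a top_algebra \<Rightarrow> ('g \<Rightarrow> 'a) \<Rightarrow> ('a \<Rightarrow> complex) \<Rightarrow> bool" where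
  "coidentity G A \<eta> k \<longleftrightarrow>
     k \<in> algebra_hom A complex_algebra \<and> (\<forall>g\<in>carrier G. k (\<eta> g) = 1)"

text \<open>\<open>\<real>[G]\<close> inside \<open>\<complex>[G]\<close>, as the closed real linear span of \<open>G\<close>.\<close>

definition real_span :: "'a top_algebra \<Rightarrow> 'a set \<Rightarrow> 'a set" where
  "real_span A S =
     {finsum A (\<lambda>s. complex_of_real (r s) \<odot>\<^bsub>A\<^esub> s) F |F r. finite F \<and> F \<subseteq> S}"

definition real_group_algebra :: "'g top_group \<Rightarrow> 'a top_algebra \<Rightarrow> ('g \<Rightarrow> 'a) \<Rightarrow> 'a set" where
  "real_group_algebra G A \<eta> =
     Abstract_Topology.closure_of (vtop A) (real_span A (\<eta> ` carrier G))"

definition grouplike_group ::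
  "'a top_algebra \<Rightarrow> ('a \<Rightarrow> 'a \<Rightarrow> 'e) \<Rightarrow> ('a \<Rightarrow> 'e) \<Rightarrow> ('a \<Rightarrow> complex) \<Rightarrow> 'a top_group" where
  "grouplike_group A t \<gamma> k =
     \<lparr>carrier = {a \<in> carrier A. \<gamma> a = t a a \<and> k a = 1},
      monoid.mult = monoid.mult A, one = one A,
      gtop = subtopology (vtop A) {a \<in> carrier A. \<gamma> a = t a a \<and> k a = 1}\<rparr>"

definition weakly_complete_lie_algebra :: "'a top_algebra \<Rightarrow> bool" where
  "weakly_complete_lie_algebra L \<longleftrightarrow>
     weakly_complete_space L \<and> (\<lambda>x y. x \<otimes>\<^bsub>L\<^esub> y) \<in> continuous_bilinear L L L \<and>
     (\<forall>x\<in>carrier L. x \<otimes>\<^bsub>L\<^esub> x = \<zero>\<^bsub>L\<^esub>) \<and>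
     (\<forall>x\<in>carrier L. \<forall>y\<in>carrier L. \<forall>z\<in>carrier L.
        x \<otimes>\<^bsub>L\<^esub> (y \<otimes>\<^bsub>L\<^esub> z) \<oplus>\<^bsub>L\<^esub> y \<otimes>\<^bsub>L\<^esub> (z \<otimes>\<^bsub>L\<^esub> x) \<oplus>\<^bsub>L\<^esub> z \<otimes>\<^bsub>L\<^esub> (x \<otimes>\<^bsub>L\<^esub> y) = \<zero>\<^bsub>L\<^esub>)"

text \<open>The subset \<open>S\<close> of \<open>A\<close> with the structure induced from \<open>A\<close> and the commutator bracket.\<close>

definition commutator_lie :: "'a top_algebra \<Rightarrow> 'a set \<Rightarrow> 'a top_algebra" where
  "commutator_lie A S =
     A\<lparr>carrier := S, monoid.mult := (\<lambda>a b. a \<otimes>\<^bsub>A\<^esub> b \<ominus>\<^bsub>A\<^esub> b \<otimes>\<^bsub>A\<^esub> a),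
       vtop := subtopology (vtop A) S\<rparr>"

definition lie_iso :: "'a top_algebra \<Rightarrow> 'b top_algebra \<Rightarrow> ('a \<Rightarrow> 'b) set" where
  "lie_iso L M =
     {f \<in> top_linear_iso L M. \<forall>x\<in>carrier L. \<forall>y\<in>carrier L. f (x \<otimes>\<^bsub>L\<^esub> y) = f x \<otimes>\<^bsub>M\<^esub> f y}"

definition primitive_lie ::
  "'a top_algebra \<Rightarrow> 'e top_algebra \<Rightarrow> ('a \<Rightarrow> 'a \<Rightarrow> 'e) \<Rightarrow> ('a \<Rightarrow> 'e) \<Rightarrow> 'a top_algebra" where
  "primitive_lie A E t \<gamma> =
     commutator_lie A {a \<in> carrier A. \<gamma> a = t a \<one>\<^bsub>A\<^esub> \<oplus>\<^bsub>E\<^esub> t \<one>\<^bsub>A\<^esub> a}"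

end

theory Submission
  imports Defs "HOL-Library.Function_Algebras"
begin

text \<open>A compact abelian group carries an invariant mean, obtained from finite averages of translates,
  which gives convolution on \<open>C(G)\<close>. Power iteration of a self-adjoint function under convolution
  converges to an idempotent; minimal idempotents are multiples of characters, so every nonzero
  continuous function has a nonzero Fourier coefficient. Hence translation-finite functions are
  trigonometric polynomials, and \<open>G\<close> is identified with \<open>Hom(D, S\<^sup>1)\<close>.

  A continuous functional on a power of \<open>\<complex>\<close> involves only finitely many coordinates, and similarly for
  bilinear forms. So a continuous functional on \<open>A\<close> restricts along \<open>\<eta>\<close> to a translation-finite
  function, a trigonometric polynomial. This lets one write down a right inverse of the map from
  \<open>A\<close> to the power of \<open>\<complex>\<close> over the characters whose components are the extensions of the characters,
  and the universal property makes it a two-sided inverse. The same argument treats the tensor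
  product. The remaining claims are identities between functionals, checked on the image of \<open>G\<close>,
  on which the functionals of the power of \<open>\<complex>\<close> are determined by orthogonality of characters.\<close>

text \<open>Two obstacles shape the proof. The universal properties in \<open>group_algebra\<close>
  and \<open>tensor_product\<close> range only over test objects with elements of type
  \<open>'a \<Rightarrow> complex\<close> or \<open>'e \<Rightarrow> complex\<close>. The power of
  \<complex> over the character group lives on another type, so they cannot be applied to it.
  Existence is therefore used only for scalar targets, encoded as a power over one point of the
  admissible type, and the functionals so obtained are assembled coordinatewise; uniqueness is used
  only to compare maps into a copy of \<open>A\<close> or \<open>E\<close> transported along a
  chart. Secondly, density of the span of \<eta> \<open>G\<close> in \<open>A\<close> is not given
  beforehand, so multiplicativity of the right inverse is proved from the side of the power of
  \<complex>, where functionals are finite sums. In the analysis, one estimate does the work of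
  compact operators: the sup norm of a convolution is at most the product of mean-square norms. It
  makes power iteration converge uniformly, and it bounds the squared norm of a nonzero idempotent
  below by 1, so that minimal idempotents exist.\<close>

lemma continuous_map_complex_mult:
  fixes f g :: "'x \<Rightarrow> complex"
  assumes "continuous_map X euclidean f" "continuous_map X euclidean g"
  shows "continuous_map X euclidean (\<lambda>x. f x * g x)"
  using assms by (simp add: continuous_map_atin tendsto_mult)

lemma continuous_map_cnj:
  assumes "continuous_map X euclidean f"
  shows "continuous_map X euclidean (\<lambda>x. cnj (f x))"
  using assms by (simp add: continuous_map_atin tendsto_cnj)

lemma continuous_map_of_real:
  assumes "continuous_map X euclideanreal f"
  shows "continuous_map X euclidean (\<lambda>x. complex_of_real (f x))"
  using assms by (simp add: continuous_map_atin tendsto_of_real)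

lemma continuous_map_Re:
  assumes "continuous_map X euclidean f"
  shows "continuous_map X euclideanreal (\<lambda>x. Re (f x))"
  using assms by (simp add: continuous_map_atin tendsto_Re)

lemma continuous_map_Im:
  assumes "continuous_map X euclidean f"
  shows "continuous_map X euclideanreal (\<lambda>x. Im (f x))"
  using assms by (simp add: continuous_map_atin tendsto_Im)

lemma continuous_map_const_euclidean: "continuous_map X euclidean (\<lambda>x. c)"
  by simp

lemma continuous_map_euclidean_metric:
  fixes f :: "'x \<Rightarrow> 'b::metric_space"
  shows "continuous_map X euclidean f \<longleftrightarrow>
    (\<forall>x\<in>topspace X. \<forall>e>0. \<exists>U. openin X U \<and> x \<in> U \<and> (\<forall>y\<in>U. dist (f x) (f y) < e))"
  unfolding mtopology_is_euclidean[symmetric] Met_TC.continuous_map_to_metric by simp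

text \<open>Tube lemma: the set of pairs on which \<open>F\<close> is within \<open>e\<close> of its
  value over \<open>y0\<close> is open and contains the whole slice over \<open>y0\<close>, so
  compactness of \<open>X\<close> fits a product neighbourhood inside. This is the source of uniform
  continuity on the group and of continuity of means in a parameter.\<close>

lemma compact_uniform_nbhd:
  fixes F :: "'x \<times> 'y \<Rightarrow> 'b::real_normed_vector"
  assumes "compact_space X" and F: "continuous_map (prod_topology X Y) euclidean F"
    and y0: "y0 \<in> topspace Y" and e: "e > 0"
  obtains U where "openin Y U" "y0 \<in> U"
    "\<And>x y. x \<in> topspace X \<Longrightarrow> y \<in> U \<Longrightarrow> norm (F (x, y) - F (x, y0)) < e"
proof -
  define H where "H = (\<lambda>(x, y). norm (F (x, y) - F (x, y0)))"
  have s: "continuous_map (prod_topology X Y) (prod_topology X Y) (\<lambda>z. (fst z, y0))"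
    using y0 by (intro continuous_map_pairedI continuous_map_fst) auto
  have "continuous_map (prod_topology X Y) euclidean (\<lambda>z. F (fst z, y0))"
    using continuous_map_compose[OF s F] by (simp add: o_def)
  then have "continuous_map (prod_topology X Y) euclideanreal (\<lambda>z. norm (F z - F (fst z, y0)))"
    using F by (intro continuous_map_norm continuous_map_diff)
  then have H: "continuous_map (prod_topology X Y) euclideanreal H"
    by (simp add: H_def case_prod_beta')
  define W where "W = {z \<in> topspace (prod_topology X Y). H z \<in> {..<e}}"
  have W: "openin (prod_topology X Y) W"
    unfolding W_def by (rule openin_continuous_map_preimage[OF H]) auto
  have "topspace X \<times> {y0} \<subseteq> W" using y0 e by (auto simp: W_def H_def)
  moreover have "compactin X (topspace X)" "compactin Y {y0}"
    using y0 assms(1) by (simp_all add: compact_space_def)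
  ultimately obtain U V where UV: "openin X U" "openin Y V" "topspace X \<subseteq> U" "{y0} \<subseteq> V" "U \<times> V \<subseteq> W"
    using Wallace_theorem_prod_topology[OF _ _ W] by metis
  show ?thesis
  proof (rule that[OF UV(2)])
    show "y0 \<in> V" using UV by auto
    fix x y assume "x \<in> topspace X" "y \<in> V"
    then have "(x, y) \<in> U \<times> V" using UV by auto
    then show "norm (F (x, y) - F (x, y0)) < e" using UV(5) by (auto simp: W_def H_def)
  qed
qed

lemma compact_map_bounded:
  fixes f :: "'x \<Rightarrow> 'b::real_normed_vector"
  assumes "compact_space X" "continuous_map X euclidean f"
  obtains B where "B > 0" "\<And>x. x \<in> topspace X \<Longrightarrow> norm (f x) \<le> B"
proof -
  have "compactin euclidean (f ` topspace X)"
    using assms image_compactin unfolding compact_space_def by blast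
  then have "bounded (f ` topspace X)" by (simp add: compact_imp_bounded)
  then show ?thesis using that unfolding bounded_pos by auto
qed

section \<open>Averages over translates\<close>

locale compact_ab_group =
  fixes G :: "'g top_group" (structure)
  assumes compact_abelian: "compact_abelian_group G"
begin

abbreviation "X \<equiv> gtop G"

sublocale comm_group G
  using compact_abelian by (simp add: compact_abelian_group_def)

lemma topspace_G [simp]: "topspace X = carrier G"
  using compact_abelian by (simp add: compact_abelian_group_def topological_group_def)

lemma compact_G: "compact_space X" and Hausdorff_G: "Hausdorff_space X"
  using compact_abelian by (simp_all add: compact_abelian_group_def)

lemma continuous_mult [continuous_intros]:
  assumes "continuous_map Y X a" "continuous_map Y X b"
  shows "continuous_map Y X (\<lambda>y. a y \<otimes> b y)"
proof -
  have m: "continuous_map (prod_topology X X) X (\<lambda>(x, y). x \<otimes> y)"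
    using compact_abelian by (simp add: compact_abelian_group_def topological_group_def)
  have "continuous_map Y (prod_topology X X) (\<lambda>y. (a y, b y))"
    using assms by (rule continuous_map_pairedI)
  from continuous_map_compose[OF this m] show ?thesis by (simp add: o_def)
qed

lemma continuous_inv [continuous_intros]:
  assumes "continuous_map Y X a"
  shows "continuous_map Y X (\<lambda>y. inv (a y))"
proof -
  have m: "continuous_map X X (\<lambda>x. inv x)"
    using compact_abelian by (simp add: compact_abelian_group_def topological_group_def)
  from continuous_map_compose[OF assms m] show ?thesis by (simp add: o_def)
qed

abbreviation cts :: "('g \<Rightarrow> 'b::topological_space) \<Rightarrow> bool" where
  "cts f \<equiv> continuous_map X euclidean f"

lemma cts_compose:
  assumes "continuous_map X euclidean f" "continuous_map Y X a"
  shows "continuous_map Y euclidean (\<lambda>y. f (a y))"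
  using continuous_map_compose[OF assms(2,1)] by (simp add: o_def)

lemma cts_translate:
  assumes "cts f" "a \<in> carrier G" shows "cts (\<lambda>x. f (x \<otimes> a))"
  by (rule cts_compose[OF assms(1)]) (use assms in \<open>auto intro!: continuous_intros\<close>)

lemma cts_inv: "cts f \<Longrightarrow> cts (\<lambda>x. f (inv x))"
  by (rule cts_compose) (auto intro!: continuous_intros)

lemma cts_bounded:
  fixes f :: "'g \<Rightarrow> 'b::real_normed_vector"
  assumes "cts f" obtains B where "B > 0" "\<And>x. x \<in> carrier G \<Longrightarrow> norm (f x) \<le> B"
  using compact_map_bounded[OF compact_G assms] by auto

text \<open>Translates are indexed by lists, so that repetitions carry weight and an average of
  averages is again an average (\<open>avg_avg\<close>). The value field is left open because
  existence of the mean is proved with the order of the reals and then transferred to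
  \<complex>.\<close>

definition avg :: "'g list \<Rightarrow> ('g \<Rightarrow> 'b::real_normed_field) \<Rightarrow> 'g \<Rightarrow> 'b" where
  "avg xs f x = (\<Sum>i<length xs. f (x \<otimes> xs ! i)) / of_nat (length xs)"

definition listG :: "'g list \<Rightarrow> bool" where
  "listG xs \<longleftrightarrow> xs \<noteq> [] \<and> set xs \<subseteq> carrier G"

lemma listG_nth: "listG xs \<Longrightarrow> i < length xs \<Longrightarrow> xs ! i \<in> carrier G"
  by (auto simp: listG_def)

lemma listG_pos: "listG xs \<Longrightarrow> length xs > 0"
  by (auto simp: listG_def)

lemma listG_single: "a \<in> carrier G \<Longrightarrow> listG [a]"
  by (auto simp: listG_def)

lemma avg_cong:
  assumes "listG xs" "x \<in> carrier G" "\<And>x. x \<in> carrier G \<Longrightarrow> f x = h x"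
  shows "avg xs f x = avg xs h x"
  using assms unfolding avg_def by (auto intro!: arg_cong2[where f="(/)"] sum.cong simp: listG_nth)

text \<open>Commutativity of the group enters the theory of means here. Additivity and uniqueness of
  the mean rest on it.\<close>

lemma avg_commute:
  assumes "listG xs" "listG ys" "x \<in> carrier G"
  shows "avg xs (avg ys f) x = avg ys (avg xs f) x"
proof -
  have "(\<Sum>i<length xs. \<Sum>j<length ys. f (x \<otimes> xs ! i \<otimes> ys ! j)) =
        (\<Sum>j<length ys. \<Sum>i<length xs. f (x \<otimes> ys ! j \<otimes> xs ! i))"
    by (subst sum.swap) (use assms in \<open>auto intro!: sum.cong simp: m_ac listG_nth\<close>)
  then show ?thesis by (simp add: avg_def flip: sum_divide_distrib)
qed

text \<open>A further averaging never spoils an estimate that holds at all points; this is why lists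
  chosen for different functions can be merged.\<close>

lemma avg_near:
  assumes "listG xs" "x \<in> carrier G" "\<And>x. x \<in> carrier G \<Longrightarrow> norm (f x - c) \<le> e"
  shows "norm (avg xs f x - c) \<le> e"
proof -
  have n: "length xs > 0" using assms listG_pos by auto
  have "avg xs f x - c = (\<Sum>i<length xs. f (x \<otimes> xs ! i) - c) / of_nat (length xs)"
    using n by (simp add: avg_def sum_subtractf diff_divide_distrib)
  also have "norm \<dots> \<le> (\<Sum>i<length xs. e) / of_nat (length xs)"
    unfolding norm_divide norm_of_nat
    by (intro divide_right_mono sum_norm_le) (use assms in \<open>auto simp: listG_nth\<close>)
  finally show ?thesis using n by simp
qed

lemma avg_add: "avg xs (\<lambda>x. f x + h x) x = avg xs f x + avg xs h x"
  by (simp add: avg_def sum.distrib add_divide_distrib)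

lemma avg_cmult: "avg xs (\<lambda>x. c * f x) x = c * avg xs f x"
  by (simp add: avg_def sum_distrib_left)

lemma avg_diff: "avg xs (\<lambda>x. f x - h x) x = avg xs f x - avg xs h x"
  by (simp add: avg_def sum_subtractf diff_divide_distrib)

lemma avg_const: "listG xs \<Longrightarrow> avg xs (\<lambda>x. c) x = c"
  using listG_pos by (simp add: avg_def)

definition list_mult :: "'g list \<Rightarrow> 'g list \<Rightarrow> 'g list" where
  "list_mult xs ys = map (\<lambda>k. xs ! (k div length ys) \<otimes> ys ! (k mod length ys)) [0..<length xs * length ys]"

lemma listG_list_mult:
  assumes "listG xs" "listG ys" shows "listG (list_mult xs ys)"
proof -
  have "xs ! (k div length ys) \<otimes> ys ! (k mod length ys) \<in> carrier G" if "k < length xs * length ys" for k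
    using that listG_pos[OF assms(2)] by (intro m_closed listG_nth assms) (auto simp: less_mult_imp_div_less)
  then show ?thesis using listG_pos[OF assms(1)] listG_pos[OF assms(2)] by (auto simp: listG_def list_mult_def)
qed

lemma avg_avg:
  assumes "listG xs" "listG ys" "x \<in> carrier G"
  shows "avg xs (avg ys f) x = avg (list_mult xs ys) f x"
proof -
  define n m where "n = length xs" and "m = length ys"
  have nm: "n > 0" "m > 0" using assms listG_pos by (auto simp: n_def m_def)
  have dm: "k div m < n" "k mod m < m" if "k < n * m" for k
    using that nm by (auto simp: less_mult_imp_div_less)
  have lt: "i * m + j < n * m" if "i < n" "j < m" for i j
  proof -
    have "i * m + j < Suc i * m" using that by simp
    also have "\<dots> \<le> n * m" using that by (intro mult_le_mono1) simp
    finally show ?thesis .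
  qed
  have "(\<Sum>i<n. \<Sum>j<m. f (x \<otimes> xs ! i \<otimes> ys ! j)) = (\<Sum>(i,j)\<in>{..<n}\<times>{..<m}. f (x \<otimes> xs ! i \<otimes> ys ! j))"
    by (simp add: sum.cartesian_product)
  also have "\<dots> = (\<Sum>k<n*m. f (x \<otimes> xs ! (k div m) \<otimes> ys ! (k mod m)))"
    by (rule sum.reindex_bij_witness[where i="\<lambda>k. (k div m, k mod m)" and j="\<lambda>(i,j). i * m + j"])
      (use nm lt dm in auto)
  also have "\<dots> = (\<Sum>k<n*m. f (x \<otimes> list_mult xs ys ! k))"
    using assms dm by (intro sum.cong) (auto simp: list_mult_def m_assoc listG_nth n_def m_def)
  finally show ?thesis by (simp add: avg_def list_mult_def n_def m_def flip: sum_divide_distrib)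
qed

text \<open>Any point \<open>x\<close> is moved into \<open>U\<close> by
  \<open>inv x \<otimes> u\<close>. So the open sets of points that a fixed \<open>g\<close> moves
  into \<open>U\<close> cover the group, and finitely many of them suffice.\<close>

lemma finite_translate_cover:
  assumes "openin X U" "u \<in> U"
  obtains gs where "listG gs" "\<And>x. x \<in> carrier G \<Longrightarrow> \<exists>i<length gs. x \<otimes> gs ! i \<in> U"
proof -
  have Uc: "U \<subseteq> carrier G" using assms openin_subset by fastforce
  define V where "V g = {x \<in> carrier G. x \<otimes> g \<in> U}" for g
  have V: "openin X (V g)" if "g \<in> carrier G" for g
  proof -
    have "continuous_map X X (\<lambda>x. x \<otimes> g)" using that by (auto intro!: continuous_intros)
    from openin_continuous_map_preimage[OF this assms(1)] show ?thesis by (simp add: V_def)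
  qed
  have "\<exists>\<F>. finite \<F> \<and> \<F> \<subseteq> V ` carrier G \<and> carrier G \<subseteq> \<Union>\<F>"
  proof (rule compactinD)
    show "compactin X (carrier G)" using compact_G by (simp add: compact_space_def)
    show "carrier G \<subseteq> \<Union> (V ` carrier G)"
    proof
      fix x assume x: "x \<in> carrier G"
      then have "x \<in> V (inv x \<otimes> u)" using assms Uc by (auto simp: V_def simp flip: m_assoc)
      then show "x \<in> \<Union> (V ` carrier G)" using x assms Uc by blast
    qed
  qed (use V in auto)
  then obtain F where F: "finite F" "F \<subseteq> carrier G" "carrier G \<subseteq> \<Union> (V ` F)"
    by (metis finite_subset_image)
  obtain gs where gs: "set gs = F" using F(1) finite_list by blast
  show ?thesis
  proof (rule that)
    show "listG gs" using gs F one_closed by (auto simp: listG_def)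
    fix x assume "x \<in> carrier G"
    then obtain g where "g \<in> F" "x \<otimes> g \<in> U" using F by (auto simp: V_def)
    then show "\<exists>i<length gs. x \<otimes> gs ! i \<in> U" using gs by (metis in_set_conv_nth)
  qed
qed

lemma uniformly_continuous:
  fixes f :: "'g \<Rightarrow> 'b::real_normed_vector"
  assumes "cts f" "e > 0"
  obtains U where "openin X U" "\<one> \<in> U"
    "\<And>x u. x \<in> carrier G \<Longrightarrow> u \<in> U \<Longrightarrow> norm (f (x \<otimes> u) - f x) < e"
proof -
  have c: "continuous_map (prod_topology X X) euclidean (\<lambda>z. f (fst z \<otimes> snd z))"
    by (rule cts_compose[OF assms(1)]) (auto intro!: continuous_intros)
  have 1: "\<one> \<in> topspace X" by simp
  obtain U where U: "openin X U" "\<one> \<in> U"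
    "\<And>x y. x \<in> topspace X \<Longrightarrow> y \<in> U \<Longrightarrow> norm (f (fst (x, y) \<otimes> snd (x, y)) - f (fst (x, \<one>) \<otimes> snd (x, \<one>))) < e"
    using compact_uniform_nbhd[OF compact_G c 1 assms(2)] by blast
  show ?thesis
    by (rule that[OF U(1,2)]) (use U(3) in auto)
qed

text \<open>The Haar integral without measures: \<open>c\<close> is the constant that averages of
  translates of \<open>f\<close> approach uniformly.\<close>

definition is_mean :: "('g \<Rightarrow> 'b::real_normed_field) \<Rightarrow> 'b \<Rightarrow> bool" where
  "is_mean f c \<longleftrightarrow> (\<forall>e>0. \<exists>xs. listG xs \<and> (\<forall>x\<in>carrier G. norm (avg xs f x - c) \<le> e))"

text \<open>The value is \<open>p\<close>, the infimum of all constants that bound some average of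
  \<open>f\<close> from above. An average \<open>h\<close> with bound close to \<open>p\<close>
  cannot dip below \<open>p - 2 * d\<close>: uniform continuity spreads a dip over a translate of a
  fixed neighbourhood \<open>U\<close>, and averaging again over finitely many translates that bring
  every point into the dip would push the bound strictly below \<open>p\<close>.\<close>

lemma is_mean_real_exists:
  fixes f :: "'g \<Rightarrow> real"
  assumes f: "cts f"
  shows "\<exists>c. is_mean f c"
proof -
  define S where "S = {s. \<exists>xs. listG xs \<and> (\<forall>x\<in>carrier G. avg xs f x \<le> s)}"
  define p where "p = Inf S"
  obtain B where B: "\<And>x. x \<in> carrier G \<Longrightarrow> norm (f x) \<le> B" using cts_bounded[OF f] by blast
  have nB: "norm (avg xs f \<one>) \<le> B" if "listG xs" for xs
    using avg_near[OF that one_closed, of f 0 B] B by auto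
  have bdd: "bdd_below S"
  proof (rule bdd_belowI[of _ "-B"])
    fix s assume "s \<in> S"
    then obtain xs where "listG xs" "avg xs f \<one> \<le> s" by (auto simp: S_def)
    then show "- B \<le> s" using nB[of xs] by auto
  qed
  have "B \<in> S"
  proof -
    have "avg [\<one>] f x \<le> B" if "x \<in> carrier G" for x using B[OF that] that by (auto simp: avg_def)
    then show ?thesis using listG_single[OF one_closed] by (auto simp: S_def)
  qed
  then have ne: "S \<noteq> {}" by auto
  have "is_mean f p"
    unfolding is_mean_def
  proof (intro allI impI)
    fix e :: real assume e: "e > 0"
    define d where "d = e / 2"
    have d: "d > 0" using e by (simp add: d_def)
    obtain U where U: "openin X U" "\<one> \<in> U"
      and Uf: "\<And>x u. x \<in> carrier G \<Longrightarrow> u \<in> U \<Longrightarrow> norm (f (x \<otimes> u) - f x) < d"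
      using uniformly_continuous[OF f d] by blast
    have Uc: "U \<subseteq> carrier G" using U openin_subset by fastforce
    obtain gs where gs: "listG gs" "\<And>x. x \<in> carrier G \<Longrightarrow> \<exists>i<length gs. x \<otimes> gs ! i \<in> U"
      using finite_translate_cover[OF U] by blast
    define m where "m = real (length gs)"
    have m: "m \<ge> 1" using listG_pos[OF gs(1)] by (simp add: m_def Suc_le_eq)
    \<comment> \<open>Among \<open>m\<close> translates one value will lie below
      \<open>p - d\<close> and the other \<open>m - 1\<close> may exceed \<open>p\<close> by at most
      \<open>r\<close>. This \<open>r\<close> keeps the total excess below \<open>d / 2\<close>, so
      the sum stays \<open>d / 2\<close> below \<open>m * p\<close>.\<close>
    define r where "r = d / (2 * m)"
    have r: "r > 0" using d m by (simp add: r_def)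
    have "\<exists>s\<in>S. s < p + r" using ne bdd r by (auto simp: p_def simp flip: cInf_less_iff)
    then obtain xs where xs: "listG xs" and ub: "\<And>x. x \<in> carrier G \<Longrightarrow> avg xs f x \<le> p + r"
      by (force simp: S_def)
    define h where "h = avg xs f"
    \<comment> \<open>Averages inherit the modulus of continuity of \<open>f\<close>. Hence
      \<open>U\<close>, and with it \<open>gs\<close>, \<open>m\<close> and \<open>r\<close>, could
      be fixed before the average \<open>h\<close> was chosen.\<close>
    have hU: "h (x \<otimes> u) < h x + d" if "x \<in> carrier G" "u \<in> U" for x u
    proof -
      have u: "u \<in> carrier G" using that Uc by auto
      have "(\<Sum>i<length xs. f (x \<otimes> u \<otimes> xs ! i)) < (\<Sum>i<length xs. f (x \<otimes> xs ! i) + d)"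
      proof (intro sum_strict_mono)
        fix i assume "i \<in> {..<length xs}"
        then have i: "xs ! i \<in> carrier G" using listG_nth xs by auto
        have "x \<otimes> u \<otimes> xs ! i = x \<otimes> xs ! i \<otimes> u" using i u that by (simp add: m_ac)
        then show "f (x \<otimes> u \<otimes> xs ! i) < f (x \<otimes> xs ! i) + d"
          using Uf[of "x \<otimes> xs ! i" u] i u that by auto
      qed (use listG_pos[OF xs] in auto)
      then show ?thesis using listG_pos[OF xs]
        by (simp add: h_def avg_def sum.distrib field_simps)
    qed
    have lower: "p - 2 * d \<le> h x0" if x0: "x0 \<in> carrier G" for x0
    proof (rule ccontr)
      assume "\<not> p - 2 * d \<le> h x0"
      then have lt: "h x0 < p - 2 * d" by simp
      have bound: "avg gs h x \<le> p - d / (2 * m)" if x: "x \<in> carrier G" for x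
      proof -
        \<comment> \<open>The cover is applied at \<open>inv x0 \<otimes> x\<close>, so that some
          translate of \<open>x\<close> lands in the translate of \<open>U\<close> by the dip
          \<open>x0\<close>.\<close>
        have "inv x0 \<otimes> x \<in> carrier G" using x x0 by auto
        then obtain i where i: "i < length gs" "inv x0 \<otimes> x \<otimes> gs ! i \<in> U" using gs(2) by blast
        have gi: "gs ! i \<in> carrier G" using i gs listG_nth by auto
        have "x0 \<otimes> (inv x0 \<otimes> x \<otimes> gs ! i) = x \<otimes> gs ! i"
          using x x0 gi by (simp flip: m_assoc)
        then have hi: "h (x \<otimes> gs ! i) < p - d" using hU[OF x0 i(2)] lt by auto
        have "(\<Sum>j<length gs. h (x \<otimes> gs ! j)) = h (x \<otimes> gs ! i) + (\<Sum>j\<in>{..<length gs} - {i}. h (x \<otimes> gs ! j))"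
          using i by (intro sum.remove) auto
        also have "\<dots> \<le> (p - d) + (\<Sum>j\<in>{..<length gs} - {i}. p + r)"
          by (intro add_mono sum_mono) (use hi ub x gs listG_nth in \<open>auto simp: h_def\<close>)
        also have "\<dots> = (p - d) + (m - 1) * (p + r)"
          using i by (simp add: m_def of_nat_diff)
        also have "\<dots> \<le> m * (p - d / (2 * m))"
        proof -
          have "(m - 1) * r \<le> d / 2" using d m by (simp add: r_def field_simps)
          then show ?thesis using m by (simp add: algebra_simps)
        qed
        finally have "(\<Sum>j<length gs. h (x \<otimes> gs ! j)) \<le> m * (p - d / (2 * m))" .
        then have "(\<Sum>j<length gs. h (x \<otimes> gs ! j)) / m \<le> p - d / (2 * m)"
          using m by (simp add: pos_divide_le_eq mult.commute)
        then show ?thesis by (simp add: avg_def m_def)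
      qed
      have "p - d / (2 * m) \<in> S"
        unfolding S_def using bound avg_avg[OF gs(1) xs, of _ f] listG_list_mult[OF gs(1) xs]
        by (auto simp: h_def intro!: exI[of _ "list_mult gs xs"])
      then have "p \<le> p - d / (2 * m)" unfolding p_def using bdd by (rule cInf_lower)
      then show False using d m by (simp add: field_simps)
    qed
    have "r \<le> e" using m d e by (simp add: r_def d_def field_simps)
    then have "\<forall>x\<in>carrier G. norm (avg xs f x - p) \<le> e"
      using lower ub by (force simp: h_def d_def abs_le_iff)
    then show "\<exists>xs. listG xs \<and> (\<forall>x\<in>carrier G. norm (avg xs f x - p) \<le> e)" using xs by auto
  qed
  then show ?thesis by blast
qed

lemma avg_of_real: "avg xs (\<lambda>x. complex_of_real (f x)) x = complex_of_real (avg xs f x)"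
  by (simp add: avg_def)

lemma is_mean_of_real:
  "is_mean f c \<Longrightarrow> is_mean (\<lambda>x. complex_of_real (f x)) (complex_of_real c)"
  unfolding is_mean_def avg_of_real by (simp flip: of_real_diff)

lemma is_mean_cmult:
  assumes "is_mean f c" shows "is_mean (\<lambda>x. a * f x) (a * c)"
  unfolding is_mean_def avg_cmult
proof (intro allI impI)
  fix e :: real assume e: "e > 0"
  then have "e / (norm a + 1) > 0" by (simp add: add_nonneg_pos)
  then obtain xs where xs: "listG xs" "\<forall>x\<in>carrier G. norm (avg xs f x - c) \<le> e / (norm a + 1)"
    using assms unfolding is_mean_def by blast
  have "norm (a * avg xs f x - a * c) \<le> e" if "x \<in> carrier G" for x
  proof -
    have "norm (a * avg xs f x - a * c) = norm a * norm (avg xs f x - c)"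
      by (simp flip: norm_mult right_diff_distrib)
    also have "\<dots> \<le> (norm a + 1) * (e / (norm a + 1))"
      using xs that by (intro mult_mono) auto
    finally show ?thesis by (simp add: add_nonneg_eq_0_iff split: if_splits)
  qed
  then show "\<exists>xs. listG xs \<and> (\<forall>x\<in>carrier G. norm (a * avg xs f x - a * c) \<le> e)" using xs by blast
qed

text \<open>Each list is good for one of the two functions. Averages commute, so in the combined
  average the good list can be taken as the inner one for either function, and the outer list
  preserves its estimate by \<open>avg_near\<close>.\<close>

lemma is_mean_add:
  assumes "is_mean f c" "is_mean h d" shows "is_mean (\<lambda>x. f x + h x) (c + d)"
  unfolding is_mean_def
proof (intro allI impI)
  fix e :: real assume e: "e > 0"
  obtain xs where xs: "listG xs" "\<forall>x\<in>carrier G. norm (avg xs f x - c) \<le> e / 2"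
    using assms(1) e unfolding is_mean_def by (meson half_gt_zero)
  obtain ys where ys: "listG ys" "\<forall>x\<in>carrier G. norm (avg ys h x - d) \<le> e / 2"
    using assms(2) e unfolding is_mean_def by (meson half_gt_zero)
  define zs where "zs = list_mult xs ys"
  have zs: "listG zs" "\<And>f x. x \<in> carrier G \<Longrightarrow> avg xs (avg ys f) x = avg zs (f :: 'g \<Rightarrow> 'a) x"
    using avg_avg listG_list_mult xs(1) ys(1) by (auto simp: zs_def)
  have "norm (avg zs (\<lambda>x. f x + h x) x - (c + d)) \<le> e" if x: "x \<in> carrier G" for x
  proof -
    have 1: "norm (avg xs (avg ys h) x - d) \<le> e/2"
      by (rule avg_near[OF xs(1) x]) (use ys in auto)
    have 2: "norm (avg ys (avg xs f) x - c) \<le> e/2"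
      by (rule avg_near[OF ys(1) x]) (use xs in auto)
    have "avg zs (\<lambda>x. f x + h x) x - (c + d) = (avg ys (avg xs f) x - c) + (avg xs (avg ys h) x - d)"
      using zs(2)[OF x, of f] zs(2)[OF x, of h] avg_commute[OF xs(1) ys(1) x, of f] by (simp add: avg_add)
    also have "norm \<dots> \<le> e/2 + e/2" by (intro norm_triangle_le add_mono 1 2)
    finally show ?thesis by simp
  qed
  then show "\<exists>xs. listG xs \<and> (\<forall>x\<in>carrier G. norm (avg xs (\<lambda>x. f x + h x) x - (c + d)) \<le> e)"
    using zs(1) by blast
qed

text \<open>By additivity \<open>c - d\<close> is a mean of the zero function, all of whose averages
  vanish.\<close>

lemma is_mean_unique:
  assumes "is_mean f c" "is_mean f d" shows "c = d"
proof -
  have "is_mean (\<lambda>x. f x + (-1) * f x) (c + (-1) * d)"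
    by (intro is_mean_add is_mean_cmult assms)
  then have z: "is_mean (\<lambda>x. 0) (c - d)" by simp
  have "norm (c - d) \<le> 0 + e" if "e > 0" for e
  proof -
    obtain xs where "listG xs" "norm (avg xs (\<lambda>x. 0) \<one> - (c - d)) \<le> e"
      using z \<open>e > 0\<close> one_closed unfolding is_mean_def by meson
    then show ?thesis using avg_const[of xs "0 :: 'a" \<one>] norm_minus_cancel[of "c - d"] by simp
  qed
  then have "norm (c - d) \<le> 0" by (rule field_le_epsilon)
  then show ?thesis by simp
qed

section \<open>The invariant mean as a positive linear functional\<close>

definition mean :: "('g \<Rightarrow> complex) \<Rightarrow> complex" where
  "mean f = (THE c. is_mean f c)"

lemma mean_eqI: "is_mean f c \<Longrightarrow> mean f = c"
  unfolding mean_def using is_mean_unique by blast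

lemma is_mean_cong:
  assumes "\<And>x. x \<in> carrier G \<Longrightarrow> f x = h x"
  shows "is_mean f c \<longleftrightarrow> is_mean h c"
proof -
  have "avg xs f x = avg xs h x" if "listG xs" "x \<in> carrier G" for xs x
    using that assms by (rule avg_cong)
  then show ?thesis unfolding is_mean_def by (simp cong: conj_cong ball_cong)
qed

lemma mean_cong: "(\<And>x. x \<in> carrier G \<Longrightarrow> f x = h x) \<Longrightarrow> mean f = mean h"
  unfolding mean_def by (intro arg_cong[where f=The] ext is_mean_cong)

lemma is_mean_mean:
  assumes "cts f" shows "is_mean f (mean f)"
proof -
  obtain a where a: "is_mean (\<lambda>x. Re (f x)) a"
    using is_mean_real_exists[OF continuous_map_Re[OF assms]] by blast
  obtain b where b: "is_mean (\<lambda>x. Im (f x)) b"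
    using is_mean_real_exists[OF continuous_map_Im[OF assms]] by blast
  then have "is_mean (\<lambda>x. complex_of_real (Re (f x)) + \<i> * complex_of_real (Im (f x))) (of_real a + \<i> * of_real b)"
    by (intro is_mean_add is_mean_cmult is_mean_of_real a b)
  then have "is_mean f (of_real a + \<i> * of_real b)" by (simp flip: complex_eq)
  then show ?thesis using mean_eqI by simp
qed

lemma mean_add: "cts f \<Longrightarrow> cts h \<Longrightarrow> mean (\<lambda>x. f x + h x) = mean f + mean h"
  by (intro mean_eqI is_mean_add is_mean_mean)

lemma mean_cmult: "cts f \<Longrightarrow> mean (\<lambda>x. c * f x) = c * mean f"
  by (intro mean_eqI is_mean_cmult is_mean_mean)

lemma mean_diff: 
  assumes "cts f" "cts h" shows "mean (\<lambda>x. f x - h x) = mean f - mean h"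
  using mean_add[OF assms(1), of "\<lambda>x. (-1) * h x"] mean_cmult[OF assms(2), of "-1"] assms(2)
  by (simp add: continuous_map_minus)

lemma is_mean_const: "is_mean (\<lambda>x. c) c"
  unfolding is_mean_def using listG_single[OF one_closed] by (auto simp: avg_const intro!: exI[of _ "[\<one>]"])

lemma mean_const [simp]: "mean (\<lambda>x. c) = c"
  by (rule mean_eqI[OF is_mean_const])

lemma mean_sum:
  assumes "\<And>i. i \<in> I \<Longrightarrow> cts (f i)"
  shows "mean (\<lambda>x. \<Sum>i\<in>I. f i x) = (\<Sum>i\<in>I. mean (f i))"
  using assms
proof (induction I rule: infinite_finite_induct)
  case (insert i I)
  then show ?case
    by (simp add: mean_add continuous_map_sum)
qed auto

lemma mean_bound:
  assumes "cts f" "\<And>x. x \<in> carrier G \<Longrightarrow> norm (f x) \<le> B"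
  shows "norm (mean f) \<le> B"
proof (rule field_le_epsilon)
  fix e :: real assume "e > 0"
  then obtain xs where xs: "listG xs" "norm (avg xs f \<one> - mean f) \<le> e"
    using is_mean_mean[OF assms(1)] one_closed unfolding is_mean_def by meson
  have "norm (avg xs f \<one>) \<le> B" using avg_near[OF xs(1) one_closed, of f 0 B] assms by auto
  then show "norm (mean f) \<le> B + e" using xs(2) norm_triangle_ineq3[of "avg xs f \<one>" "mean f"] by linarith
qed

lemma mean_cnj: "cts f \<Longrightarrow> mean (\<lambda>x. cnj (f x)) = cnj (mean f)"
proof (rule mean_eqI)
  assume "cts f"
  have "avg xs (\<lambda>x. cnj (f x)) x = cnj (avg xs f x)" for xs x by (simp add: avg_def)
  moreover have "norm (cnj a - cnj b) = norm (a - b)" for a b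
    by (metis complex_cnj_diff complex_mod_cnj)
  ultimately show "is_mean (\<lambda>x. cnj (f x)) (cnj (mean f))"
    using is_mean_mean[OF \<open>cts f\<close>] unfolding is_mean_def by simp
qed

lemma mean_translate:
  assumes "cts f" "a \<in> carrier G"
  shows "mean (\<lambda>x. f (x \<otimes> a)) = mean f"
proof (rule mean_eqI)
  have "avg xs (\<lambda>x. f (x \<otimes> a)) x = avg xs f (x \<otimes> a)" if "listG xs" "x \<in> carrier G" for xs x
    unfolding avg_def using that assms
    by (auto intro!: arg_cong2[where f="(/)"] sum.cong arg_cong[where f=f] simp: m_ac listG_nth)
  then show "is_mean (\<lambda>x. f (x \<otimes> a)) (mean f)"
    using is_mean_mean[OF assms(1)] assms(2) unfolding is_mean_def
    by (simp cong: conj_cong ball_cong) (meson m_closed)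
qed

lemma mean_inv:
  assumes "cts f"
  shows "mean (\<lambda>x. f (inv x)) = mean f"
proof (rule mean_eqI)
  show "is_mean (\<lambda>x. f (inv x)) (mean f)"
    unfolding is_mean_def
  proof (intro allI impI)
    fix e :: real assume "e > 0"
    then obtain xs where xs: "listG xs" "\<forall>x\<in>carrier G. norm (avg xs f x - mean f) \<le> e"
      using is_mean_mean[OF assms(1)] unfolding is_mean_def by meson
    have "avg (map (\<lambda>x. inv x) xs) (\<lambda>x. f (inv x)) x = avg xs f (inv x)" if "x \<in> carrier G" for x
      unfolding avg_def using that xs
      by (auto intro!: arg_cong2[where f="(/)"] sum.cong arg_cong[where f=f] simp: inv_mult listG_nth)
    moreover have "listG (map (\<lambda>x. inv x) xs)" using xs by (auto simp: listG_def)
    ultimately show "\<exists>xs. listG xs \<and> (\<forall>x\<in>carrier G. norm (avg xs (\<lambda>x. f (inv x)) x - mean f) \<le> e)"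
      using xs by (intro exI[of _ "map (\<lambda>x. inv x) xs"]) simp
  qed
qed

lemma cts_avg:
  fixes f :: "'g \<Rightarrow> complex"
  assumes "cts f" "listG xs" shows "cts (avg xs f)"
proof -
  have "cts (\<lambda>x. (1 / of_nat (length xs)) * (\<Sum>i<length xs. f (x \<otimes> xs ! i)))"
    by (intro continuous_map_complex_mult continuous_map_sum cts_translate[OF assms(1)])
       (use assms in \<open>auto simp: listG_nth\<close>)
  then show ?thesis by (simp add: avg_def[abs_def])
qed

lemma mean_avg:
  assumes "cts f" "listG xs" shows "mean (avg xs f) = mean f"
proof -
  have "mean (\<lambda>x. (1 / of_nat (length xs)) * (\<Sum>i<length xs. f (x \<otimes> xs ! i))) = 
     (1 / of_nat (length xs)) * (\<Sum>i<length xs. mean f)"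
    using assms(2) by (subst mean_cmult; (subst mean_sum)?)
      (auto intro!: continuous_map_sum cts_translate[OF assms(1)] simp: listG_nth mean_translate[OF assms(1)])
  then show ?thesis using listG_pos[OF assms(2)] by (simp add: avg_def[abs_def])
qed

text \<open>Positivity is a statement about real values, while linearity is already available for
  complex functions; reading the real mean off the complex one gives access to both.\<close>

definition rmean :: "('g \<Rightarrow> real) \<Rightarrow> real" where
  "rmean r = Re (mean (\<lambda>x. of_real (r x)))"

lemma is_mean_rmean: assumes "cts r" shows "is_mean r (rmean r)" 
  and mean_of_real: "mean (\<lambda>x. of_real (r x)) = of_real (rmean r)"
proof -
  obtain c where c: "is_mean r c" using is_mean_real_exists assms by blast
  then have "mean (\<lambda>x. of_real (r x)) = of_real c" by (intro mean_eqI is_mean_of_real)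
  then show "is_mean r (rmean r)" "mean (\<lambda>x. of_real (r x)) = of_real (rmean r)"
    using c by (auto simp: rmean_def)
qed

lemma rmean_ge:
  assumes "cts r" "\<And>x. x \<in> carrier G \<Longrightarrow> c \<le> r x" shows "c \<le> rmean r"
proof (rule field_le_epsilon)
  fix e :: real assume "e > 0"
  then obtain xs where xs: "listG xs" "norm (avg xs r \<one> - rmean r) \<le> e"
    using is_mean_rmean[OF assms(1)] one_closed unfolding is_mean_def by meson
  have "(\<Sum>i<length xs. c) \<le> (\<Sum>i<length xs. r (\<one> \<otimes> xs ! i))"
    by (rule sum_mono) (use assms xs listG_nth in auto)
  then have "c \<le> avg xs r \<one>"
    using listG_pos[OF xs(1)] by (simp add: avg_def field_simps)
  then show "c \<le> rmean r + e" using xs(2) by auto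
qed

lemma rmean_diff:
  assumes "cts r" "cts s" shows "rmean (\<lambda>x. r x - s x) = rmean r - rmean s"
  unfolding rmean_def using mean_diff[of "\<lambda>x. of_real (r x)" "\<lambda>x. of_real (s x)"] assms
  by (simp add: continuous_map_of_real)

lemma rmean_cmult:
  assumes "cts r" shows "rmean (\<lambda>x. c * r x) = c * rmean r"
  unfolding rmean_def using mean_cmult[of "\<lambda>x. of_real (r x)" "of_real c"] assms
  by (simp add: continuous_map_of_real)

lemma rmean_mono:
  assumes "cts r" "cts s" "\<And>x. x \<in> carrier G \<Longrightarrow> r x \<le> s x"
  shows "rmean r \<le> rmean s"
  using rmean_ge[of "\<lambda>x. s x - r x" 0] rmean_diff[of s r] assms by (simp add: continuous_map_diff)

text \<open>The open set where \<open>r\<close> exceeds \<open>r x0 / 2\<close> meets every coset of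
  translates listed in \<open>gs\<close>: each point has a translate in it. So the average over
  \<open>gs\<close> is bounded below by a positive constant, and averaging does not change the
  mean.\<close>

lemma rmean_pos:
  assumes r: "cts r" "\<And>x. x \<in> carrier G \<Longrightarrow> 0 \<le> r x" and x0: "x0 \<in> carrier G" "0 < r x0"
  shows "0 < rmean r"
proof -
  define U where "U = {x \<in> carrier G. r x \<in> {r x0 / 2<..}}"
  have "openin X {x \<in> topspace X. r x \<in> {r x0 / 2<..}}"
    by (rule openin_continuous_map_preimage[OF r(1)]) auto
  then have U: "openin X U" "x0 \<in> U" using x0 by (auto simp: U_def)
  obtain gs where gs: "listG gs" "\<And>x. x \<in> carrier G \<Longrightarrow> \<exists>i<length gs. x \<otimes> gs ! i \<in> U"
    using finite_translate_cover[OF U] by blast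
  define c where "c = r x0 / 2 / length gs"
  have c: "c > 0" using x0 listG_pos[OF gs(1)] by (simp add: c_def)
  have lb: "c \<le> avg gs r x" if x: "x \<in> carrier G" for x
  proof -
    obtain i where i: "i < length gs" "x \<otimes> gs ! i \<in> U" using gs x by blast
    have "r x0 / 2 \<le> r (x \<otimes> gs ! i)" using i by (auto simp: U_def)
    also have "\<dots> \<le> (\<Sum>i<length gs. r (x \<otimes> gs ! i))"
      by (rule member_le_sum) (use i x r gs listG_nth in auto)
    finally show ?thesis unfolding c_def avg_def by (rule divide_right_mono) simp
  qed
  have "mean (\<lambda>x. of_real (avg gs r x)) = mean (avg gs (\<lambda>x. complex_of_real (r x)))"
    by (simp add: avg_of_real[abs_def] avg_def)
  also have "\<dots> = mean (\<lambda>x. of_real (r x))" using r gs by (intro mean_avg continuous_map_of_real)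
  finally have "rmean (avg gs r) = rmean r" by (simp add: rmean_def)
  moreover have "cts (avg gs r)"
    using continuous_map_Re[OF cts_avg[OF continuous_map_of_real[OF r(1)] gs(1)]] by (simp add: avg_of_real)
  ultimately show ?thesis using rmean_ge[of "avg gs r" c] lb c by auto
qed

section \<open>Means depending on a parameter and the exchange of two means\<close>

lemma cts_section:
  assumes "continuous_map (prod_topology X X) euclidean (\<lambda>z. F (fst z) (snd z))" "x \<in> carrier G"
  shows "cts (\<lambda>y. F x y)" "cts (\<lambda>y. F y x)"
proof -
  have "continuous_map X (prod_topology X X) (\<lambda>y. (x, y))" "continuous_map X (prod_topology X X) (\<lambda>y. (y, x))"
    using assms by (auto intro!: continuous_map_pairedI)
  from this[THEN continuous_map_compose, OF assms(1)]
  show "cts (\<lambda>y. F x y)" "cts (\<lambda>y. F y x)" by (simp_all add: o_def)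
qed

lemma cts_mean:
  assumes F: "continuous_map (prod_topology X X) euclidean (\<lambda>z. F (fst z) (snd z))"
  shows "cts (\<lambda>x. mean (\<lambda>y. F y x))"
proof -
  have "\<exists>U. openin X U \<and> x \<in> U \<and> (\<forall>y\<in>U. dist (mean (\<lambda>z. F z x)) (mean (\<lambda>z. F z y)) < e)" 
    if x: "x \<in> carrier G" and e: "e > 0" for x e
  proof -
    have x': "x \<in> topspace X" and e2: "e/2 > 0" using x e by auto
    obtain U where U: "openin X U" "x \<in> U"
      "\<And>z y. z \<in> topspace X \<Longrightarrow> y \<in> U \<Longrightarrow> norm (F (fst (z, y)) (snd (z, y)) - F (fst (z, x)) (snd (z, x))) < e/2"
      using compact_uniform_nbhd[OF compact_G F x' e2] by blast
    have "dist (mean (\<lambda>z. F z x)) (mean (\<lambda>z. F z y)) < e" if y: "y \<in> U" for y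
    proof -
      have yc: "y \<in> carrier G" using U y openin_subset by fastforce
      have "mean (\<lambda>z. F z y) - mean (\<lambda>z. F z x) = mean (\<lambda>z. F z y - F z x)"
        using mean_diff cts_section[OF F] yc x by simp
      also have "norm \<dots> \<le> e/2"
        by (rule mean_bound) (use U(3) y in \<open>auto intro!: continuous_map_diff cts_section[OF F] yc x less_imp_le\<close>)
      finally show ?thesis using e by (simp add: dist_norm norm_minus_commute)
    qed
    then show ?thesis using U by blast
  qed
  then show ?thesis
    unfolding continuous_map_euclidean_metric by simp
qed

text \<open>Commuting averages make a single list of translates serve finitely many sections, hence by
  compactness all sections of \<open>F\<close> at once.\<close>

lemma avg_uniform_sections:
  assumes F: "continuous_map (prod_topology X X) euclidean (\<lambda>z. F (fst z) (snd z))" and e: "e > 0"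
  obtains ys where "listG ys"
    "\<And>x y. x \<in> carrier G \<Longrightarrow> y \<in> carrier G \<Longrightarrow> norm (avg ys (F x) y - mean (F x)) \<le> e"
proof -
  have F': "continuous_map (prod_topology X X) euclidean (\<lambda>z. F (snd z) (fst z))"
  proof -
    have "continuous_map (prod_topology X X) (prod_topology X X) (\<lambda>z. (snd z, fst z))"
      by (intro continuous_map_pairedI continuous_map_fst continuous_map_snd)
    from continuous_map_compose[OF this F] show ?thesis by (simp add: o_def)
  qed
  have "\<exists>U. openin X U \<and> x0 \<in> U \<and> (\<forall>x\<in>U. \<forall>y\<in>carrier G. norm (F x y - F x0 y) \<le> e/3)" if x0: "x0 \<in> carrier G" for x0
  proof -
    have x': "x0 \<in> topspace X" and e2: "e/3 > 0" using x0 e by auto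
    obtain U where U: "openin X U" "x0 \<in> U"
      "\<And>z y. z \<in> topspace X \<Longrightarrow> y \<in> U \<Longrightarrow> norm (F (snd (z, y)) (fst (z, y)) - F (snd (z, x0)) (fst (z, x0))) < e/3"
      using compact_uniform_nbhd[OF compact_G F' x' e2] by blast
    then show ?thesis by (metis fst_conv less_imp_le snd_conv topspace_G)
  qed
  then obtain U where U: "\<And>x0. x0 \<in> carrier G \<Longrightarrow> openin X (U x0)" "\<And>x0. x0 \<in> carrier G \<Longrightarrow> x0 \<in> U x0"
    and UF: "\<And>x0 x y. x0 \<in> carrier G \<Longrightarrow> x \<in> U x0 \<Longrightarrow> y \<in> carrier G \<Longrightarrow> norm (F x y - F x0 y) \<le> e/3"
    by metis
  have "\<exists>\<F>. finite \<F> \<and> \<F> \<subseteq> U ` carrier G \<and> carrier G \<subseteq> \<Union>\<F>"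
    by (rule compactinD[of X]) (use U compact_G in \<open>auto simp: compact_space_def\<close>)
  then obtain S where S: "finite S" "S \<subseteq> carrier G" "carrier G \<subseteq> \<Union> (U ` S)"
    by (metis finite_subset_image)
  have "\<exists>ys. listG ys \<and> (\<forall>x0\<in>S. \<forall>y\<in>carrier G. norm (avg ys (F x0) y - mean (F x0)) \<le> e/3)"
    using S(1,2)
  proof (induction S)
    case empty then show ?case using listG_single[OF one_closed] by auto
  next
    case (insert a S)
    then obtain ys where ys: "listG ys" "\<forall>x0\<in>S. \<forall>y\<in>carrier G. norm (avg ys (F x0) y - mean (F x0)) \<le> e/3"
      by auto
    have "cts (F a)" using cts_section[OF F] insert by auto
    moreover have "e/3 > 0" using e by simp
    ultimately obtain xs where xs: "listG xs" "\<forall>y\<in>carrier G. norm (avg xs (F a) y - mean (F a)) \<le> e/3"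
      using is_mean_mean unfolding is_mean_def by blast
    define zs where "zs = list_mult xs ys"
    have zs: "listG zs" "\<And>f x. x \<in> carrier G \<Longrightarrow> avg xs (avg ys f) x = avg zs (f :: 'g \<Rightarrow> complex) x"
      using avg_avg listG_list_mult xs(1) ys(1) by (auto simp: zs_def)
    have "norm (avg zs (F x0) y - mean (F x0)) \<le> e/3" if "x0 \<in> insert a S" and y: "y \<in> carrier G" for x0 y
    proof (cases "x0 = a")
      case True
      have "norm (avg ys (avg xs (F a)) y - mean (F a)) \<le> e/3"
        by (rule avg_near[OF ys(1) y]) (use xs in auto)
      then show ?thesis using True zs(2)[OF y, of "F a"] avg_commute[OF xs(1) ys(1) y, of "F a"] by simp
    next
      case False
      then have "norm (avg xs (avg ys (F x0)) y - mean (F x0)) \<le> e/3"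
        by (intro avg_near[OF xs(1) y]) (use ys that in auto)
      then show ?thesis using y zs by simp
    qed
    then show ?case using zs(1) by blast
  qed
  then obtain ys where ys: "listG ys" and ysS: "\<forall>x0\<in>S. \<forall>y\<in>carrier G. norm (avg ys (F x0) y - mean (F x0)) \<le> e/3"
    by blast
  show ?thesis
  proof (rule that[OF ys])
    fix x y assume x: "x \<in> carrier G" and y: "y \<in> carrier G"
    obtain x0 where x0: "x0 \<in> S" "x \<in> U x0" using S x by blast
    have x0c: "x0 \<in> carrier G" using x0 S by auto
    have n: "norm (F x y - F x0 y) \<le> e/3" if "y \<in> carrier G" for y using UF x0 x0c that by auto
    have "norm (avg ys (\<lambda>y. F x y - F x0 y) y - 0) \<le> e/3"
      by (rule avg_near[OF ys y]) (use n in auto)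
    then have 1: "norm (avg ys (F x) y - avg ys (F x0) y) \<le> e/3" by (simp add: avg_diff)
    have "norm (mean (\<lambda>y. F x y - F x0 y)) \<le> e/3"
      using n by (intro mean_bound continuous_map_diff cts_section[OF F] x x0c)
    then have 2: "norm (mean (F x0) - mean (F x)) \<le> e/3"
      using mean_diff[OF cts_section(1)[OF F x] cts_section(1)[OF F x0c]] by (simp add: norm_minus_commute)
    have 3: "norm (avg ys (F x0) y - mean (F x0)) \<le> e/3" using ysS x0 y by auto
    have eq: "avg ys (F x) y - mean (F x) = (avg ys (F x) y - avg ys (F x0) y) + (avg ys (F x0) y - mean (F x0))
        + (mean (F x0) - mean (F x))" by simp
    show "norm (avg ys (F x) y - mean (F x)) \<le> e"
      unfolding eq using 1 2 3 norm_triangle_le[OF add_mono[OF norm_triangle_le[OF add_mono[OF 1 3]] 2]] by simp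
  qed
qed

text \<open>Fubini. One list \<open>ys\<close> averages all sections \<open>F x\<close> to within
  \<open>e\<close> of their means. Averaging over \<open>ys\<close> is a finite sum and so commutes
  with the mean over \<open>x\<close>; hence averaging the function of \<open>y\<close> on the right
  over \<open>ys\<close> comes uniformly close to the iterated mean on the left.\<close>

lemma mean_swap:
  assumes F: "continuous_map (prod_topology X X) euclidean (\<lambda>z. F (fst z) (snd z))"
  shows "mean (\<lambda>x. mean (\<lambda>y. F x y)) = mean (\<lambda>y. mean (\<lambda>x. F x y))"
proof -
  have F': "continuous_map (prod_topology X X) euclidean (\<lambda>z. F (snd z) (fst z))"
  proof -
    have "continuous_map (prod_topology X X) (prod_topology X X) (\<lambda>z. (snd z, fst z))"
      by (intro continuous_map_pairedI continuous_map_fst continuous_map_snd)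
    from continuous_map_compose[OF this F] show ?thesis by (simp add: o_def)
  qed
  have "is_mean (\<lambda>y. mean (\<lambda>x. F x y)) (mean (\<lambda>x. mean (F x)))"
    unfolding is_mean_def
  proof (intro allI impI)
    fix e :: real assume "e > 0"
    then obtain ys where ys: "listG ys"
      and ysF: "\<And>x y. x \<in> carrier G \<Longrightarrow> y \<in> carrier G \<Longrightarrow> norm (avg ys (F x) y - mean (F x)) \<le> e"
      using avg_uniform_sections[OF F] by blast
    have "norm (avg ys (\<lambda>y. mean (\<lambda>x. F x y)) y - mean (\<lambda>x. mean (F x))) \<le> e" if y: "y \<in> carrier G" for y
    proof -
      have c1: "cts (\<lambda>x. F x (y \<otimes> ys ! i))" if "i < length ys" for i
        using that y ys listG_nth by (intro cts_section[OF F]) auto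
      have c2: "cts (\<lambda>x. avg ys (F x) y)"
      proof -
        have "cts (\<lambda>x. (1 / of_nat (length ys)) * (\<Sum>i<length ys. F x (y \<otimes> ys ! i)))"
          by (intro continuous_map_complex_mult continuous_map_sum) (use c1 in auto)
        then show ?thesis by (simp add: avg_def)
      qed
      have c3: "cts (\<lambda>x. mean (F x))" using cts_mean[OF F'] by simp
      have "mean (\<lambda>x. \<Sum>i<length ys. F x (y \<otimes> ys ! i)) = (\<Sum>i<length ys. mean (\<lambda>x. F x (y \<otimes> ys ! i)))"
        by (rule mean_sum) (use c1 in auto)
      moreover have "cts (\<lambda>x. \<Sum>i<length ys. F x (y \<otimes> ys ! i))"
        by (rule continuous_map_sum) (use c1 in auto)
      ultimately have "avg ys (\<lambda>y. mean (\<lambda>x. F x y)) y = mean (\<lambda>x. (1 / of_nat (length ys)) * (\<Sum>i<length ys. F x (y \<otimes> ys ! i)))"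
        using mean_cmult[of "\<lambda>x. \<Sum>i<length ys. F x (y \<otimes> ys ! i)" "1 / of_nat (length ys)"]
        by (simp add: avg_def)
      also have "\<dots> = mean (\<lambda>x. avg ys (F x) y)" by (simp add: avg_def)
      finally have "avg ys (\<lambda>y. mean (\<lambda>x. F x y)) y - mean (\<lambda>x. mean (F x)) = mean (\<lambda>x. avg ys (F x) y - mean (F x))"
        using mean_diff[OF c2 c3] by simp
      also have "norm \<dots> \<le> e" using ysF y by (intro mean_bound continuous_map_diff c2 c3)
      finally show ?thesis .
    qed
    then show "\<exists>xs. listG xs \<and> (\<forall>x\<in>carrier G. norm (avg xs (\<lambda>y. mean (\<lambda>x. F x y)) x - mean (\<lambda>x. mean (F x))) \<le> e)"
      using ys by blast
  qed
  then show ?thesis by (simp add: mean_eqI)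
qed

end

section \<open>Convolution\<close>

context compact_ab_group
begin

text \<open>Continuous functions are extended by 0, so that equality on the group is equality of
  functions and the zero element is the constant function 0.\<close>

definition CG :: "('g \<Rightarrow> complex) set" where
  "CG = {f. cts f \<and> (\<forall>x. x \<notin> carrier G \<longrightarrow> f x = 0)}"

definition conv :: "('g \<Rightarrow> complex) \<Rightarrow> ('g \<Rightarrow> complex) \<Rightarrow> 'g \<Rightarrow> complex" where
  "conv f h x = (if x \<in> carrier G then mean (\<lambda>y. f y * h (inv y \<otimes> x)) else 0)"

definition star :: "('g \<Rightarrow> complex) \<Rightarrow> 'g \<Rightarrow> complex" where
  "star f x = (if x \<in> carrier G then cnj (f (inv x)) else 0)"

definition translate :: "'g \<Rightarrow> ('g \<Rightarrow> complex) \<Rightarrow> 'g \<Rightarrow> complex" where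
  "translate g f x = (if x \<in> carrier G then f (x \<otimes> g) else 0)"

lemma CG_cts: "f \<in> CG \<Longrightarrow> cts f"
  and CG_outside: "f \<in> CG \<Longrightarrow> x \<notin> carrier G \<Longrightarrow> f x = 0"
  by (auto simp: CG_def)

lemma cts_cong:
  assumes "\<And>x. x \<in> carrier G \<Longrightarrow> f x = h x" shows "cts f \<longleftrightarrow> cts h"
  using continuous_map_eq[of X euclidean f h] continuous_map_eq[of X euclidean h f] assms by auto

lemma CG_I:
  assumes "cts h" "\<And>x. x \<in> carrier G \<Longrightarrow> f x = h x" "\<And>x. x \<notin> carrier G \<Longrightarrow> f x = 0"
  shows "f \<in> CG"
  using assms cts_cong[of f h] by (auto simp: CG_def)

lemma CG_ext:
  assumes "f \<in> CG" "h \<in> CG" "\<And>x. x \<in> carrier G \<Longrightarrow> f x = h x" shows "f = h"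
  using assms by (intro ext) (metis CG_outside)

lemma CG_lin:
  assumes "f \<in> CG" "h \<in> CG" shows "(\<lambda>x. a * f x + b * h x) \<in> CG"
  using assms by (auto simp: CG_def intro!: continuous_map_add continuous_map_complex_mult)

lemma CG_cmult: "f \<in> CG \<Longrightarrow> (\<lambda>x. a * f x) \<in> CG"
  using CG_lin[of f f a 0] by simp

lemma CG_star: "f \<in> CG \<Longrightarrow> star f \<in> CG"
  by (rule CG_I[where h="\<lambda>x. cnj (f (inv x))"])
    (auto simp: star_def intro!: continuous_map_cnj cts_inv dest: CG_cts)

lemma CG_translate: "f \<in> CG \<Longrightarrow> g \<in> carrier G \<Longrightarrow> translate g f \<in> CG"
  by (rule CG_I[where h="\<lambda>x. f (x \<otimes> g)"])
    (auto simp: translate_def intro: cts_translate CG_cts)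

lemma cts_conv_integrand:
  fixes f h :: "'g \<Rightarrow> complex"
  assumes "cts f" "cts h" "x \<in> carrier G"
  shows "cts (\<lambda>y. f y * h (inv y \<otimes> x))"
proof -
  have "cts (\<lambda>y. h (inv y \<otimes> x))"
    by (rule cts_compose[OF assms(2)]) (use assms in \<open>auto intro!: continuous_intros\<close>)
  with assms(1) show ?thesis by (rule continuous_map_complex_mult)
qed

lemma CG_conv:
  assumes "f \<in> CG" "h \<in> CG" shows "conv f h \<in> CG"
proof (rule CG_I[where h="\<lambda>x. mean (\<lambda>y. f y * h (inv y \<otimes> x))"])
  have 1: "continuous_map (prod_topology X X) euclidean (\<lambda>z. f (fst z))"
    by (rule cts_compose[OF CG_cts[OF assms(1)]]) (intro continuous_map_fst)
  have 2: "continuous_map (prod_topology X X) euclidean (\<lambda>z. h (inv (fst z) \<otimes> snd z))"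
    by (rule cts_compose[OF CG_cts[OF assms(2)]])
      (intro continuous_mult continuous_inv continuous_map_fst continuous_map_snd)
  show "cts (\<lambda>x. mean (\<lambda>y. f y * h (inv y \<otimes> x)))"
    by (rule cts_mean[where F="\<lambda>y x. f y * h (inv y \<otimes> x)"]) (intro continuous_map_complex_mult 1 2)
qed (auto simp: conv_def)

text \<open>Substitution of \<open>inv y \<otimes> x\<close> for \<open>y\<close>, composed of an
  inversion and a translation, both of which preserve the mean.\<close>

lemma conv_commute:
  assumes "f \<in> CG" "h \<in> CG" shows "conv f h = conv h f"
proof (rule CG_ext)
  fix x assume x: "x \<in> carrier G"
  define k where "k y = f y * h (inv y \<otimes> x)" for y
  have k: "cts k" unfolding k_def using assms x by (intro cts_conv_integrand CG_cts)
  have "mean k = mean (\<lambda>y. k (inv y))" using mean_inv[OF k] by simp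
  also have "\<dots> = mean (\<lambda>y. k (inv (y \<otimes> inv x)))"
    using mean_translate[OF cts_inv[OF k], of "inv x"] x by simp
  also have "\<dots> = mean (\<lambda>y. h y * f (inv y \<otimes> x))"
  proof (rule mean_cong)
    fix y assume y: "y \<in> carrier G"
    have "inv (y \<otimes> inv x) = inv y \<otimes> x" using x y by (simp add: inv_mult)
    moreover have "inv (inv y \<otimes> x) \<otimes> x = y" using x y by (simp add: inv_mult m_assoc)
    ultimately show "k (inv (y \<otimes> inv x)) = h y * f (inv y \<otimes> x)" by (simp add: k_def)
  qed
  finally show "conv f h x = conv h f x" using x by (simp add: conv_def k_def[abs_def])
qed (use assms CG_conv in auto)

text \<open>Exchange the two means, then translate the inner variable by \<open>z\<close>.\<close>

lemma conv_assoc: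
  assumes "f \<in> CG" "h \<in> CG" "k \<in> CG" shows "conv (conv f h) k = conv f (conv h k)"
proof (rule CG_ext)
  fix x assume x: "x \<in> carrier G"
  define F where "F y z = f z * h (inv z \<otimes> y) * k (inv y \<otimes> x)" for y z
  have 1: "continuous_map (prod_topology X X) euclidean (\<lambda>z. f (snd z))"
    by (rule cts_compose[OF CG_cts[OF assms(1)]]) (intro continuous_map_snd)
  have 2: "continuous_map (prod_topology X X) euclidean (\<lambda>z. h (inv (snd z) \<otimes> fst z))"
    by (rule cts_compose[OF CG_cts[OF assms(2)]])
      (intro continuous_mult continuous_inv continuous_map_fst continuous_map_snd)
  have 3: "continuous_map (prod_topology X X) euclidean (\<lambda>z. k (inv (fst z) \<otimes> x))"
    by (rule cts_compose[OF CG_cts[OF assms(3)]])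
      (use x in \<open>intro continuous_mult continuous_inv continuous_map_fst; simp\<close>)
  have F: "continuous_map (prod_topology X X) euclidean (\<lambda>z. F (fst z) (snd z))"
    unfolding F_def by (intro continuous_map_complex_mult 1 2 3)
  have "conv (conv f h) k x = mean (\<lambda>y. mean (\<lambda>z. F y z))"
  proof -
    have "mean (\<lambda>y. conv f h y * k (inv y \<otimes> x)) = mean (\<lambda>y. mean (\<lambda>z. F y z))"
    proof (rule mean_cong)
      fix y assume y: "y \<in> carrier G"
      have "mean (\<lambda>z. F y z) = mean (\<lambda>z. k (inv y \<otimes> x) * (f z * h (inv z \<otimes> y)))"
        by (simp add: F_def mult_ac)
      also have "\<dots> = k (inv y \<otimes> x) * mean (\<lambda>z. f z * h (inv z \<otimes> y))"
        by (intro mean_cmult cts_conv_integrand CG_cts assms y)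
      finally show "conv f h y * k (inv y \<otimes> x) = mean (\<lambda>z. F y z)" using y by (simp add: conv_def)
    qed
    then show ?thesis using x by (simp add: conv_def)
  qed
  also have "\<dots> = mean (\<lambda>z. mean (\<lambda>y. F y z))" by (rule mean_swap[OF F])
  also have "\<dots> = mean (\<lambda>z. f z * conv h k (inv z \<otimes> x))"
  proof (rule mean_cong)
    fix z assume z: "z \<in> carrier G"
    have c: "cts (\<lambda>y. F y z)" using cts_section(2)[OF F z] .
    have i: "cts (\<lambda>y. h y * k (inv y \<otimes> (inv z \<otimes> x)))"
      using z x by (intro cts_conv_integrand CG_cts assms) auto
    have "mean (\<lambda>y. F y z) = mean (\<lambda>y. F (y \<otimes> z) z)" using mean_translate[OF c z] by simp
    also have "\<dots> = mean (\<lambda>y. f z * (h y * k (inv y \<otimes> (inv z \<otimes> x))))"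
    proof (rule mean_cong)
      fix y assume y: "y \<in> carrier G"
      have "inv z \<otimes> (y \<otimes> z) = y" using y z by (simp add: m_lcomm)
      moreover have "inv (y \<otimes> z) \<otimes> x = inv y \<otimes> (inv z \<otimes> x)" using x y z by (simp add: inv_mult m_assoc)
      ultimately show "F (y \<otimes> z) z = f z * (h y * k (inv y \<otimes> (inv z \<otimes> x)))" by (simp add: F_def)
    qed
    also have "\<dots> = f z * mean (\<lambda>y. h y * k (inv y \<otimes> (inv z \<otimes> x)))" by (rule mean_cmult[OF i])
    finally show "mean (\<lambda>y. F y z) = f z * conv h k (inv z \<otimes> x)" using x z by (simp add: conv_def)
  qed
  finally show "conv (conv f h) k x = conv f (conv h k) x" using x by (simp add: conv_def)
qed (use assms CG_conv in auto)

lemma conv_lin: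
  assumes "f \<in> CG" "h \<in> CG" "k \<in> CG"
  shows "conv (\<lambda>x. a * f x + b * h x) k = (\<lambda>x. a * conv f k x + b * conv h k x)"
proof
  fix x
  show "conv (\<lambda>x. a * f x + b * h x) k x = a * conv f k x + b * conv h k x"
  proof (cases "x \<in> carrier G")
    case True
    have c1: "cts (\<lambda>y. f y * k (inv y \<otimes> x))" and c2: "cts (\<lambda>y. h y * k (inv y \<otimes> x))"
      using assms True by (intro cts_conv_integrand CG_cts; simp)+
    have "mean (\<lambda>y. a * (f y * k (inv y \<otimes> x)) + b * (h y * k (inv y \<otimes> x))) =
       a * mean (\<lambda>y. f y * k (inv y \<otimes> x)) + b * mean (\<lambda>y. h y * k (inv y \<otimes> x))"
      using c1 c2 by (subst mean_add) (auto simp: mean_cmult intro!: continuous_map_complex_mult)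
    then show ?thesis using True by (simp add: conv_def algebra_simps)
  qed (simp add: conv_def)
qed

lemma conv_lin_right:
  assumes "f \<in> CG" "h \<in> CG" "k \<in> CG"
  shows "conv k (\<lambda>x. a * f x + b * h x) = (\<lambda>x. a * conv k f x + b * conv k h x)"
  using conv_lin[OF assms] assms by (simp add: conv_commute[of k] CG_lin)

lemma conv_cmult: "f \<in> CG \<Longrightarrow> k \<in> CG \<Longrightarrow> conv (\<lambda>x. a * f x) k = (\<lambda>x. a * conv f k x)"
  using conv_lin[of f f k a 0] by simp

lemma conv_cmult_right: "f \<in> CG \<Longrightarrow> k \<in> CG \<Longrightarrow> conv k (\<lambda>x. a * f x) = (\<lambda>x. a * conv k f x)"
  using conv_lin_right[of f f k a 0] by simp

lemma conv_scale:
  "f \<in> CG \<Longrightarrow> h \<in> CG \<Longrightarrow> conv (\<lambda>x. a * f x) (\<lambda>x. b * h x) = (\<lambda>x. (a * b) * conv f h x)"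
  by (simp add: conv_cmult conv_cmult_right CG_cmult mult.assoc)

lemma conv_zero [simp]: "conv (\<lambda>x. 0) k = (\<lambda>x. 0)" "conv k (\<lambda>x. 0) = (\<lambda>x. 0)"
  by (auto simp: conv_def)

lemma star_star: "f \<in> CG \<Longrightarrow> star (star f) = f"
  by (rule CG_ext) (auto simp: CG_star, auto simp: star_def)

lemma star_lin: "star (\<lambda>x. a * f x + b * h x) = (\<lambda>x. cnj a * star f x + cnj b * star h x)"
  by (auto simp: star_def)

lemma star_conv:
  assumes "f \<in> CG" "h \<in> CG" shows "star (conv f h) = conv (star f) (star h)"
proof (rule CG_ext)
  fix x assume x: "x \<in> carrier G"
  define k where "k y = star f y * star h (inv y \<otimes> x)" for y
  have k: "cts k" unfolding k_def using assms x by (intro cts_conv_integrand CG_cts CG_star)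
  have "conv (star f) (star h) x = mean (\<lambda>y. k (inv y))"
    using mean_inv[OF k] x by (simp add: conv_def k_def[abs_def])
  also have "\<dots> = mean (\<lambda>y. cnj (f y * h (inv y \<otimes> inv x)))"
    by (rule mean_cong) (use x in \<open>simp add: k_def star_def inv_mult\<close>)
  also have "\<dots> = cnj (mean (\<lambda>y. f y * h (inv y \<otimes> inv x)))"
    using assms x by (intro mean_cnj cts_conv_integrand CG_cts) auto
  finally show "star (conv f h) x = conv (star f) (star h) x" using x by (simp add: star_def conv_def)
qed (use assms CG_conv CG_star in auto)

lemma conv_translate:
  assumes "f \<in> CG" "h \<in> CG" "g \<in> carrier G"
  shows "conv f (translate g h) = translate g (conv f h)"
proof (rule CG_ext)
  fix x assume x: "x \<in> carrier G"
  have "mean (\<lambda>y. f y * translate g h (inv y \<otimes> x)) = mean (\<lambda>y. f y * h (inv y \<otimes> (x \<otimes> g)))"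
    by (rule mean_cong) (use x assms in \<open>simp add: translate_def m_assoc\<close>)
  then show "conv f (translate g h) x = translate g (conv f h) x"
    using x assms by (simp add: conv_def translate_def)
qed (use assms CG_conv CG_translate in auto)

lemma star_translate:
  assumes "f \<in> CG" "g \<in> carrier G"
  shows "star (translate g f) = translate (inv g) (star f)"
  using assms by (auto simp: star_def translate_def inv_mult)

section \<open>Inner product, Cauchy-Schwarz and the sup norm bound for convolutions\<close>

definition inner :: "('g \<Rightarrow> complex) \<Rightarrow> ('g \<Rightarrow> complex) \<Rightarrow> complex" where
  "inner f h = mean (\<lambda>x. f x * cnj (h x))"

definition nn :: "('g \<Rightarrow> complex) \<Rightarrow> real" where
  "nn f = rmean (\<lambda>x. (norm (f x))\<^sup>2)"

lemma cts_norm_sq: "f \<in> CG \<Longrightarrow> cts (\<lambda>x. (norm (f x))\<^sup>2)"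
  using CG_cts[of f] by (simp add: power2_eq_square continuous_map_real_mult continuous_map_norm)

lemma inner_self: "inner f f = of_real (nn f)" if "f \<in> CG"
  using mean_of_real[OF cts_norm_sq[OF that]] unfolding inner_def nn_def complex_norm_square .

text \<open>Evaluation at \<one> acts as a trace on the convolution algebra. It turns identities
  between convolution powers or idempotents into identities between norms.\<close>

lemma conv_star_one:
  assumes "f \<in> CG" "h \<in> CG"
  shows "conv f (star h) \<one> = inner f h"
  unfolding conv_def inner_def using assms by (auto intro!: mean_cong simp: star_def)

lemma nn_nonneg: "f \<in> CG \<Longrightarrow> 0 \<le> nn f"
  unfolding nn_def using rmean_ge[OF cts_norm_sq, of f 0] by simp

lemma nn_pos:
  assumes "f \<in> CG" "f \<noteq> (\<lambda>x. 0)" shows "0 < nn f"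
proof -
  obtain x where "f x \<noteq> 0" using assms by auto
  then have "x \<in> carrier G" using assms CG_outside by blast
  then show ?thesis unfolding nn_def using \<open>f x \<noteq> 0\<close> assms
    by (intro rmean_pos[where ?x0.0=x] cts_norm_sq) auto
qed

lemma cts_inner: "f \<in> CG \<Longrightarrow> h \<in> CG \<Longrightarrow> cts (\<lambda>x. f x * cnj (h x))"
  by (intro continuous_map_complex_mult continuous_map_cnj CG_cts)

lemma inner_lin:
  assumes "f \<in> CG" "h \<in> CG" "k \<in> CG"
  shows "inner (\<lambda>x. a * f x + b * h x) k = a * inner f k + b * inner h k"
proof -
  have "inner (\<lambda>x. a * f x + b * h x) k = mean (\<lambda>x. a * (f x * cnj (k x)) + b * (h x * cnj (k x)))"
    by (simp add: inner_def algebra_simps)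
  also have "\<dots> = mean (\<lambda>x. a * (f x * cnj (k x))) + mean (\<lambda>x. b * (h x * cnj (k x)))"
    by (intro mean_add continuous_map_complex_mult[OF continuous_map_const_euclidean] cts_inner assms)
  also have "\<dots> = a * inner f k + b * inner h k"
    using cts_inner[OF assms(1,3)] cts_inner[OF assms(2,3)] by (simp add: mean_cmult inner_def)
  finally show ?thesis .
qed

lemma inner_cnj: "f \<in> CG \<Longrightarrow> h \<in> CG \<Longrightarrow> inner h f = cnj (inner f h)"
  unfolding inner_def using mean_cnj[OF cts_inner[of f h]] by (simp add: mult.commute)

lemma nn_lin:
  assumes "f \<in> CG" "h \<in> CG"
  shows "of_real (nn (\<lambda>x. a * f x + b * h x)) =
    a * cnj a * nn f + a * cnj b * inner f h + b * cnj a * cnj (inner f h) + b * cnj b * nn h"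
proof -
  let ?k = "\<lambda>x. a * f x + b * h x"
  have k: "?k \<in> CG" using assms by (rule CG_lin)
  have "inner f ?k = cnj a * nn f + cnj b * inner f h"
    using inner_cnj[OF k assms(1)] inner_lin[OF assms assms(1), of a b] inner_cnj[OF assms] inner_self[OF assms(1)] by simp
  moreover have "inner h ?k = cnj a * cnj (inner f h) + cnj b * nn h"
    using inner_cnj[OF k assms(2)] inner_lin[OF assms assms(2), of a b] inner_cnj[OF assms] inner_self[OF assms(2)] by simp
  ultimately show ?thesis
    using inner_self[OF k] inner_lin[OF assms k, of a b] by (simp add: algebra_simps)
qed

lemma Cauchy_Schwarz:
  assumes "f \<in> CG" "h \<in> CG"
  shows "(norm (inner f h))\<^sup>2 \<le> nn f * nn h"
proof (cases "h = (\<lambda>x. 0)")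
  case True
  then show ?thesis using nn_nonneg assms by (simp add: inner_def)
next
  case False
  define b where "b = nn h"
  define c where "c = inner f h"
  have b: "b > 0" using nn_pos assms False by (simp add: b_def)
  have cc: "c * cnj c = complex_of_real (norm c) * complex_of_real (norm c)"
    unfolding complex_norm_square[symmetric] by (simp add: power2_eq_square)
  have "complex_of_real (nn (\<lambda>x. 1 * f x + (- c / b) * h x)) = of_real (nn f - (norm c)\<^sup>2 / b)"
    unfolding nn_lin[OF assms] using b
    by (simp add: cc field_simps power2_eq_square flip: b_def c_def)
  then have "nn (\<lambda>x. 1 * f x + (- c / b) * h x) = nn f - (norm c)\<^sup>2 / b" using of_real_eq_iff by blast
  moreover have "0 \<le> nn (\<lambda>x. 1 * f x + (- c / b) * h x)" by (intro nn_nonneg CG_lin assms)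
  ultimately have "(norm c)\<^sup>2 / b \<le> nn f" by linarith
  then show ?thesis using b by (simp add: pos_divide_le_eq b_def c_def)
qed

text \<open>The value at \<open>x\<close> is the inner product of \<open>f\<close> with a translate
  of \<open>star h\<close>, and translation, inversion and conjugation preserve \<open>nn\<close>.
  Thus convolution smooths: mean-square estimates become uniform ones.\<close>

lemma norm_conv_le:
  assumes "f \<in> CG" "h \<in> CG" "x \<in> carrier G"
  shows "norm (conv f h x) \<le> sqrt (nn f * nn h)"
proof -
  define k where "k = translate (inv x) (star h)"
  have k: "k \<in> CG" unfolding k_def using assms by (intro CG_translate CG_star) auto
  have "conv f h x = inner f k"
    unfolding conv_def inner_def using assms
    by (auto intro!: mean_cong simp: k_def translate_def star_def inv_mult)
  moreover have "nn k = nn h"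
  proof -
    let ?r = "\<lambda>y. complex_of_real ((norm (h y))\<^sup>2)"
    have r: "cts ?r" using continuous_map_of_real[OF cts_norm_sq[OF assms(2)]] .
    have "mean (\<lambda>y. of_real ((norm (k y))\<^sup>2)) = mean (\<lambda>y. ?r (inv (y \<otimes> inv x)))"
      by (rule mean_cong) (use assms in \<open>simp add: k_def translate_def star_def\<close>)
    also have "\<dots> = mean ?r"
      using mean_translate[OF cts_inv[OF r], of "inv x"] mean_inv[OF r] assms by simp
    finally show ?thesis by (simp add: nn_def rmean_def)
  qed
  ultimately show ?thesis using Cauchy_Schwarz[OF assms(1) k] by (simp add: real_le_rsqrt)
qed

lemma norm_conv_le_sup:
  assumes "f \<in> CG" "h \<in> CG" "x \<in> carrier G" "A \<ge> 0" 
    "\<And>x. x \<in> carrier G \<Longrightarrow> norm (f x) \<le> A" "\<And>x. x \<in> carrier G \<Longrightarrow> norm (h x) \<le> B"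
  shows "norm (conv f h x) \<le> A * B"
proof -
  have "norm (mean (\<lambda>y. f y * h (inv y \<otimes> x))) \<le> A * B"
    by (intro mean_bound cts_conv_integrand CG_cts assms(1,2,3))
      (use assms in \<open>auto simp: norm_mult intro!: mult_mono\<close>)
  then show ?thesis using assms by (simp add: conv_def)
qed

section \<open>Idempotents by power iteration\<close>

primrec cpow :: "('g \<Rightarrow> complex) \<Rightarrow> nat \<Rightarrow> 'g \<Rightarrow> complex" where
  "cpow p 0 = p"
| "cpow p (Suc n) = conv p (cpow p n)"

lemma CG_cpow: "p \<in> CG \<Longrightarrow> cpow p n \<in> CG"
  by (induction n) (auto intro: CG_conv)

text \<open>\<open>cpow p n\<close> is the convolution power of exponent \<open>n + 1\<close>.\<close>

lemma conv_cpow: "p \<in> CG \<Longrightarrow> conv (cpow p m) (cpow p n) = cpow p (m + n + 1)"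
  by (induction m) (auto simp: conv_assoc CG_cpow)

lemma star_cpow: "p \<in> CG \<Longrightarrow> star p = p \<Longrightarrow> star (cpow p n) = cpow p n"
  by (induction n) (auto simp: star_conv CG_cpow)

text \<open>Convolution with such a \<open>q\<close> is an orthogonal projection commuting with
  translations; its rank is \<open>nn q\<close>, which equals \<open>q \<one>\<close>.\<close>

definition sa_idem :: "('g \<Rightarrow> complex) \<Rightarrow> bool" where
  "sa_idem q \<longleftrightarrow> q \<in> CG \<and> conv q q = q \<and> star q = q \<and> q \<noteq> (\<lambda>x. 0)"

text \<open>Power iteration: with \<open>c n\<close> the squared norm of the \<open>n\<close>-th power, \<open>c\<close> is log-convex by
  Cauchy-Schwarz and submultiplicative because it bounds the sup norm of the \<open>2 n\<close>-th power. Hence \<open>c n\<close> is at least the \<open>n\<close>-th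
  power of the limit ratio \<open>r\<close>, so the normalised even powers do not degenerate to \<open>0\<close>.\<close>

lemma sa_idem_exists:
  assumes p: "p \<in> CG" "star p = p" "p \<noteq> (\<lambda>x. 0)"
  obtains q r where "sa_idem q" "r > 0" "conv (conv p p) q = (\<lambda>x. of_real r * q x)"
proof -
  let ?w = "cpow p"
  note wCG = CG_cpow[OF p(1)]
  define c where "c n = nn (?w n)" for n
  have inner_w: "inner (?w m) (?w n) = ?w (m + n + 1) \<one>" for m n
    using conv_star_one[OF wCG wCG, of m n] star_cpow[OF p(1,2)] conv_cpow[OF p(1)] by simp
  have w_one: "?w (2 * n + 1) \<one> = of_real (c n)" for n
    using inner_w[of n n] inner_self[OF wCG[of n]] by (simp add: c_def mult_2)
  have w_ne: "?w n \<noteq> (\<lambda>x. 0)" for n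
  proof (induction n)
    case (Suc n)
    show ?case
    proof
      assume z: "?w (Suc n) = (\<lambda>x. 0)"
      \<comment> \<open>A vanishing power makes all later ones vanish, among them the one of index
        \<open>2 * n + 1\<close>, whose value at \<one> is the squared norm of the power of index
        \<open>n\<close>.\<close>
      have "?w (k + Suc n) = (\<lambda>x. 0)" for k by (induction k) (use z in auto)
      from this[of n] have "c n = 0" using w_one[of n] by (simp add: mult_2)
      then show False using nn_pos[OF wCG Suc] by (simp add: c_def)
    qed
  qed (use p in simp)
  have c_pos: "c n > 0" for n using nn_pos[OF wCG w_ne] by (simp add: c_def)
  have logconv: "(c (Suc n))\<^sup>2 \<le> c n * c (Suc (Suc n))" for n
  proof -
    have "inner (?w n) (?w (Suc (Suc n))) = of_real (c (Suc n))"
      using inner_w[of n "Suc (Suc n)"] w_one[of "Suc n"] by (simp add: mult_2 del: cpow.simps)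
    then show ?thesis using Cauchy_Schwarz[OF wCG[of n] wCG[of "Suc (Suc n)"]] c_pos[of "Suc n"]
      by (simp add: c_def)
  qed
  have w_le: "norm (?w (2 * n + 1) x) \<le> c n" if "x \<in> carrier G" for n x
  proof -
    have "?w (2 * n + 1) = conv (?w n) (?w n)" using conv_cpow[OF p(1), of n n] by (simp add: mult_2)
    then show ?thesis using norm_conv_le[OF wCG[of n] wCG[of n] that] c_pos[of n]
      by (simp add: c_def flip: power2_eq_square)
  qed
  have submult: "c (m + n + 1) \<le> c m * c n" for m n
  proof -
    have "of_real (c (m + n + 1)) = conv (?w (2 * m + 1)) (?w (2 * n + 1)) \<one>"
      using w_one[of "m + n + 1"] conv_cpow[OF p(1), of "2 * m + 1" "2 * n + 1"] by (simp add: algebra_simps)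
    moreover have "norm (conv (?w (2 * m + 1)) (?w (2 * n + 1)) \<one>) \<le> c m * c n"
      by (intro norm_conv_le_sup wCG w_le one_closed) (use c_pos[of m] in auto)
    ultimately show ?thesis using c_pos[of "m+n+1"] by (metis abs_of_pos norm_of_real)
  qed
  define r where "r n = c (Suc n) / c n" for n
  have r_inc: "incseq r"
  proof (rule incseq_SucI)
    fix n show "r n \<le> r (Suc n)"
      using logconv[of n] c_pos[of n] c_pos[of "Suc n"] by (simp add: r_def field_simps power2_eq_square)
  qed
  have r_bd: "r n \<le> c 0" for n
    using submult[of n 0] c_pos[of n] by (simp add: r_def field_simps)
  have "bdd_above (range r)" using r_bd by (rule bdd_aboveI2)
  define \<rho> where "\<rho> = (SUP n. r n)"
  have r_lim: "r \<longlonglongrightarrow> \<rho>" unfolding \<rho>_def by (rule LIMSEQ_incseq_SUP) fact+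
  have r_le: "r n \<le> \<rho>" for n unfolding \<rho>_def by (rule cSUP_upper) (use \<open>bdd_above (range r)\<close> in auto)
  have r_pos: "0 < r n" for n using c_pos[of n] c_pos[of "Suc n"] by (simp add: r_def)
  have \<rho>: "\<rho> > 0" using r_le[of 0] r_pos[of 0] by linarith
  \<comment> \<open>The ratios increase, so \<open>c m * r m ^ Suc n\<close> is at most
    \<open>c (m + n + 1)\<close>, and submultiplicativity bounds the latter by
    \<open>c m * c n\<close>. Cancel \<open>c m\<close> and let \<open>m\<close> tend to
    infinity.\<close>
  have c_lower: "\<rho> ^ Suc n \<le> c n" for n
  proof -
    have ineq: "r m ^ Suc n \<le> c n" for m
    proof -
      have "c m * r m ^ k \<le> c (m + k)" for k
      proof (induction k)
        case (Suc k)
        have "c m * r m ^ Suc k = (c m * r m ^ k) * r m" by simp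
        also have "\<dots> \<le> c (m + k) * r (m + k)"
          using Suc c_pos r_pos[of m] incseqD[OF r_inc, of m "m+k"] by (intro mult_mono) (auto simp: less_imp_le)
        also have "\<dots> = c (m + Suc k)" using c_pos[of "m+k"] by (simp add: r_def)
        finally show ?case .
      qed simp
      from this[of "Suc n"] have "c m * r m ^ Suc n \<le> c m * c n" using submult[of m n] by simp
      then show ?thesis using c_pos[of m] by (simp only: mult_le_cancel_left_pos)
    qed
    have "(\<lambda>m. r m ^ Suc n) \<longlonglongrightarrow> \<rho> ^ Suc n" by (intro tendsto_power r_lim)
    then show ?thesis by (rule LIMSEQ_le_const2) (use ineq in auto)
  qed
  \<comment> \<open>The squared norms compared with the growth rate \<rho>: decreasing because no
    ratio exceeds \<rho>, at least 1 by \<open>c_lower\<close>, hence convergent.\<close>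
  define d where "d n = c n / \<rho> ^ Suc n" for n
  have d1: "1 \<le> d n" for n using c_lower[of n] \<rho> by (simp add: d_def)
  have d_dec: "decseq d"
  proof (rule decseq_SucI)
    fix n
    have "c (Suc n) \<le> \<rho> * c n" using r_le[of n] c_pos[of n] by (simp add: r_def field_simps)
    then show "d (Suc n) \<le> d n" using \<rho> by (simp add: d_def field_simps)
  qed
  obtain L where L: "d \<longlonglongrightarrow> L" using decseq_convergent[OF d_dec, of 1] d1 by blast
  \<comment> \<open>Index \<open>2 * n + 1\<close> means exponent \<open>2 * (n + 1)\<close>: this
    is power \<open>n + 1\<close> of \<open>conv p p\<close>, rescaled by the same power of
    \<rho>.\<close>
  define e where "e n = (\<lambda>x. of_real (1 / \<rho> ^ Suc n) * ?w (2 * n + 1) x)" for n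
  have eCG: "e n \<in> CG" for n unfolding e_def by (intro CG_cmult wCG)
  have e_conv: "conv (e m) (e n) = e (m + n + 1)" for m n
  proof -
    have "complex_of_real (1 / \<rho> ^ Suc m) * of_real (1 / \<rho> ^ Suc n) = of_real (1 / \<rho> ^ Suc (m + n + 1))"
      by (simp add: power_add)
    moreover have "2 * m + 1 + (2 * n + 1) + 1 = 2 * (m + n + 1) + 1" by simp
    ultimately show ?thesis
      unfolding e_def conv_scale[OF wCG wCG] conv_cpow[OF p(1)] by presburger
  qed
  have e_star: "star (e n) = e n" for n
    using star_lin[of "of_real (1 / \<rho> ^ Suc n)" "?w (2 * n + 1)" 0 "?w 0"] star_cpow[OF p(1,2), of "2*n+1"]
    by (simp add: e_def del: cpow.simps)
  have e_one: "e n \<one> = of_real (d n)" for n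
    using w_one[of n] by (simp add: e_def d_def del: cpow.simps)
  \<comment> \<open>Since \<open>inner (e m) (e n)\<close> is \<open>d (m + n + 1)\<close>, the
    squared distance is a second difference of the convergent sequence \<open>d\<close>. So the
    \<open>e n\<close> are Cauchy in the mean-square norm.\<close>
  have e_nn: "nn (\<lambda>x. 1 * e m x + (-1) * e n x) = d (2*m+1) - 2 * d (m+n+1) + d (2*n+1)" for m n
  proof -
    have i: "inner (e m) (e n) = of_real (d (m + n + 1))" for m n
      using conv_star_one[OF eCG eCG, of m n] e_star e_conv e_one by simp
    then have "nn (e n) = d (2*n+1)" for n
      using inner_self[OF eCG[of n]] i[of n n] by (simp add: mult_2)
    then have "complex_of_real (nn (\<lambda>x. 1 * e m x + (-1) * e n x)) = of_real (d (2*m+1) - 2 * d (m+n+1) + d (2*n+1))"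
      unfolding nn_lin[OF eCG eCG] by (simp add: i)
    then show ?thesis using of_real_eq_iff by blast
  qed
  \<comment> \<open>Here \<open>?w 1\<close> is \<open>conv p p\<close>. Raising the index costs one
    more convolution by a fixed function, and by \<open>norm_conv_le\<close> this turns mean-square
    Cauchy into uniformly Cauchy.\<close>
  have e_Suc: "e (Suc n) = (\<lambda>x. of_real (1 / \<rho>) * conv (?w 1) (e n) x)" for n
  proof -
    have "complex_of_real (1 / \<rho> ^ Suc (Suc n)) = of_real (1 / \<rho>) * of_real (1 / \<rho> ^ Suc n)" by simp
    moreover have "1 + (2 * n + 1) + 1 = 2 * Suc n + 1" by simp
    ultimately show ?thesis
      unfolding e_def conv_cmult_right[OF wCG wCG] conv_cpow[OF p(1)] by (metis mult.assoc)
  qed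
  define K where "K = sqrt (nn (?w 1)) / \<rho>"
  have K: "K > 0" using c_pos[of 1] \<rho> by (simp add: K_def c_def)
  have e_diff: "norm (e (Suc m) x - e (Suc n) x) \<le> K * sqrt (d (2*m+1) - 2 * d (m+n+1) + d (2*n+1))"
    if x: "x \<in> carrier G" for m n x
  proof -
    have "e (Suc m) x - e (Suc n) x = of_real (1 / \<rho>) * conv (?w 1) (\<lambda>x. 1 * e m x + (-1) * e n x) x"
      by (subst conv_lin_right[OF eCG eCG wCG]) (simp add: e_Suc diff_divide_distrib del: cpow.simps)
    also have "norm \<dots> = (1 / \<rho>) * norm (conv (?w 1) (\<lambda>x. 1 * e m x + (-1) * e n x) x)"
      using \<rho> by (simp add: norm_mult norm_divide del: cpow.simps)
    also have "\<dots> \<le> (1 / \<rho>) * sqrt (nn (?w 1) * nn (\<lambda>x. 1 * e m x + (-1) * e n x))"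
      by (intro mult_left_mono norm_conv_le wCG CG_lin eCG x) (use \<rho> in auto)
    finally show ?thesis unfolding e_nn by (simp add: K_def real_sqrt_mult)
  qed
  have e_Cauchy: "\<exists>N. \<forall>m n x. N \<le> m \<longrightarrow> N \<le> n \<longrightarrow> x \<in> topspace X \<longrightarrow> dist (e m x) (e n x) < \<epsilon>"
    if \<epsilon>: "\<epsilon> > 0" for \<epsilon> :: real
  proof -
    \<comment> \<open>Chosen so that \<open>4 * \<delta>\<close> is the square of
      \<open>\<epsilon> / K\<close>: with three values of \<open>d\<close> within \<delta> of the
      limit, the second difference is below \<open>4 * \<delta>\<close>.\<close>
    define \<delta> where "\<delta> = (\<epsilon> / K)\<^sup>2 / 4"
    have \<delta>: "\<delta> > 0" using \<epsilon> K by (simp add: \<delta>_def)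
    then obtain N where N: "\<And>n. n \<ge> N \<Longrightarrow> \<bar>d n - L\<bar> < \<delta>" 
      using LIMSEQ_D[OF L \<delta>] by auto
    have "dist (e m x) (e n x) < \<epsilon>" if mn: "m \<ge> Suc N" "n \<ge> Suc N" and x: "x \<in> topspace X" for m n x
    proof -
      obtain m' n' where m': "m = Suc m'" "n = Suc n'" "m' \<ge> N" "n' \<ge> N"
        using mn by (metis Suc_le_D Suc_le_mono)
      have "\<bar>d (2*m'+1) - L\<bar> < \<delta>" "\<bar>d (m'+n'+1) - L\<bar> < \<delta>" "\<bar>d (2*n'+1) - L\<bar> < \<delta>"
        using m' by (auto intro!: N)
      then have "d (2*m'+1) - 2 * d (m'+n'+1) + d (2*n'+1) < 4 * \<delta>" by linarith
      then have "sqrt (d (2*m'+1) - 2 * d (m'+n'+1) + d (2*n'+1)) < \<epsilon> / K"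
        using \<epsilon> K by (intro real_less_lsqrt) (auto simp: \<delta>_def)
      then have "K * sqrt (d (2*m'+1) - 2 * d (m'+n'+1) + d (2*n'+1)) < \<epsilon>"
        using K by (simp add: field_simps)
      then show ?thesis using e_diff[of x m' n'] x m' by (simp add: dist_norm)
    qed
    then show ?thesis by blast
  qed
  obtain q' where q': "continuous_map X Met_TC.mtopology q'"
    "\<And>\<epsilon>. 0 < \<epsilon> \<Longrightarrow> \<forall>\<^sub>F n in sequentially. \<forall>x \<in> topspace X. dist (e n x) (q' x) < \<epsilon>"
    by (rule Met_TC.continuous_map_uniformly_Cauchy_limit[of X e])
      (use e_Cauchy CG_cts[OF eCG] in \<open>auto simp: complete_UNIV\<close>)
  define q where "q x = (if x \<in> carrier G then q' x else 0)" for x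
  have qCG: "q \<in> CG" by (rule CG_I[where h=q']) (use q' in \<open>auto simp: q_def\<close>)
  have q_unif: "\<forall>\<^sub>F n in sequentially. \<forall>x \<in> carrier G. norm (e n x - q x) < \<epsilon>" if "\<epsilon> > 0" for \<epsilon>
    using q'(2)[OF that] by (rule eventually_mono) (auto simp: q_def dist_norm)
  have q_lim: "(\<lambda>n. e n x) \<longlonglongrightarrow> q x" if "x \<in> carrier G" for x
  proof (rule tendstoI)
    fix \<epsilon> :: real assume "\<epsilon> > 0"
    show "\<forall>\<^sub>F n in sequentially. dist (e n x) (q x) < \<epsilon>"
      using q_unif[OF \<open>\<epsilon> > 0\<close>] by (rule eventually_mono) (use that in \<open>auto simp: dist_norm\<close>)
  qed
  have conv_lim: "(\<lambda>n. conv k (e n) x) \<longlonglongrightarrow> conv k q x" if k: "k \<in> CG" and x: "x \<in> carrier G" for k x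
  proof (rule tendstoI)
    fix \<epsilon> :: real assume \<epsilon>: "\<epsilon> > 0"
    obtain B where B: "B > 0" "\<And>x. x \<in> carrier G \<Longrightarrow> norm (k x) \<le> B" using cts_bounded[OF CG_cts[OF k]] by metis
    have "\<forall>\<^sub>F n in sequentially. \<forall>x \<in> carrier G. norm (e n x - q x) < \<epsilon> / (2 * B)"
      using \<epsilon> B by (intro q_unif) auto
    then show "\<forall>\<^sub>F n in sequentially. dist (conv k (e n) x) (conv k q x) < \<epsilon>"
    proof (rule eventually_mono)
      fix n assume n: "\<forall>x \<in> carrier G. norm (e n x - q x) < \<epsilon> / (2 * B)"
      have "conv k (e n) x - conv k q x = conv k (\<lambda>x. 1 * e n x + (-1) * q x) x"
        by (subst conv_lin_right[OF eCG qCG k]) simp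
      also have "norm \<dots> \<le> B * (\<epsilon> / (2 * B))"
        by (intro norm_conv_le_sup CG_lin eCG qCG k x) (use B n in \<open>auto simp: less_imp_le\<close>)
      finally show "dist (conv k (e n) x) (conv k q x) < \<epsilon>" using B \<epsilon> by (simp add: dist_norm)
    qed
  qed
  have shift: "(\<lambda>n. e (n + k) x) \<longlonglongrightarrow> q x" if "x \<in> carrier G" for k x
    using LIMSEQ_ignore_initial_segment[OF q_lim[OF that]] .
  \<comment> \<open>Convolving with \<open>e m\<close> only shifts the index of the sequence, so it
    fixes the limit. The case \<open>m = 0\<close> says that \<open>conv p p\<close> acts on
    \<open>q\<close> as the scalar \<rho>.\<close>
  have eq: "conv (e m) q = q" for m
  proof (rule CG_ext)
    fix x assume x: "x \<in> carrier G"
    have "(\<lambda>n. conv (e m) (e n) x) = (\<lambda>n. e (n + (m + 1)) x)" by (simp add: e_conv add_ac)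
    then have "(\<lambda>n. conv (e m) (e n) x) \<longlonglongrightarrow> q x" using shift[OF x, of "m + 1"] by simp
    then show "conv (e m) q x = q x" using conv_lim[OF eCG x] LIMSEQ_unique by blast
  qed (intro CG_conv eCG qCG, rule qCG)
  have qq: "conv q q = q"
  proof (rule CG_ext)
    fix x assume x: "x \<in> carrier G"
    have "(\<lambda>n. conv q (e n) x) = (\<lambda>n. q x)" using eq by (simp add: conv_commute[OF qCG eCG])
    then show "conv q q x = q x" using conv_lim[OF qCG x] LIMSEQ_unique tendsto_const by metis
  qed (intro CG_conv qCG, rule qCG)
  have star_q: "star q = q"
  proof (rule CG_ext)
    fix x assume x: "x \<in> carrier G"
    have "(\<lambda>n. cnj (e n (inv x))) \<longlonglongrightarrow> cnj (q (inv x))" using x by (intro tendsto_cnj q_lim) auto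
    moreover have "cnj (e n (inv x)) = e n x" for n using fun_cong[OF e_star[of n], of x] x by (simp add: star_def)
    ultimately have "cnj (q (inv x)) = q x" using q_lim[OF x] LIMSEQ_unique by simp
    then show "star q x = q x" using x by (simp add: star_def)
  qed (intro CG_star qCG, rule qCG)
  \<comment> \<open>The values at \<one> are the \<open>d n\<close>, all at least 1, so the limit
    cannot vanish there.\<close>
  have "q \<noteq> (\<lambda>x. 0)"
  proof
    assume "q = (\<lambda>x. 0)"
    then have "(\<lambda>n. complex_of_real (d n)) \<longlonglongrightarrow> 0" using q_lim[OF one_closed] e_one by simp
    then have "(\<lambda>n. Re (complex_of_real (d n))) \<longlonglongrightarrow> Re 0" by (rule tendsto_Re)
    then have "d \<longlonglongrightarrow> 0" by simp
    then show False using LIMSEQ_le_const[of d 0 1] d1 by auto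
  qed
  then have "sa_idem q" using qCG qq star_q by (simp add: sa_idem_def)
  moreover have "conv (conv p p) q = (\<lambda>x. of_real \<rho> * q x)"
  proof -
    have "conv p p = (\<lambda>x. of_real \<rho> * e 0 x)" using \<rho> by (simp add: e_def)
    then show ?thesis using eq[of 0] by (simp add: conv_cmult eCG qCG)
  qed
  ultimately show ?thesis using \<rho> that by blast
qed

section \<open>Minimal idempotents\<close>

lemma sa_idem_one: 
  assumes "sa_idem q" shows "q \<one> = of_real (nn q)" "1 \<le> nn q"
proof -
  have q: "q \<in> CG" "conv q q = q" "star q = q" "q \<noteq> (\<lambda>x. 0)" using assms by (auto simp: sa_idem_def)
  show "q \<one> = of_real (nn q)" using conv_star_one[OF q(1) q(1)] inner_self[OF q(1)] q by simp
  have p: "nn q > 0" using nn_pos q by simp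
  \<comment> \<open>As \<open>q = conv q q\<close>, its sup norm is at most \<open>nn q\<close>.
    Estimating \<open>conv q q\<close> by sup norms then bounds \<open>nn q\<close> by its own
    square.\<close>
  have "norm (q x) \<le> nn q" if "x \<in> carrier G" for x
    using norm_conv_le[OF q(1) q(1) that] p q by simp
  then have "norm (conv q q \<one>) \<le> nn q * nn q"
    using p q by (intro norm_conv_le_sup) auto
  then have "nn q \<le> nn q * nn q" using q \<open>q \<one> = of_real (nn q)\<close> p by simp
  then show "1 \<le> nn q" using p by simp
qed

text \<open>The integer part of \<open>nn\<close> is minimised among the idempotents below
  \<open>q0\<close>. If \<open>q'\<close> were a proper one below \<open>q\<close>, the complement
  \<open>q - q'\<close> would also be an idempotent below \<open>q0\<close>, and its
  \<open>nn\<close> would be smaller than that of \<open>q\<close> by \<open>nn q'\<close>, hence by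
  at least 1.\<close>

lemma minimal_sa_idem:
  assumes "sa_idem q0"
  obtains q where "sa_idem q" "conv q q0 = q"
    "\<And>q'. sa_idem q' \<Longrightarrow> conv q' q = q' \<Longrightarrow> q' = q"
proof -
  define P where "P q \<longleftrightarrow> sa_idem q \<and> conv q q0 = q" for q
  have "P q0" using assms by (simp add: P_def sa_idem_def)
  obtain q where q: "P q" "\<And>y. P y \<Longrightarrow> nat \<lfloor>nn q\<rfloor> \<le> nat \<lfloor>nn y\<rfloor>"
    using ex_has_least_nat[of P q0 "\<lambda>q. nat \<lfloor>nn q\<rfloor>"] \<open>P q0\<close> by auto
  have qi: "sa_idem q" and q0: "conv q q0 = q" using q by (auto simp: P_def)
  have qC: "q \<in> CG" "conv q q = q" "star q = q" and q0C: "q0 \<in> CG"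
    using qi assms by (auto simp: sa_idem_def)
  have "q' = q" if i': "sa_idem q'" and sub: "conv q' q = q'" for q'
  proof (rule ccontr)
    assume ne: "q' \<noteq> q"
    have q'C: "q' \<in> CG" "conv q' q' = q'" "star q' = q'" using i' by (auto simp: sa_idem_def)
    define s where "s = (\<lambda>x. 1 * q x + (-1) * q' x)"
    have sC: "s \<in> CG" unfolding s_def by (intro CG_lin qC q'C)
    have sq: "conv q' s = (\<lambda>x. 0)" unfolding s_def using sub q'C qC by (subst conv_lin_right) auto
    have qs: "conv q s = s" unfolding s_def using sub q'C qC
      by (subst conv_lin_right) (auto simp: conv_commute[of q q'])
    have "conv s s = (\<lambda>x. 1 * conv q s x + (-1) * conv q' s x)"
      by (subst (1) s_def, subst conv_lin) (use qC q'C sC in auto)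
    then have ss: "conv s s = s" using sq qs by simp
    have "star s = s" unfolding s_def by (subst star_lin) (simp add: qC q'C)
    moreover have "s \<noteq> (\<lambda>x. 0)"
    proof
      assume "s = (\<lambda>x. 0)"
      then have "q x - q' x = 0" for x by (metis s_def mult_1 mult_minus1 add_uminus_conv_diff)
      then show False using ne by auto
    qed
    ultimately have si: "sa_idem s" using sC ss by (simp add: sa_idem_def)
    have "conv s q0 = conv (conv q s) q0" using qs by simp
    also have "\<dots> = conv s (conv q q0)" using qC sC q0C by (simp add: conv_commute[of q s] conv_assoc)
    also have "\<dots> = s" using q0 qs by (simp add: conv_commute[OF sC qC(1)])
    finally have "P s" using si by (simp add: P_def)
    then have le: "nat \<lfloor>nn q\<rfloor> \<le> nat \<lfloor>nn s\<rfloor>" using q by blast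
    have "complex_of_real (nn s) = of_real (nn q - nn q')"
      using sa_idem_one(1)[OF si] sa_idem_one(1)[OF qi] sa_idem_one(1)[OF i'] by (simp add: s_def)
    then have "nn s = nn q - nn q'" using of_real_eq_iff by blast
    then have "nn s \<le> nn q - 1" "nn q \<ge> 1" using sa_idem_one(2)[OF i'] sa_idem_one(2)[OF qi] by auto
    then have "nat \<lfloor>nn s\<rfloor> < nat \<lfloor>nn q\<rfloor>" by linarith
    with le show False by (meson leD)
  qed
  then show ?thesis using that qi q0 by blast
qed

text \<open>In the corner cut out by \<open>q\<close>, the square of a nonzero self-adjoint
  \<open>k\<close> is a positive multiple of \<open>q\<close>, because power iteration on
  \<open>k\<close> produces an idempotent below \<open>q\<close>, which must be \<open>q\<close>.
  For \<open>h\<close> with square \<open>r q\<close> and \<open>s\<close> the root of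
  \<open>r\<close>, the product of \<open>h - s q\<close> and \<open>h + s q\<close> is then 0. If
  the first factor is nonzero, its square is invertible in the corner, so the second factor
  vanishes.\<close>

lemma self_adjoint_multiple:
  assumes q: "sa_idem q" and min: "\<And>q'. sa_idem q' \<Longrightarrow> conv q' q = q' \<Longrightarrow> q' = q"
    and h: "h \<in> CG" "star h = h" "conv h q = h"
  obtains c :: complex where "h = (\<lambda>x. c * q x)"
proof -
  have qC: "q \<in> CG" "conv q q = q" "star q = q" using q by (auto simp: sa_idem_def)
  have sq: "\<exists>r>0. conv k k = (\<lambda>x. of_real r * q x)"
    if k: "k \<in> CG" "star k = k" "conv k q = k" "k \<noteq> (\<lambda>x. 0)" for k
  proof -
    obtain q' r where q': "sa_idem q'" "r > 0" "conv (conv k k) q' = (\<lambda>x. of_real r * q' x)"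
      using sa_idem_exists[OF k(1,2,4)] by blast
    have q'C: "q' \<in> CG" using q' by (simp add: sa_idem_def)
    note C = k(1) qC(1) q'C CG_conv
    have kk: "conv (conv k k) q = conv k k" using k C by (simp add: conv_assoc)
    have "(\<lambda>x. of_real r * conv q' q x) = conv (conv (conv k k) q') q"
      using q' C by (simp add: conv_cmult)
    also have "\<dots> = conv (conv (conv k k) q) q'"
      using C by (simp add: conv_assoc conv_commute[of q q'])
    also have "\<dots> = (\<lambda>x. of_real r * q' x)" using kk q' by simp
    finally have "conv q' q = q'" using q'(2) by (auto simp: fun_eq_iff)
    then have "q' = q" using min q' by simp
    then show ?thesis using kk q' by auto
  qed
  show ?thesis
  proof (cases "h = (\<lambda>x. 0)")
    case True
    then show ?thesis using that[of 0] by simp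
  next
    case False
    then obtain r where r: "r > 0" "conv h h = (\<lambda>x. of_real r * q x)" using sq h by blast
    define s where "s = complex_of_real (sqrt r)"
    have ss: "s * s = of_real r" using r by (simp add: s_def flip: of_real_mult)
    define k where "k = (\<lambda>x. 1 * h x + (- s) * q x)"
    define l where "l = (\<lambda>x. 1 * h x + s * q x)"
    have kC: "k \<in> CG" and lC: "l \<in> CG" unfolding k_def l_def by (intro CG_lin h qC)+
    have kq: "conv k q = k" unfolding k_def by (subst conv_lin) (use h qC in auto)
    have lq: "conv q l = l" unfolding l_def
      by (subst conv_lin_right) (use h qC in \<open>auto simp: conv_commute[of q h]\<close>)
    have k_star: "star k = k" unfolding k_def by (subst star_lin) (simp add: h qC s_def)
    show ?thesis
    proof (cases "k = (\<lambda>x. 0)")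
      case True
      then have "h x = s * q x" for x by (metis k_def add_eq_0_iff mult_minus_left mult_1 add.inverse_inverse)
      then show ?thesis using that by blast
    next
      case False
      then obtain r' where r': "r' > 0" "conv k k = (\<lambda>x. of_real r' * q x)" using sq kC k_star kq by blast
      have hl: "conv h l = (\<lambda>x. of_real r * q x + s * h x)" unfolding l_def
        by (subst conv_lin_right) (use h qC r in auto)
      have "conv k l = (\<lambda>x. 1 * conv h l x + (- s) * conv q l x)"
        unfolding k_def by (subst conv_lin) (use h qC lC in auto)
      also have "\<dots> = (\<lambda>x. 0)" using hl lq ss by (auto simp: l_def algebra_simps fun_eq_iff)
      finally have kl: "conv k l = (\<lambda>x. 0)" .
      have "(\<lambda>x. of_real r' * l x) = conv (conv k k) l" using r' lq lC qC by (simp add: conv_cmult)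
      also have "\<dots> = (\<lambda>x. 0)" using kl kC lC by (simp add: conv_assoc)
      finally have "l x = 0" for x using r' by (metis mult_eq_0_iff of_real_eq_0_iff less_irrefl)
      then have "h x = - s * q x" for x by (metis l_def add_eq_0_iff2 mult_1 mult_minus_left)
      then show ?thesis using that by blast
    qed
  qed
qed

section \<open>Characters from minimal idempotents, and nonvanishing Fourier coefficients\<close>

definition mchar :: "('g \<Rightarrow> complex) \<Rightarrow> bool" where
  "mchar \<psi> \<longleftrightarrow> \<psi> \<in> CG \<and> (\<forall>x\<in>carrier G. \<forall>y\<in>carrier G. \<psi> (x \<otimes> y) = \<psi> x * \<psi> y) \<and>
     (\<forall>x\<in>carrier G. norm (\<psi> x) = 1)"

lemma mchar_CG: "mchar \<psi> \<Longrightarrow> \<psi> \<in> CG"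
  and mchar_mult: "mchar \<psi> \<Longrightarrow> x \<in> carrier G \<Longrightarrow> y \<in> carrier G \<Longrightarrow> \<psi> (x \<otimes> y) = \<psi> x * \<psi> y"
  and mchar_norm: "mchar \<psi> \<Longrightarrow> x \<in> carrier G \<Longrightarrow> norm (\<psi> x) = 1"
  by (auto simp: mchar_def)

lemma mchar_one:
  assumes "mchar \<psi>" shows "\<psi> \<one> = 1"
  using mchar_mult[OF assms one_closed one_closed] mchar_norm[OF assms one_closed] by auto

lemma mchar_cnj:
  assumes "mchar \<psi>" "x \<in> carrier G" shows "\<psi> x * cnj (\<psi> x) = 1"
  using mchar_norm[OF assms] unfolding complex_norm_square[symmetric] by simp

lemma mchar_inv:
  assumes "mchar \<psi>" "x \<in> carrier G" shows "\<psi> (inv x) = cnj (\<psi> x)"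
proof -
  have "\<psi> (inv x) * \<psi> x = 1"
    using mchar_mult[OF assms(1) inv_closed[OF assms(2)] assms(2)] mchar_one[OF assms(1)] assms(2) by simp
  then show ?thesis using mchar_cnj[OF assms] by (metis mult.commute mult.left_commute mult.right_neutral)
qed

text \<open>Translates of \<open>q\<close> stay in its corner. A translate \<open>T\<close> and the
  opposite translate \<open>T'\<close> are exchanged by \<open>star\<close>, so
  \<open>T + T'\<close> and \<i> times \<open>T - T'\<close> are self-adjoint and hence multiples of
  \<open>q\<close>; so is \<open>T\<close>. An eigenfunction of all translations becomes
  multiplicative once its value at \<one> is normalised to 1.\<close>

lemma mchar_of_minimal:
  assumes q: "sa_idem q" and min: "\<And>q'. sa_idem q' \<Longrightarrow> conv q' q = q' \<Longrightarrow> q' = q"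
  shows "mchar (\<lambda>x. q x / q \<one>)" 
proof -
  have qC: "q \<in> CG" "conv q q = q" "star q = q" using q by (auto simp: sa_idem_def)
  have q1: "q \<one> = of_real (nn q)" "1 \<le> nn q" using sa_idem_one[OF q] by auto
  then have q1n: "q \<one> \<noteq> 0" by auto
  have "\<exists>c. translate g q = (\<lambda>x. c * q x)" if g: "g \<in> carrier G" for g
  proof -
    define T where "T = translate g q"
    define T' where "T' = translate (inv g) q"
    have C: "T \<in> CG" "T' \<in> CG" unfolding T_def T'_def using g qC by (auto intro: CG_translate)
    have st: "star T = T'" "star T' = T"
      unfolding T_def T'_def using g qC by (auto simp: star_translate)
    have cq: "conv T q = T" "conv T' q = T'"
      unfolding T_def T'_def using g qC
      by (auto simp: conv_commute[OF CG_translate[of q] qC(1)] conv_translate)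
    obtain c1 where c1: "(\<lambda>x. 1 * T x + 1 * T' x) = (\<lambda>x. c1 * q x)"
    proof (rule self_adjoint_multiple[OF q min])
      show "(\<lambda>x. 1 * T x + 1 * T' x) \<in> CG" by (intro CG_lin C)
      show "star (\<lambda>x. 1 * T x + 1 * T' x) = (\<lambda>x. 1 * T x + 1 * T' x)" by (subst star_lin) (auto simp: st)
      show "conv (\<lambda>x. 1 * T x + 1 * T' x) q = (\<lambda>x. 1 * T x + 1 * T' x)"
        by (subst conv_lin) (use C qC cq in auto)
    qed
    obtain c2 where c2: "(\<lambda>x. \<i> * T x + (- \<i>) * T' x) = (\<lambda>x. c2 * q x)"
    proof (rule self_adjoint_multiple[OF q min])
      show "(\<lambda>x. \<i> * T x + (- \<i>) * T' x) \<in> CG" by (intro CG_lin C)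
      show "star (\<lambda>x. \<i> * T x + (- \<i>) * T' x) = (\<lambda>x. \<i> * T x + (- \<i>) * T' x)" by (subst star_lin) (auto simp: st)
      show "conv (\<lambda>x. \<i> * T x + (- \<i>) * T' x) q = (\<lambda>x. \<i> * T x + (- \<i>) * T' x)"
        by (subst conv_lin) (use C qC cq in auto)
    qed
    have "T x = ((c1 - \<i> * c2) / 2) * q x" for x
    proof -
      have "T x + T' x = c1 * q x" "\<i> * T x - \<i> * T' x = c2 * q x"
        using fun_cong[OF c1, of x] fun_cong[OF c2, of x] by auto
      then have "\<i> * (c2 * q x) = (\<i> * \<i>) * (T x - T' x)"
        by (metis mult.assoc right_diff_distrib)
      then have "2 * T x = c1 * q x - \<i> * (c2 * q x)"
        unfolding \<open>T x + T' x = c1 * q x\<close>[symmetric] by simp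
      then show ?thesis by (simp add: algebra_simps)
    qed
    then show ?thesis unfolding T_def by blast
  qed
  then obtain c where c: "\<And>g. g \<in> carrier G \<Longrightarrow> translate g q = (\<lambda>x. c g * q x)" by metis
  have q_mult: "q (x \<otimes> g) = c g * q x" if "x \<in> carrier G" "g \<in> carrier G" for x g
    using fun_cong[OF c[OF that(2)], of x] that by (simp add: translate_def)
  have cq: "q g = c g * q \<one>" if "g \<in> carrier G" for g using q_mult[of \<one> g] that by simp
  have mult: "q (x \<otimes> y) / q \<one> = q x / q \<one> * (q y / q \<one>)" if "x \<in> carrier G" "y \<in> carrier G" for x y
    using q_mult[OF that] cq[OF that(2)] q1n by (simp add: field_simps)
  have le: "norm (q x / q \<one>) \<le> 1" if "x \<in> carrier G" for x
  proof -
    have "norm (q x) \<le> nn q" using norm_conv_le[OF qC(1) qC(1) that] q1 qC by simp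
    then show ?thesis using q1 by (simp add: norm_divide)
  qed
  \<comment> \<open>The values at \<open>x\<close> and at \<open>inv x\<close> have modulus at most
    1 and product 1.\<close>
  have "norm (q x / q \<one>) = 1" if x: "x \<in> carrier G" for x
  proof -
    have "q x / q \<one> * (q (inv x) / q \<one>) = 1" using mult[of x "inv x"] x q1n by simp
    then have "norm (q x / q \<one>) * norm (q (inv x) / q \<one>) = 1" by (metis norm_mult norm_one)
    moreover have "norm (q x / q \<one>) * norm (q (inv x) / q \<one>) \<le> norm (q x / q \<one>)"
      using le[of "inv x"] x by (intro mult_left_le) auto
    ultimately show ?thesis using le[OF x] by linarith
  qed
  moreover have "(\<lambda>x. q x / q \<one>) \<in> CG" using CG_cmult[OF qC(1), of "1 / q \<one>"] by simp
  ultimately show ?thesis using mult by (simp add: mchar_def)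
qed

text \<open>Power iteration is applied to \<open>p\<close>, the convolution of \<open>w\<close> with
  \<open>star w\<close>. On a minimal idempotent \<open>q\<close> below the limit,
  \<open>conv p p\<close> acts as a positive scalar, so \<open>conv w q\<close> cannot vanish. But
  \<open>q\<close> is a multiple of a character \<psi>, so \<open>conv w q\<close> is the Fourier
  coefficient of \<open>w\<close> at \<psi> times \<open>q\<close>.\<close>

theorem Peter_Weyl:
  assumes w: "w \<in> CG" "w \<noteq> (\<lambda>x. 0)"
  obtains \<psi> where "mchar \<psi>" "mean (\<lambda>x. w x * cnj (\<psi> x)) \<noteq> 0"
proof -
  define p where "p = conv w (star w)"
  have sw: "star w \<in> CG" using w CG_star by simp
  have pC: "p \<in> CG" unfolding p_def using w sw by (intro CG_conv)
  have "p \<one> = of_real (nn w)" using conv_star_one[OF w(1) w(1)] inner_self[OF w(1)] by (simp add: p_def)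
  then have pn: "p \<noteq> (\<lambda>x. 0)" using nn_pos[OF w] by auto
  have ps: "star p = p" unfolding p_def
    using w sw star_star[OF w(1)] by (simp add: star_conv conv_commute[of w "star w"])
  obtain q0 r where q0: "sa_idem q0" "r > 0" "conv (conv p p) q0 = (\<lambda>x. of_real r * q0 x)"
    using sa_idem_exists[OF pC ps pn] by blast
  obtain q where q: "sa_idem q" "conv q q0 = q"
    and min: "\<And>q'. sa_idem q' \<Longrightarrow> conv q' q = q' \<Longrightarrow> q' = q"
    using minimal_sa_idem[OF q0(1)] by blast
  have qC: "q \<in> CG" "q \<noteq> (\<lambda>x. 0)" and q0C: "q0 \<in> CG" using q q0 by (auto simp: sa_idem_def)
  define \<psi> where "\<psi> x = q x / q \<one>" for x
  have \<psi>: "mchar \<psi>" unfolding \<psi>_def[abs_def] using mchar_of_minimal[OF q(1) min] .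
  have q1: "q \<one> \<noteq> 0" using sa_idem_one[OF q(1)] by auto
  have "conv (conv p p) q = conv (conv (conv p p) q0) q"
    using q pC qC q0C by (simp add: conv_assoc CG_conv conv_commute[of q0 q])
  also have "\<dots> = (\<lambda>x. of_real r * q x)"
    using q0 q q0C qC by (simp add: conv_cmult conv_commute[of q0 q])
  finally have ppq: "conv (conv p p) q = (\<lambda>x. of_real r * q x)" .
  have wq: "conv w q \<noteq> (\<lambda>x. 0)"
  proof
    assume "conv w q = (\<lambda>x. 0)"
    then have "conv p q = (\<lambda>x. 0)"
      unfolding p_def using w sw qC by (simp add: conv_commute[of w "star w"] conv_assoc)
    then have "conv (conv p p) q = (\<lambda>x. 0)" using pC qC by (simp add: conv_assoc)
    then have "q x = 0" for x using ppq q0(2) by (metis mult_eq_0_iff of_real_eq_0_iff less_irrefl)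
    then show False using qC by auto
  qed
  have "mean (\<lambda>x. w x * cnj (\<psi> x)) \<noteq> 0"
  proof
    assume z: "mean (\<lambda>x. w x * cnj (\<psi> x)) = 0"
    have "conv w q x = 0" if x: "x \<in> carrier G" for x
    proof -
      have "mean (\<lambda>y. w y * q (inv y \<otimes> x)) = mean (\<lambda>y. (q \<one> * \<psi> x) * (w y * cnj (\<psi> y)))"
      proof (rule mean_cong)
        fix y assume y: "y \<in> carrier G"
        have "\<psi> (inv y) = cnj (\<psi> y)" using mchar_inv[OF \<psi> y] .
        moreover have "q (inv y \<otimes> x) = q \<one> * \<psi> (inv y \<otimes> x)" using q1 by (simp add: \<psi>_def)
        moreover have "\<psi> (inv y \<otimes> x) = \<psi> (inv y) * \<psi> x" using \<psi> x y by (simp add: mchar_def)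
        ultimately show "w y * q (inv y \<otimes> x) = (q \<one> * \<psi> x) * (w y * cnj (\<psi> y))" by simp
      qed
      also have "\<dots> = (q \<one> * \<psi> x) * mean (\<lambda>y. w y * cnj (\<psi> y))"
        using \<psi> w by (intro mean_cmult cts_inner) (auto simp: mchar_def)
      finally show ?thesis using x z by (simp add: conv_def)
    qed
    then have "conv w q = (\<lambda>x. 0)" using CG_outside[OF CG_conv[OF w(1) qC(1)]] by blast
    then show False using wq by simp
  qed
  then show ?thesis using that \<psi> by blast
qed

end

text \<open>Gives complex functions on any type the linear algebra of HOL: bounds on independent
  sets are used for characters, basis expansions for homomorphisms into \<complex>.\<close>

definition fun_scale :: "complex \<Rightarrow> ('x \<Rightarrow> complex) \<Rightarrow> 'x \<Rightarrow> complex" where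
  "fun_scale c f = (\<lambda>x. c * f x)"

interpretation fun_vs: vector_space "fun_scale :: complex \<Rightarrow> ('x \<Rightarrow> complex) \<Rightarrow> 'x \<Rightarrow> complex"
  by standard (auto simp: fun_scale_def fun_eq_iff algebra_simps)

lemma continuous_map_cmult:
  fixes f :: "'x \<Rightarrow> complex"
  shows "continuous_map X euclidean f \<Longrightarrow> continuous_map X euclidean (\<lambda>x. c * f x)"
  by (intro continuous_map_complex_mult continuous_map_const_euclidean)

lemma sum_fun_apply: "(\<Sum>i\<in>I. f i) x = (\<Sum>i\<in>I. (f i x :: complex))"
  by (induction I rule: infinite_finite_induct) auto

section \<open>Orthogonality, trigonometric polynomials and duality\<close>

context compact_ab_group
begin

definition mtriv :: "'g \<Rightarrow> complex" where "mtriv x = (if x \<in> carrier G then 1 else 0)"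

lemma mchar_mtriv: "mchar mtriv"
  by (auto simp: mchar_def mtriv_def intro!: CG_I[where h="\<lambda>x. 1"])

lemma mchar_times:
  assumes "mchar \<psi>" "mchar \<phi>" shows "mchar (\<lambda>x. \<psi> x * \<phi> x)"
proof -
  have "(\<lambda>x. \<psi> x * \<phi> x) \<in> CG"
    using assms continuous_map_complex_mult[of X \<psi> \<phi>] unfolding mchar_def CG_def by auto
  then show ?thesis using assms unfolding mchar_def by (auto simp: norm_mult)
qed

lemma mchar_cnj_fun:
  assumes "mchar \<psi>" shows "mchar (\<lambda>x. cnj (\<psi> x))"
proof -
  have "(\<lambda>x. cnj (\<psi> x)) \<in> CG"
    using assms continuous_map_cnj[of X \<psi>] unfolding mchar_def CG_def by auto
  then show ?thesis using assms unfolding mchar_def by auto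
qed

lemma mean_mchar:
  assumes "mchar \<psi>" shows "mean \<psi> = (if \<psi> = mtriv then 1 else 0)"
proof (cases "\<psi> = mtriv")
  case True
  have "mean mtriv = mean (\<lambda>x. 1)" by (rule mean_cong) (simp add: mtriv_def)
  then show ?thesis using True by simp
next
  case False
  then obtain a where a: "a \<in> carrier G" "\<psi> a \<noteq> 1"
    using CG_ext[OF mchar_CG[OF assms] mchar_CG[OF mchar_mtriv]] by (auto simp: mtriv_def)
  have "mean \<psi> = mean (\<lambda>x. \<psi> (x \<otimes> a))"
    using mean_translate[OF CG_cts[OF mchar_CG[OF assms]] a(1)] by simp
  also have "\<dots> = mean (\<lambda>x. \<psi> a * \<psi> x)"
    by (rule mean_cong) (simp add: mchar_mult[OF assms _ a(1)])
  also have "\<dots> = \<psi> a * mean \<psi>" by (rule mean_cmult[OF CG_cts[OF mchar_CG[OF assms]]])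
  finally show ?thesis using a False by simp
qed

lemma mchar_orthogonal:
  assumes "mchar \<psi>" "mchar \<phi>"
  shows "mean (\<lambda>x. \<psi> x * cnj (\<phi> x)) = (if \<psi> = \<phi> then 1 else 0)"
proof -
  have "(\<lambda>x. \<psi> x * cnj (\<phi> x)) = mtriv \<longleftrightarrow> \<psi> = \<phi>"
  proof
    assume e: "(\<lambda>x. \<psi> x * cnj (\<phi> x)) = mtriv"
    show "\<psi> = \<phi>"
    proof (rule CG_ext)
      fix x assume x: "x \<in> carrier G"
      have "\<psi> x * cnj (\<phi> x) = 1" using fun_cong[OF e, of x] x by (simp add: mtriv_def)
      then show "\<psi> x = \<phi> x" using mchar_cnj[OF assms(2) x]
        by (metis mult.commute mult.left_commute mult.right_neutral)
    qed (use assms mchar_CG in auto)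
  next
    assume e: "\<psi> = \<phi>"
    show "(\<lambda>x. \<psi> x * cnj (\<phi> x)) = mtriv"
    proof
      fix x show "\<psi> x * cnj (\<phi> x) = mtriv x"
        using mchar_cnj[OF assms(2), of x] CG_outside[OF mchar_CG[OF assms(2)], of x] e
        by (auto simp: mtriv_def)
    qed
  qed
  then show ?thesis using mean_mchar[OF mchar_times[OF assms(1) mchar_cnj_fun[OF assms(2)]]] by simp
qed

lemma mean_mchar_sum:
  assumes "finite T" "T \<subseteq> Collect mchar" "mchar \<phi>"
  shows "mean (\<lambda>x. (\<Sum>\<psi>\<in>T. c \<psi> * \<psi> x) * cnj (\<phi> x)) = (if \<phi> \<in> T then c \<phi> else 0)"
proof -
  have ct: "cts (\<lambda>x. \<psi> x * cnj (\<phi> x))" if "\<psi> \<in> T" for \<psi>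
    using assms that by (intro cts_inner mchar_CG) auto
  have "mean (\<lambda>x. (\<Sum>\<psi>\<in>T. c \<psi> * \<psi> x) * cnj (\<phi> x)) = mean (\<lambda>x. \<Sum>\<psi>\<in>T. c \<psi> * (\<psi> x * cnj (\<phi> x)))"
    by (simp add: sum_distrib_right mult.assoc)
  also have "\<dots> = (\<Sum>\<psi>\<in>T. mean (\<lambda>x. c \<psi> * (\<psi> x * cnj (\<phi> x))))"
    by (intro mean_sum continuous_map_cmult ct)
  also have "\<dots> = (\<Sum>\<psi>\<in>T. c \<psi> * (if \<psi> = \<phi> then 1 else 0))"
    by (rule sum.cong) (use ct assms in \<open>auto simp: mean_cmult mchar_orthogonal\<close>)
  also have "\<dots> = (if \<phi> \<in> T then c \<phi> else 0)" using assms(1) by (simp add: if_distrib cong: if_cong)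
  finally show ?thesis .
qed

lemma mchar_sum_zero:
  assumes "finite T" "T \<subseteq> Collect mchar" "\<And>x. x \<in> carrier G \<Longrightarrow> (\<Sum>\<psi>\<in>T. c \<psi> * \<psi> x) = 0" "\<phi> \<in> T"
  shows "c \<phi> = 0"
proof -
  have "mean (\<lambda>x. (\<Sum>\<psi>\<in>T. c \<psi> * \<psi> x) * cnj (\<phi> x)) = mean (\<lambda>x. 0)"
    by (rule mean_cong) (use assms in auto)
  then show ?thesis using mean_mchar_sum[OF assms(1,2), of \<phi> c] assms by auto
qed

lemma independent_mchar: "T \<subseteq> Collect mchar \<Longrightarrow> fun_vs.independent T"
  unfolding fun_vs.independent_explicit_module
proof (intro allI impI)
  fix t u \<phi> assume T: "T \<subseteq> Collect mchar" and t: "finite t" "t \<subseteq> T" "\<phi> \<in> t"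
    and z: "(\<Sum>v\<in>t. fun_scale (u v) v) = 0"
  have "(\<Sum>v\<in>t. u v * v x) = 0" for x
    using fun_cong[OF z, of x] by (simp add: sum_fun_apply fun_scale_def)
  then show "u \<phi> = 0" using mchar_sum_zero[of t u \<phi>] T t by auto
qed

text \<open>The Fourier coefficients of \<open>f\<close> vanish except at characters in the span of the \<open>a i\<close>.\<close>

lemma translation_finite_trig_poly:
  fixes f :: "'g \<Rightarrow> complex"
  assumes f: "cts f" and I: "finite I" and b: "\<And>i. i \<in> I \<Longrightarrow> cts (b i)"
    and fab: "\<And>g h. g \<in> carrier G \<Longrightarrow> h \<in> carrier G \<Longrightarrow> f (g \<otimes> h) = (\<Sum>i\<in>I. a i g * b i h)"
  obtains T c where "finite T" "T \<subseteq> Collect mchar"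
    "\<And>g. g \<in> carrier G \<Longrightarrow> f g = (\<Sum>\<psi>\<in>T. c \<psi> * \<psi> g)"
proof -
  define F where "F = {\<psi>. mchar \<psi> \<and> mean (\<lambda>x. f x * cnj (\<psi> x)) \<noteq> 0}"
  \<comment> \<open>The \<open>a i\<close> are cut off because \<psi>, which vanishes outside the
    carrier, is to be a combination of them on the whole type.\<close>
  define a' where "a' i = (\<lambda>x. if x \<in> carrier G then a i x else 0)" for i
  have cC: "cts (\<lambda>x. k x * cnj (\<psi> x))" if "cts k" "mchar \<psi>" for k \<psi>
    using that CG_cts[OF mchar_CG] continuous_map_cnj by (intro continuous_map_complex_mult) auto
  have "F \<subseteq> fun_vs.span (a' ` I)"
  proof
    fix \<psi> assume "\<psi> \<in> F"
    then have \<psi>: "mchar \<psi>" "mean (\<lambda>x. f x * cnj (\<psi> x)) \<noteq> 0" by (auto simp: F_def)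
    define m where "m = mean (\<lambda>x. f x * cnj (\<psi> x))"
    define d where "d i = mean (\<lambda>x. b i x * cnj (\<psi> x)) / m" for i
    have m: "m \<noteq> 0" using \<psi> by (simp add: m_def)
    have "\<psi> = (\<Sum>i\<in>I. fun_scale (d i) (a' i))"
    proof
      fix g show "\<psi> g = (\<Sum>i\<in>I. fun_scale (d i) (a' i)) g"
      proof (cases "g \<in> carrier G")
        case False
        then show ?thesis using CG_outside[OF mchar_CG[OF \<psi>(1)]]
          by (simp add: sum_fun_apply fun_scale_def a'_def)
      next
        case g: True
        \<comment> \<open>Invariance under translation by \<open>g\<close> pulls the conjugate of
          \<psi> \<open>g\<close> out of the Fourier coefficient, while \<open>fab\<close> expands
          the translate of \<open>f\<close>. Solving for \<psi> \<open>g\<close> yields the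
          coefficients \<open>d i\<close>.\<close>
        have "m = mean (\<lambda>h. f (h \<otimes> g) * cnj (\<psi> (h \<otimes> g)))"
          unfolding m_def using mean_translate[OF cC[OF f \<psi>(1)] g] by simp
        also have "\<dots> = mean (\<lambda>h. cnj (\<psi> g) * (\<Sum>i\<in>I. a i g * (b i h * cnj (\<psi> h))))"
        proof (rule mean_cong)
          fix h assume h: "h \<in> carrier G"
          have "f (h \<otimes> g) = (\<Sum>i\<in>I. a i g * b i h)" using fab[OF g h] g h by (simp add: m_comm)
          then show "f (h \<otimes> g) * cnj (\<psi> (h \<otimes> g)) = cnj (\<psi> g) * (\<Sum>i\<in>I. a i g * (b i h * cnj (\<psi> h)))"
            by (simp add: mchar_mult[OF \<psi>(1) h g] sum_distrib_left sum_distrib_right mult_ac)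
        qed
        also have "\<dots> = cnj (\<psi> g) * (\<Sum>i\<in>I. a i g * mean (\<lambda>h. b i h * cnj (\<psi> h)))"
        proof -
          have ci: "cts (\<lambda>h. a i g * (b i h * cnj (\<psi> h)))" if "i \<in> I" for i
            using continuous_map_complex_mult[OF continuous_map_const_euclidean cC[OF b[OF that] \<psi>(1)]] .
          have "cts (\<lambda>h. \<Sum>i\<in>I. a i g * (b i h * cnj (\<psi> h)))" using I ci by (rule continuous_map_sum)
          then show ?thesis
            using mean_cmult mean_sum[where f="\<lambda>i h. a i g * (b i h * cnj (\<psi> h))", OF ci] cC[OF b \<psi>(1)] by simp
        qed
        also have "\<dots> = cnj (\<psi> g) * (\<Sum>i\<in>I. m * (d i * a i g))"
          using m by (simp add: d_def mult_ac)
        finally have "m = m * (cnj (\<psi> g) * (\<Sum>i\<in>I. d i * a i g))"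
          by (simp add: sum_distrib_left mult_ac)
        then have "cnj (\<psi> g) * (\<Sum>i\<in>I. d i * a i g) = 1" using m by simp
        then have "\<psi> g = (\<Sum>i\<in>I. d i * a i g)" using mchar_cnj[OF \<psi>(1) g]
          by (metis mult.commute mult.left_commute mult.right_neutral)
        then show ?thesis using g by (simp add: sum_fun_apply fun_scale_def a'_def)
      qed
    qed
    also have "\<dots> \<in> fun_vs.span (a' ` I)"
      by (intro fun_vs.span_sum fun_vs.span_scale fun_vs.span_base) auto
    finally show "\<psi> \<in> fun_vs.span (a' ` I)" .
  qed
  moreover have "F \<subseteq> Collect mchar" by (auto simp: F_def)
  \<comment> \<open>Characters are linearly independent, so only finitely many fit into the span of
    finitely many functions.\<close>
  ultimately have F: "finite F" "F \<subseteq> Collect mchar"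
    using fun_vs.independent_span_bound[of "a' ` I" F] independent_mchar I by auto
  define c where "c \<psi> = mean (\<lambda>x. f x * cnj (\<psi> x))" for \<psi>
  define S where "S x = (\<Sum>\<psi>\<in>F. c \<psi> * \<psi> x)" for x
  \<comment> \<open>The remainder after subtracting the Fourier sum; all its Fourier coefficients
    vanish, so \<open>Peter_Weyl\<close> forces it to be 0.\<close>
  define w where "w x = (if x \<in> carrier G then f x - S x else 0)" for x
  have S: "cts S" unfolding S_def
    using F by (intro continuous_map_sum continuous_map_cmult CG_cts[OF mchar_CG]) auto
  have wC: "w \<in> CG"
    by (rule CG_I[where h="\<lambda>x. f x - S x"]) (use f S in \<open>auto simp: w_def intro!: continuous_map_diff\<close>)
  have "mean (\<lambda>x. w x * cnj (\<psi> x)) = 0" if \<psi>: "mchar \<psi>" for \<psi>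
  proof -
    have "mean (\<lambda>x. w x * cnj (\<psi> x)) = mean (\<lambda>x. f x * cnj (\<psi> x) - S x * cnj (\<psi> x))"
      by (rule mean_cong) (simp add: w_def algebra_simps)
    also have "\<dots> = c \<psi> - mean (\<lambda>x. S x * cnj (\<psi> x))"
      unfolding c_def by (intro mean_diff cC f S \<psi>)
    also have "mean (\<lambda>x. S x * cnj (\<psi> x)) = (if \<psi> \<in> F then c \<psi> else 0)"
      unfolding S_def by (rule mean_mchar_sum[OF F \<psi>])
    also have "\<dots> = c \<psi>" using \<psi> by (simp add: F_def c_def)
    finally show ?thesis by simp
  qed
  then have w0: "w = (\<lambda>x. 0)" using Peter_Weyl[OF wC] by blast
  have "f g = (\<Sum>\<psi>\<in>F. c \<psi> * \<psi> g)" if "g \<in> carrier G" for g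
    using fun_cong[OF w0, of g] that by (simp add: w_def S_def)
  then show ?thesis using F that by blast
qed

text \<open>A Urysohn function \<open>u\<close> for \<one> and \<open>a\<close> differs from its
  translate by \<open>a\<close>, so the difference has a nonzero Fourier coefficient. A character
  with value 1 at \<open>a\<close> has the same coefficient on \<open>u\<close> and on its
  translate, and is thereby excluded.\<close>

theorem mchar_separates:
  assumes a: "a \<in> carrier G" "a \<noteq> \<one>"
  obtains \<psi> where "mchar \<psi>" "\<psi> a \<noteq> 1"
proof -
  have "normal_space X" using compact_G Hausdorff_G compact_Hausdorff_or_regular_imp_normal_space by blast
  moreover have "closedin X {\<one>}" "closedin X {a}"
    using Hausdorff_G a by (auto intro!: closedin_Hausdorff_singleton)
  ultimately obtain u0 where u0: "continuous_map X euclideanreal u0" "u0 ` {\<one>} \<subseteq> {0}" "u0 ` {a} \<subseteq> {1}"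
    using Urysohn_lemma_alt[of X "{\<one>}" "{a}" 0 1] a by auto
  define u where "u x = complex_of_real (u0 x)" for x
  have u: "cts u" unfolding u_def using u0 continuous_map_of_real by blast
  define w where "w x = (if x \<in> carrier G then u x - u (x \<otimes> a) else 0)" for x
  have wC: "w \<in> CG" by (rule CG_I[where h="\<lambda>x. u x - u (x \<otimes> a)"])
    (use u a in \<open>auto simp: w_def intro!: continuous_map_diff cts_translate\<close>)
  have "w \<one> \<noteq> 0" using u0 a by (simp add: w_def u_def)
  then have "w \<noteq> (\<lambda>x. 0)" by auto
  then obtain \<psi> where \<psi>: "mchar \<psi>" "mean (\<lambda>x. w x * cnj (\<psi> x)) \<noteq> 0" using Peter_Weyl[OF wC] by blast
  have c: "cts (\<lambda>x. u x * cnj (\<psi> x))"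
    using u CG_cts[OF mchar_CG[OF \<psi>(1)]] by (intro continuous_map_complex_mult continuous_map_cnj)
  have "\<psi> a \<noteq> 1"
  proof
    assume 1: "\<psi> a = 1"
    have "mean (\<lambda>x. w x * cnj (\<psi> x)) = mean (\<lambda>x. u x * cnj (\<psi> x) - u (x \<otimes> a) * cnj (\<psi> (x \<otimes> a)))"
      by (rule mean_cong) (simp add: w_def mchar_mult[OF \<psi>(1) _ a(1)] 1 algebra_simps)
    also have "\<dots> = mean (\<lambda>x. u x * cnj (\<psi> x)) - mean (\<lambda>x. u (x \<otimes> a) * cnj (\<psi> (x \<otimes> a)))"
      by (intro mean_diff c cts_translate[OF c a(1)])
    also have "\<dots> = 0" using mean_translate[OF c a(1)] by simp
    finally show False using \<psi> by simp
  qed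
  then show ?thesis using that \<psi> by blast
qed

text \<open>If \<theta> were evaluation at a point \<open>g\<close>, the second function would be
  the translate of the first by \<open>inv g\<close>. Twisting imitates this translation on
  trigonometric polynomials before \<open>g\<close> is known. As a relation it needs no proof of
  independence of the chosen expansion.\<close>

inductive twisted :: "(('g \<Rightarrow> complex) \<Rightarrow> complex) \<Rightarrow> ('g \<Rightarrow> complex) \<Rightarrow> ('g \<Rightarrow> complex) \<Rightarrow> bool"
  for \<theta> where
  twisted_mchar: "mchar \<psi> \<Longrightarrow> twisted \<theta> \<psi> (\<lambda>x. cnj (\<theta> \<psi>) * \<psi> x)"
| twisted_add: "twisted \<theta> f f' \<Longrightarrow> twisted \<theta> h h' \<Longrightarrow> twisted \<theta> (\<lambda>x. f x + h x) (\<lambda>x. f' x + h' x)"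
| twisted_cmult: "twisted \<theta> f f' \<Longrightarrow> twisted \<theta> (\<lambda>x. c * f x) (\<lambda>x. c * f' x)"

section \<open>Realising a homomorphism on the characters as evaluation at a point\<close>

context
  fixes \<theta> :: "('g \<Rightarrow> complex) \<Rightarrow> complex"
  assumes \<theta>_mult: "\<And>\<psi> \<phi>. mchar \<psi> \<Longrightarrow> mchar \<phi> \<Longrightarrow> \<theta> (\<lambda>x. \<psi> x * \<phi> x) = \<theta> \<psi> * \<theta> \<phi>"
    and \<theta>_norm: "\<And>\<psi>. mchar \<psi> \<Longrightarrow> norm (\<theta> \<psi>) = 1"
begin

lemma \<theta>_triv: "\<theta> mtriv = 1"
proof -
  have "(\<lambda>x. mtriv x * mtriv x) = mtriv" by (auto simp: mtriv_def)
  then have "\<theta> mtriv * \<theta> mtriv = \<theta> mtriv" using \<theta>_mult[OF mchar_mtriv mchar_mtriv] by simp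
  then show ?thesis using \<theta>_norm[OF mchar_mtriv] by auto
qed

lemma \<theta>_cnj: assumes "mchar \<psi>" shows "\<theta> (\<lambda>x. cnj (\<psi> x)) = cnj (\<theta> \<psi>)"
proof -
  have "(\<lambda>x. \<psi> x * cnj (\<psi> x)) = mtriv"
    using mchar_cnj[OF assms] CG_outside[OF mchar_CG[OF assms]] by (auto simp: mtriv_def)
  then have "\<theta> \<psi> * \<theta> (\<lambda>x. cnj (\<psi> x)) = 1"
    using \<theta>_mult[OF assms mchar_cnj_fun[OF assms]] \<theta>_triv by simp
  moreover have "\<theta> \<psi> * cnj (\<theta> \<psi>) = 1"
    using \<theta>_norm[OF assms] unfolding complex_norm_square[symmetric] by simp
  ultimately show ?thesis by (metis mult.commute mult.left_commute mult.right_neutral)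
qed

lemma twisted_cts:
  "twisted \<theta> f f' \<Longrightarrow> cts f \<and> cts f'"
proof (induction rule: twisted.induct)
  case (twisted_mchar \<psi>)
  then show ?case using CG_cts[OF mchar_CG] by (simp add: continuous_map_complex_mult)
next
  case (twisted_add f f' h h')
  then show ?case by (simp add: continuous_map_add)
next
  case (twisted_cmult f f' c)
  then show ?case by (simp add: continuous_map_complex_mult)
qed

text \<open>The formal counterpart of translation invariance: the mean sees only the trivial
  character, where \<theta> is 1.\<close>

lemma twisted_mean: "twisted \<theta> f f' \<Longrightarrow> mean f' = mean f"
proof (induction rule: twisted.induct)
  case (twisted_mchar \<psi>)
  then show ?case using mean_cmult[OF CG_cts[OF mchar_CG]] mean_mchar[of \<psi>] \<theta>_triv by simp
next
  case (twisted_add f f' h h')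
  then show ?case using twisted_cts by (simp add: mean_add)
next
  case (twisted_cmult f f' c)
  then show ?case using twisted_cts by (simp add: mean_cmult)
qed

lemma twisted_mult_mchar:
  assumes "twisted \<theta> f f'" "mchar \<phi>"
  shows "twisted \<theta> (\<lambda>x. f x * \<phi> x) (\<lambda>x. f' x * (cnj (\<theta> \<phi>) * \<phi> x))"
  using assms(1)
proof (induction rule: twisted.induct)
  case (twisted_mchar \<psi>)
  show ?case
    using twisted.twisted_mchar[OF mchar_times[OF twisted_mchar assms(2)], of \<theta>] \<theta>_mult[OF twisted_mchar assms(2)]
    by (simp add: mult_ac)
next
  case (twisted_add f f' h h')
  then show ?case using twisted.twisted_add[OF twisted_add.IH] by (simp add: distrib_right)
next
  case (twisted_cmult f f' c)
  then show ?case using twisted.twisted_cmult[OF twisted_cmult.IH, of c] by (simp add: mult.assoc)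
qed

lemma twisted_mult:
  assumes "twisted \<theta> h h'" "twisted \<theta> f f'"
  shows "twisted \<theta> (\<lambda>x. f x * h x) (\<lambda>x. f' x * h' x)"
  using assms(1)
proof (induction rule: twisted.induct)
  case (twisted_mchar \<psi>)
  then show ?case using twisted_mult_mchar[OF assms(2)] by blast
next
  case (twisted_add h1 h1' h2 h2')
  then show ?case using twisted.twisted_add[OF twisted_add.IH] by (simp add: distrib_left)
next
  case (twisted_cmult h h' c)
  then show ?case using twisted.twisted_cmult[OF twisted_cmult.IH, of c] by (simp add: mult_ac)
qed

text \<open>Exponents start at 1: the zeroth power is the constant 1 on the whole type, while
  twisted functions vanish outside the carrier.\<close>

lemma twisted_power:
  assumes "twisted \<theta> f f'" shows "twisted \<theta> (\<lambda>x. f x ^ Suc n) (\<lambda>x. f' x ^ Suc n)"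
proof (induction n)
  case (Suc n)
  then show ?case using twisted_mult[OF Suc assms] by simp
qed (use assms in simp)

lemma twisted_sum:
  assumes "finite T" "T \<noteq> {}" "\<And>i. i \<in> T \<Longrightarrow> twisted \<theta> (f i) (f' i)"
  shows "twisted \<theta> (\<lambda>x. \<Sum>i\<in>T. f i x) (\<lambda>x. \<Sum>i\<in>T. f' i x)"
  using assms
proof (induction T rule: finite_ne_induct)
  case (insert i T)
  then show ?case using twisted_add[of \<theta> "f i" "f' i"] by simp
qed simp

text \<open>If no point solved all equations, the twist would have sup norm below \<open>1\<close>. But twisting
  preserves the mean of every power, and so detects the sup norm \<open>1\<close> of the untwisted function.\<close>

lemma finite_interpolation:
  assumes T: "finite T" "T \<noteq> {}" "T \<subseteq> Collect mchar"
  obtains g where "g \<in> carrier G" "\<And>\<psi>. \<psi> \<in> T \<Longrightarrow> \<psi> g = \<theta> \<psi>"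
proof -
  define n where "n = real (card T)"
  have n: "n > 0" using T by (simp add: n_def card_gt_0_iff)
  \<comment> \<open>The map taking \<open>z\<close> to \<open>(1 + Re z) / 2\<close> sends the unit
    circle into the unit interval and takes the value 1 only at \<open>z = 1\<close>. So
    \<open>s\<close> reaches 1 exactly at the common solutions of all equations, whereas
    \<open>s0\<close> reaches 1 at \<one>.\<close>
  define s0 where "s0 x = (\<Sum>\<psi>\<in>T. (1 + Re (\<psi> x)) / 2) / n" for x
  define s where "s x = (\<Sum>\<psi>\<in>T. (1 + Re (cnj (\<theta> \<psi>) * \<psi> x)) / 2) / n" for x
  \<comment> \<open>The same two functions as trigonometric polynomials, with \<open>Re z\<close>
    written as half the sum of \<open>z\<close> and its conjugate; this makes them a twisted
    pair.\<close>
  define f0 where "f0 x = of_real (1 / (4 * n)) * (\<Sum>\<psi>\<in>T. 2 * mtriv x + (\<psi> x + cnj (\<psi> x)))" for x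
  define f where "f x = of_real (1 / (4 * n)) * (\<Sum>\<psi>\<in>T. 2 * mtriv x + (cnj (\<theta> \<psi>) * \<psi> x + \<theta> \<psi> * cnj (\<psi> x)))" for x
  have tw: "twisted \<theta> f0 f" unfolding f0_def f_def
  proof (intro twisted_cmult twisted_sum T(1,2))
    fix \<psi> assume "\<psi> \<in> T"
    then have \<psi>: "mchar \<psi>" using T by auto
    have "twisted \<theta> (\<lambda>x. cnj (\<psi> x)) (\<lambda>x. \<theta> \<psi> * cnj (\<psi> x))"
      using twisted_mchar[OF mchar_cnj_fun[OF \<psi>], of \<theta>] \<theta>_cnj[OF \<psi>] by simp
    moreover have "twisted \<theta> mtriv mtriv" using twisted_mchar[OF mchar_mtriv, of \<theta>] \<theta>_triv by simp
    ultimately show "twisted \<theta> (\<lambda>x. 2 * mtriv x + (\<psi> x + cnj (\<psi> x)))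
       (\<lambda>x. 2 * mtriv x + (cnj (\<theta> \<psi>) * \<psi> x + \<theta> \<psi> * cnj (\<psi> x)))"
      using twisted_mchar[OF \<psi>] by (intro twisted_add twisted_cmult)
  qed
  have f0s: "f0 x = of_real (s0 x)" if "x \<in> carrier G" for x
  proof -
    have "2 * mtriv x + (\<psi> x + cnj (\<psi> x)) = of_real (4 * ((1 + Re (\<psi> x)) / 2))" for \<psi>
      using that by (simp add: mtriv_def complex_eq_iff)
    then have "f0 x = of_real (1 / (4 * n)) * (\<Sum>\<psi>\<in>T. of_real (4 * ((1 + Re (\<psi> x)) / 2)))"
      unfolding f0_def by presburger
    also have "\<dots> = of_real (1 / (4 * n) * (4 * (\<Sum>\<psi>\<in>T. (1 + Re (\<psi> x)) / 2)))"
      by (simp only: of_real_sum sum_distrib_left of_real_mult)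
    also have "1 / (4 * n) * (4 * (\<Sum>\<psi>\<in>T. (1 + Re (\<psi> x)) / 2)) = s0 x" by (simp add: s0_def)
    finally show ?thesis .
  qed
  have fs: "f x = of_real (s x)" if "x \<in> carrier G" for x
  proof -
    have "2 * mtriv x + (cnj (\<theta> \<psi>) * \<psi> x + \<theta> \<psi> * cnj (\<psi> x)) = of_real (4 * ((1 + Re (cnj (\<theta> \<psi>) * \<psi> x)) / 2))" for \<psi>
      using that by (simp add: mtriv_def complex_eq_iff)
    then have "f x = of_real (1 / (4 * n)) * (\<Sum>\<psi>\<in>T. of_real (4 * ((1 + Re (cnj (\<theta> \<psi>) * \<psi> x)) / 2)))"
      unfolding f_def by presburger
    also have "\<dots> = of_real (1 / (4 * n) * (4 * (\<Sum>\<psi>\<in>T. (1 + Re (cnj (\<theta> \<psi>) * \<psi> x)) / 2)))"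
      by (simp only: of_real_sum sum_distrib_left of_real_mult)
    also have "1 / (4 * n) * (4 * (\<Sum>\<psi>\<in>T. (1 + Re (cnj (\<theta> \<psi>) * \<psi> x)) / 2)) = s x" by (simp add: s_def)
    finally show ?thesis .
  qed
  have cs: "cts s0" "cts s"
    using continuous_map_Re twisted_cts[OF tw] cts_cong[of s0 "\<lambda>x. Re (f0 x)"] cts_cong[of s "\<lambda>x. Re (f x)"] f0s fs by auto
  have bound: "0 \<le> (\<Sum>\<psi>\<in>T. (1 + Re (k \<psi>)) / 2) / n" "(\<Sum>\<psi>\<in>T. (1 + Re (k \<psi>)) / 2) / n \<le> 1"
    if "\<And>\<psi>. \<psi> \<in> T \<Longrightarrow> norm (k \<psi>) = 1" for k
  proof -
    have k: "-1 \<le> Re (k \<psi>)" "Re (k \<psi>) \<le> 1" if "\<psi> \<in> T" for \<psi>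
      using \<open>\<And>\<psi>. \<psi> \<in> T \<Longrightarrow> norm (k \<psi>) = 1\<close>[OF that] abs_Re_le_cmod[of "k \<psi>"] by linarith+
    show "0 \<le> (\<Sum>\<psi>\<in>T. (1 + Re (k \<psi>)) / 2) / n"
      by (intro divide_nonneg_nonneg sum_nonneg) (use k n in force)+
    have "(\<Sum>\<psi>\<in>T. (1 + Re (k \<psi>)) / 2) \<le> (\<Sum>\<psi>\<in>T. 1)" by (rule sum_mono) (use k in force)
    then show "(\<Sum>\<psi>\<in>T. (1 + Re (k \<psi>)) / 2) / n \<le> 1" using n by (simp add: n_def)
  qed
  have Tm: "mchar \<psi>" if "\<psi> \<in> T" for \<psi> using T that by auto
  have s0b: "0 \<le> s0 x" "s0 x \<le> 1" if "x \<in> carrier G" for x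
    unfolding s0_def using bound[of "\<lambda>\<psi>. \<psi> x"] mchar_norm[OF Tm that] by auto
  have sb: "0 \<le> s x" "s x \<le> 1" if "x \<in> carrier G" for x
    unfolding s_def using bound[of "\<lambda>\<psi>. cnj (\<theta> \<psi>) * \<psi> x"] mchar_norm[OF Tm that] \<theta>_norm[OF Tm] by (auto simp: norm_mult)
  have "compactin euclidean (s ` carrier G)"
    using image_compactin[OF _ cs(2)] compact_G by (metis compact_space_def topspace_G)
  then obtain g where g: "g \<in> carrier G" "\<And>x. x \<in> carrier G \<Longrightarrow> s x \<le> s g"
    using compact_attains_sup[of "s ` carrier G"] one_closed by auto
  have pw: "rmean (\<lambda>x. s0 x ^ Suc N) = rmean (\<lambda>x. s x ^ Suc N)" for N
  proof -
    have "mean (\<lambda>x. of_real (s0 x ^ Suc N)) = mean (\<lambda>x. f0 x ^ Suc N)" by (rule mean_cong) (simp add: f0s)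
    also have "\<dots> = mean (\<lambda>x. f x ^ Suc N)" using twisted_mean[OF twisted_power[OF tw]] by simp
    also have "\<dots> = mean (\<lambda>x. of_real (s x ^ Suc N))" by (rule mean_cong) (simp add: fs)
    finally show ?thesis by (simp add: rmean_def)
  qed
  have "s g = 1"
  proof (rule ccontr)
    assume "s g \<noteq> 1"
    then have c: "s g < 1" "0 \<le> s g" using sb g by (auto simp: less_le)
    \<comment> \<open>Any level strictly between the maximum of \<open>s\<close> and 1 would
      do.\<close>
    define c' where "c' = (1 + s g) / 2"
    have c': "s g < c'" "c' < 1" "0 < c'" using c by (auto simp: c'_def)
    \<comment> \<open>A continuous nonnegative weight living where \<open>s0\<close> exceeds
      \<open>c'\<close> and positive at \<one>. It shows that the means of the powers of
      \<open>s0\<close> decay no faster than the powers of \<open>c'\<close>, while those of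
      \<open>s\<close> decay at least like the powers of \<open>s g\<close>, although both sequences
      agree.\<close>
    define v where "v x = max 0 (s0 x - c')" for x
    have vc: "cts v" unfolding v_def using cs by (intro continuous_map_real_max continuous_map_diff) auto
    have "s0 \<one> = 1"
    proof -
      have "(\<Sum>\<psi>\<in>T. (1 + Re (\<psi> \<one>)) / 2) = (\<Sum>\<psi>\<in>T. 1)"
        by (rule sum.cong) (auto simp: mchar_one[OF Tm])
      then show ?thesis using n by (simp add: s0_def n_def)
    qed
    then have vm: "rmean v > 0" 
      using c' by (intro rmean_pos[OF vc, of \<one>]) (auto simp: v_def)
    have "c' ^ Suc N * rmean v \<le> s g ^ Suc N" for N
    proof -
      have cp: "cts (\<lambda>x. s0 x ^ Suc N)" "cts (\<lambda>x. s x ^ Suc N)"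
        using cs by (auto intro: continuous_map_real_pow continuous_map_real_mult)
      have "c' ^ Suc N * rmean v = rmean (\<lambda>x. c' ^ Suc N * v x)" using rmean_cmult[OF vc] by simp
      also have "\<dots> \<le> rmean (\<lambda>x. s0 x ^ Suc N)"
      proof (rule rmean_mono)
        show "cts (\<lambda>x. c' ^ Suc N * v x)" using vc by (intro continuous_map_real_mult) auto
        fix x assume x: "x \<in> carrier G"
        show "c' ^ Suc N * v x \<le> s0 x ^ Suc N"
        proof (cases "s0 x \<le> c'")
          case True
          then show ?thesis using s0b[OF x] by (simp add: v_def)
        next
          case False
          then have "c' ^ Suc N * v x \<le> c' ^ Suc N * 1"
            using s0b[OF x] c' by (intro mult_left_mono) (auto simp: v_def)
          also have "\<dots> \<le> s0 x ^ Suc N" using False c' by (simp only: mult_1_right) (intro power_mono, auto)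
          finally show ?thesis .
        qed
      qed (rule cp)
      also have "\<dots> = rmean (\<lambda>x. s x ^ Suc N)" by (rule pw)
      also have "\<dots> \<le> rmean (\<lambda>x. s g ^ Suc N)"
        by (rule rmean_mono) (use cp sb g in \<open>auto intro!: power_mono simp del: power_Suc\<close>)
      also have "\<dots> = s g ^ Suc N" by (simp add: rmean_def flip: of_real_power of_real_mult)
      finally show ?thesis .
    qed
    then have "rmean v \<le> (s g / c') ^ Suc N" for N
      using c' by (simp only: power_divide) (simp add: pos_le_divide_eq mult.commute)
    moreover have "(\<lambda>N. (s g / c') ^ Suc N) \<longlonglongrightarrow> 0"
      using c c' by (intro LIMSEQ_Suc LIMSEQ_realpow_zero) auto
    ultimately have "rmean v \<le> 0" using LIMSEQ_le_const[of _ 0 "rmean v"] by blast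
    then show False using vm by simp
  qed
  \<comment> \<open>The terms are at most 1 and sum to their number, so each is 1; a number of
    modulus 1 with real part 1 is 1.\<close>
  define z where "z \<psi> = cnj (\<theta> \<psi>) * \<psi> g" for \<psi>
  have sum: "(\<Sum>\<psi>\<in>T. (1 + Re (z \<psi>)) / 2) = (\<Sum>\<psi>\<in>T. 1)"
    using \<open>s g = 1\<close> n by (simp add: s_def n_def flip: z_def)
  have nm: "norm (z \<psi>) = 1" if "\<psi> \<in> T" for \<psi>
    using mchar_norm[OF Tm[OF that] g(1)] \<theta>_norm[OF Tm[OF that]] by (simp add: norm_mult z_def)
  have "\<psi> g = \<theta> \<psi>" if \<psi>: "\<psi> \<in> T" for \<psi>
  proof -
    have le: "(1 + Re (z \<psi>)) / 2 \<le> 1" if "\<psi> \<in> T" for \<psi>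
      using nm[OF that] complex_Re_le_cmod[of "z \<psi>"] by simp
    have "(1 + Re (z \<psi>)) / 2 = 1" using sum_mono_inv[OF sum le \<psi> T(1)] .
    then have "Re (z \<psi>) = 1" by simp
    then have "z \<psi> = 1" using nm[OF \<psi>] cmod_power2[of "z \<psi>"] by (simp add: complex_eq_iff)
    then have "cnj (\<theta> \<psi>) * \<psi> g = 1" by (simp add: z_def)
    moreover have "\<theta> \<psi> * cnj (\<theta> \<psi>) = 1"
      using \<theta>_norm[OF Tm[OF \<psi>]] unfolding complex_norm_square[symmetric] by simp
    ultimately show ?thesis by (metis mult.commute mult.left_commute mult.right_neutral)
  qed
  then show ?thesis using that g(1) by blast
qed

text \<open>Each equation defines a closed subset of a compact group, and finitely many equations
  are solvable together; the finite intersection property solves them all.\<close>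

theorem duality_surjective:
  obtains g where "g \<in> carrier G" "\<And>\<psi>. mchar \<psi> \<Longrightarrow> \<psi> g = \<theta> \<psi>"
proof -
  define Z where "Z \<psi> = {x \<in> carrier G. \<psi> x \<in> {\<theta> \<psi>}}" for \<psi>
  have "\<Inter> (Z ` Collect mchar) \<noteq> {}"
  proof (rule compact_space_fip[THEN iffD1, rule_format, OF compact_G], intro conjI ballI allI impI)
    fix C assume "C \<in> Z ` Collect mchar"
    then obtain \<psi> where \<psi>: "mchar \<psi>" "C = Z \<psi>" by auto
    have "closedin X {x \<in> topspace X. \<psi> x \<in> {\<theta> \<psi>}}"
      by (rule closedin_continuous_map_preimage[OF CG_cts[OF mchar_CG[OF \<psi>(1)]]]) auto
    then show "closedin X C" using \<psi> by (simp add: Z_def)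
  next
    fix F assume F: "finite F \<and> F \<subseteq> Z ` Collect mchar"
    then obtain T where T: "T \<subseteq> Collect mchar" "finite T" "F = Z ` T"
      by (metis finite_subset_image)
    \<comment> \<open>The trivial character is added because \<open>finite_interpolation\<close>
      divides by the number of characters.\<close>
    obtain g where "g \<in> carrier G" "\<And>\<psi>. \<psi> \<in> insert mtriv T \<Longrightarrow> \<psi> g = \<theta> \<psi>"
      using finite_interpolation[of "insert mtriv T"] T mchar_mtriv by auto
    then have "g \<in> \<Inter> F" using T by (auto simp: Z_def)
    then show "\<Inter> F \<noteq> {}" by blast
  qed
  then obtain g where "g \<in> \<Inter> (Z ` Collect mchar)" by blast
  then have "g \<in> carrier G" "\<And>\<psi>. mchar \<psi> \<Longrightarrow> \<psi> g = \<theta> \<psi>"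
    using mchar_mtriv by (auto simp: Z_def)
  then show ?thesis using that by blast
qed

end

end

section \<open>The circle group and the character group\<close>

definition cis1 :: "real \<Rightarrow> complex" where
  "cis1 x = exp (2 * of_real pi * \<i> * of_real x)"

lemma cis1_add: "cis1 (x + y) = cis1 x * cis1 y"
  by (simp add: cis1_def distrib_left exp_add)

lemma norm_cis1 [simp]: "norm (cis1 x) = 1"
  by (simp add: cis1_def norm_exp_eq_Re)

lemma cis1_0 [simp]: "cis1 0 = 1" by (simp add: cis1_def)

lemma cis1_eq_iff: "cis1 x = cis1 y \<longleftrightarrow> x - y \<in> \<int>"
proof -
  have "cis1 x = cis1 y \<longleftrightarrow> (\<exists>n::int. complex_of_real (2 * pi * x) = of_real (2 * pi * (y + of_int n)))"
  proof -
    have "(2 * of_real pi * \<i> * of_real x = 2 * of_real pi * \<i> * of_real y + of_int (2 * n) * of_real pi * \<i>) \<longleftrightarrow>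
      complex_of_real (2 * pi * x) = of_real (2 * pi * (y + of_int n))" for n :: int
      by (simp add: complex_eq_iff algebra_simps)
    then show ?thesis unfolding cis1_def exp_eq by simp
  qed
  also have "\<dots> \<longleftrightarrow> (\<exists>n::int. x = y + of_int n)" unfolding of_real_eq_iff by simp
  also have "\<dots> \<longleftrightarrow> x - y \<in> \<int>" unfolding Ints_def by (auto simp: algebra_simps)
  finally show ?thesis .
qed

lemma cis1_surj: "norm z = 1 \<Longrightarrow> \<exists>x\<in>{0..1}. cis1 x = z"
proof -
  assume "norm z = 1"
  then have "exp (\<i> * of_real (Arg2pi z)) = z" by (simp add: complex_norm_eq_1_exp)
  moreover define t where "t = Arg2pi z"
  ultimately have t: "0 \<le> t" "t \<le> 2 * pi" "z = exp (\<i> * of_real t)"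
    using Arg2pi_ge_0[of z] Arg2pi_lt_2pi[of z] by auto
  have "cis1 (t / (2 * pi)) = z" using t by (simp add: cis1_def mult_ac)
  moreover have "t / (2 * pi) \<in> {0..1}" using t by (simp add: field_simps)
  ultimately show ?thesis by blast
qed

lemma continuous_cis1: "continuous_on S cis1"
  unfolding cis1_def by (intro continuous_intros)

lemma comm_group_real_additive: "comm_group real_additive"
proof (rule comm_groupI)
  fix x assume "x \<in> carrier real_additive"
  show "\<exists>y\<in>carrier real_additive. y \<otimes>\<^bsub>real_additive\<^esub> x = \<one>\<^bsub>real_additive\<^esub>"
    by (rule bexI[of _ "- x"]) (auto simp: real_additive_def)
qed (auto simp: real_additive_def)

lemma inv_real_additive: "inv\<^bsub>real_additive\<^esub> x = - x"
proof -
  interpret comm_group real_additive by (rule comm_group_real_additive)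
  show ?thesis by (rule inv_equality) (auto simp: real_additive_def)
qed

lemma Ints_normal: "\<int> \<lhd> real_additive"
proof -
  interpret comm_group real_additive by (rule comm_group_real_additive)
  have "subgroup \<int> real_additive"
    by (rule subgroupI) (auto simp: inv_real_additive, auto simp: real_additive_def)
  then show ?thesis by (rule subgroup_imp_normal)
qed

abbreviation zcoset :: "real \<Rightarrow> real set" where
  "zcoset x \<equiv> \<int> #>\<^bsub>real_additive\<^esub> x"

lemma zcoset_eq: "zcoset x = {n + x |n. n \<in> \<int>}"
  by (auto simp: r_coset_def real_additive_def)

lemma carrier_RmodZ: "carrier RmodZ = range zcoset"
  by (auto simp: RmodZ_def FactGroup_def RCOSETS_def real_additive_def)

lemma exp_zcoset [simp]: "exp_RmodZ (zcoset x) = cis1 x"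
proof -
  have "cis1 ` zcoset x = {cis1 x}"
  proof -
    have "cis1 (n + x) = cis1 x" if "n \<in> \<int>" for n using that by (simp add: cis1_eq_iff)
    then show ?thesis unfolding zcoset_eq using Ints_0 by (auto simp: image_iff)
  qed
  then show ?thesis by (simp add: exp_RmodZ_def cis1_def[abs_def])
qed

lemma zcoset_eq_iff: "zcoset x = zcoset y \<longleftrightarrow> cis1 x = cis1 y"
proof
  assume "cis1 x = cis1 y"
  then have xy: "x - y \<in> \<int>" by (simp add: cis1_eq_iff)
  have "n + x \<in> zcoset y" if "n \<in> \<int>" for n
    unfolding zcoset_eq using Ints_add[OF that xy] by (auto intro!: exI[of _ "n + (x - y)"])
  moreover have "n + y \<in> zcoset x" if "n \<in> \<int>" for n
    unfolding zcoset_eq using Ints_diff[OF that xy] by (auto intro!: exI[of _ "n - (x - y)"])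
  ultimately show "zcoset x = zcoset y" unfolding zcoset_eq by auto
next
  assume "zcoset x = zcoset y"
  then show "cis1 x = cis1 y" by (metis exp_zcoset)
qed

lemma mult_RmodZ: "zcoset x \<otimes>\<^bsub>RmodZ\<^esub> zcoset y = zcoset (x + y)"
proof -
  interpret normal "\<int>" real_additive by (rule Ints_normal)
  have "zcoset x <#>\<^bsub>real_additive\<^esub> zcoset y = zcoset (x \<otimes>\<^bsub>real_additive\<^esub> y)"
    by (rule rcos_sum) (auto simp: real_additive_def)
  then show ?thesis by (simp add: RmodZ_def FactGroup_def real_additive_def)
qed

lemma one_RmodZ: "\<one>\<^bsub>RmodZ\<^esub> = zcoset 0"
  by (auto simp: RmodZ_def FactGroup_def zcoset_eq)

lemma comm_group_RmodZ: "comm_group RmodZ"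
proof (rule comm_groupI)
  fix x assume "x \<in> carrier RmodZ"
  then obtain a where "x = zcoset a" by (auto simp: carrier_RmodZ)
  then show "\<exists>y\<in>carrier RmodZ. y \<otimes>\<^bsub>RmodZ\<^esub> x = \<one>\<^bsub>RmodZ\<^esub>"
    by (intro bexI[of _ "zcoset (- a)"]) (auto simp: mult_RmodZ one_RmodZ carrier_RmodZ)
qed (auto simp: carrier_RmodZ mult_RmodZ one_RmodZ ac_simps)

lemma openin_RmodZ:
  "openin (gtop RmodZ) U \<longleftrightarrow> U \<subseteq> carrier RmodZ \<and> open {x. zcoset x \<in> U}"
proof -
  have eq: "{x. zcoset x \<in> \<Union>\<K>} = (\<Union>K\<in>\<K>. {x. zcoset x \<in> K})" for \<K> by auto
  have "istopology (\<lambda>U. U \<subseteq> carrier RmodZ \<and> open {x. zcoset x \<in> U})"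
    unfolding istopology_def eq
    by (auto simp: Collect_conj_eq intro!: open_Int)
  then show ?thesis unfolding RmodZ_def by (simp add: topology_inverse')
qed

lemma topspace_RmodZ [simp]: "topspace (gtop RmodZ) = carrier RmodZ"
proof
  show "topspace (gtop RmodZ) \<subseteq> carrier RmodZ" by (auto simp: topspace_def openin_RmodZ)
  have "openin (gtop RmodZ) (carrier RmodZ)" by (simp add: openin_RmodZ carrier_RmodZ)
  then show "carrier RmodZ \<subseteq> topspace (gtop RmodZ)" by (rule openin_subset)
qed

lemma exp_RmodZ_inj: "inj_on exp_RmodZ (carrier RmodZ)"
  by (auto simp: carrier_RmodZ inj_on_def zcoset_eq_iff)

text \<open>Continuity is read off on the real line through the quotient topology. The inverse is
  then continuous because \<real>/\<int> is compact, as the image of the unit interval, and the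
  circle is Hausdorff.\<close>

lemma exp_RmodZ_iso: "exp_RmodZ \<in> top_group_iso RmodZ circle_S1"
proof -
  have img: "exp_RmodZ ` carrier RmodZ = carrier circle_S1"
    using cis1_surj by (fastforce simp: carrier_RmodZ circle_S1_def image_iff)
  have "exp_RmodZ \<in> hom RmodZ circle_S1"
    unfolding hom_def by (auto simp: carrier_RmodZ mult_RmodZ cis1_add, auto simp: circle_S1_def)
  then have iso: "exp_RmodZ \<in> iso RmodZ circle_S1"
    using img exp_RmodZ_inj by (simp add: iso_def bij_betw_def)
  have cont: "continuous_map (gtop RmodZ) (gtop circle_S1) exp_RmodZ"
    unfolding continuous_map_def
  proof (intro conjI allI impI)
    show "exp_RmodZ \<in> topspace (gtop RmodZ) \<rightarrow> topspace (gtop circle_S1)"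
      using img by (auto simp: circle_S1_def)
    fix U assume "openin (gtop circle_S1) U"
    then obtain V where V: "open V" "U = {z. norm z = 1} \<inter> V"
      by (auto simp: circle_S1_def openin_open)
    have "{x. zcoset x \<in> {t \<in> topspace (gtop RmodZ). exp_RmodZ t \<in> U}} = cis1 -` V"
      using V by (auto simp: carrier_RmodZ)
    moreover have "open (cis1 -` V)" using V(1) by (rule open_vimage) (rule continuous_cis1)
    ultimately show "openin (gtop RmodZ) {t \<in> topspace (gtop RmodZ). exp_RmodZ t \<in> U}"
      unfolding openin_RmodZ by auto
  qed
  have q: "continuous_map euclidean (gtop RmodZ) zcoset"
    by (auto simp: continuous_map_def openin_RmodZ carrier_RmodZ)
  have "zcoset ` {0..1} = carrier RmodZ"
  proof -
    have "zcoset x \<in> zcoset ` {0..1}" for x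
      using cis1_surj[of "cis1 x"] zcoset_eq_iff by (metis image_eqI norm_cis1)
    then show ?thesis by (auto simp: carrier_RmodZ)
  qed
  then have "compact_space (gtop RmodZ)"
    using image_compactin[OF _ q, of "{0..1}"] by (simp add: compact_space_def)
  moreover have "Hausdorff_space (gtop circle_S1)"
    by (simp add: circle_S1_def Hausdorff_space_subtopology)
  ultimately have "homeomorphic_map (gtop RmodZ) (gtop circle_S1) exp_RmodZ"
    using cont img exp_RmodZ_inj by (intro continuous_imp_homeomorphic_map) (auto simp: circle_S1_def)
  then show ?thesis using iso by (simp add: top_group_iso_def)
qed

lemma exp_RmodZ_bij: "bij_betw exp_RmodZ (carrier RmodZ) {z. norm z = 1}"
  using exp_RmodZ_iso by (simp add: top_group_iso_def iso_def circle_S1_def)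

lemma exp_RmodZ_mult:
  "s \<in> carrier RmodZ \<Longrightarrow> t \<in> carrier RmodZ \<Longrightarrow> exp_RmodZ (s \<otimes>\<^bsub>RmodZ\<^esub> t) = exp_RmodZ s * exp_RmodZ t"
  by (auto simp: carrier_RmodZ mult_RmodZ cis1_add)

section \<open>Groups of homomorphisms under pointwise convergence\<close>

lemma carrier_hom_group: "carrier (hom_group D H) = {f \<in> extensional (carrier D). f \<in> hom D H}"
  by (simp add: hom_group_def)

lemma topspace_hom_group:
  assumes "topspace (gtop H) = carrier H"
  shows "topspace (gtop (hom_group D H)) = carrier (hom_group D H)"
  using assms by (auto simp: hom_group_def PiE_def hom_def)

lemma top_group_iso_inv:
  assumes H: "Group.group H" "topspace (gtop H) = carrier H" "topspace (gtop K) = carrier K"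
    and f: "f \<in> top_group_iso H K"
  shows "inv_into (carrier H) f \<in> top_group_iso K H"
proof -
  have iso: "f \<in> iso H K" and hm: "homeomorphic_map (gtop H) (gtop K) f"
    using f by (auto simp: top_group_iso_def)
  have "inv_into (carrier H) f \<in> iso K H" using group.iso_set_sym[OF H(1) iso] by simp
  moreover have "homeomorphic_map (gtop K) (gtop H) (inv_into (carrier H) f)"
  proof -
    obtain g where g: "homeomorphic_maps (gtop H) (gtop K) f g"
      using hm homeomorphic_map_maps by blast
    have "inv_into (carrier H) f y = g y" if "y \<in> topspace (gtop K)" for y
    proof -
      have gy: "g y \<in> carrier H" "f (g y) = y"
        using g that H unfolding homeomorphic_maps_def continuous_map_def by auto
      have "inj_on f (carrier H)" using iso by (simp add: iso_def bij_betw_def)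
      then show ?thesis using gy inv_into_f_f by metis
    qed
    moreover have "homeomorphic_map (gtop K) (gtop H) g"
      using g homeomorphic_maps_sym homeomorphic_map_maps by blast
    ultimately show ?thesis using homeomorphic_map_eq by metis
  qed
  ultimately show ?thesis by (simp add: top_group_iso_def)
qed

lemma hom_group_post:
  assumes D: "Group.group D" and f: "f \<in> hom H K" "continuous_map (gtop H) (gtop K) f"
    and H: "topspace (gtop H) = carrier H"
  shows "(\<lambda>\<theta>. \<lambda>x\<in>carrier D. f (\<theta> x)) \<in> hom (hom_group D H) (hom_group D K)"
    and "continuous_map (gtop (hom_group D H)) (gtop (hom_group D K)) (\<lambda>\<theta>. \<lambda>x\<in>carrier D. f (\<theta> x))"
proof -
  interpret D: group D by fact
  have fH: "f x \<in> carrier K" if "x \<in> carrier H" for x using f that by (auto simp: hom_def)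
  have fm: "f (x \<otimes>\<^bsub>H\<^esub> y) = f x \<otimes>\<^bsub>K\<^esub> f y" if "x \<in> carrier H" "y \<in> carrier H" for x y
    using f that by (auto simp: hom_def)
  have cl: "(\<lambda>x\<in>carrier D. f (\<theta> x)) \<in> carrier (hom_group D K)" if "\<theta> \<in> carrier (hom_group D H)" for \<theta>
    using that unfolding carrier_hom_group by (auto simp: hom_def intro!: fH fm)
  show "(\<lambda>\<theta>. \<lambda>x\<in>carrier D. f (\<theta> x)) \<in> hom (hom_group D H) (hom_group D K)"
    unfolding hom_def using cl
    by (auto simp: hom_group_def hom_def fun_eq_iff intro!: fm)
  show "continuous_map (gtop (hom_group D H)) (gtop (hom_group D K)) (\<lambda>\<theta>. \<lambda>x\<in>carrier D. f (\<theta> x))"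
  proof -
    have "continuous_map (gtop (hom_group D H)) (gtop K) (\<lambda>\<theta>. f (\<theta> x))" if "x \<in> carrier D" for x
    proof -
      have "continuous_map (gtop (hom_group D H)) (gtop H) (\<lambda>\<theta>. \<theta> x)"
        unfolding hom_group_def using that
        by (auto intro!: continuous_map_from_subtopology continuous_map_product_projection)
      from continuous_map_compose[OF this f(2)] show ?thesis by (simp add: o_def)
    qed
    then have "continuous_map (gtop (hom_group D H)) (product_topology (\<lambda>_. gtop K) (carrier D)) (\<lambda>\<theta>. \<lambda>x\<in>carrier D. f (\<theta> x))"
      by (auto simp: continuous_map_componentwise)
    moreover have "(\<lambda>\<theta>. \<lambda>x\<in>carrier D. f (\<theta> x)) \<in> topspace (gtop (hom_group D H)) \<rightarrow> carrier (hom_group D K)"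
      using cl topspace_hom_group[OF H] by auto
    ultimately show ?thesis unfolding hom_group_def[of D K]
      by (auto intro!: continuous_map_into_subtopology simp: carrier_hom_group)
  qed
qed

lemma hom_group_iso:
  assumes D: "Group.group D" and f: "f \<in> top_group_iso H K" and H: "Group.group H"
    and t: "topspace (gtop H) = carrier H" "topspace (gtop K) = carrier K"
  shows "(\<lambda>\<theta>. \<lambda>x\<in>carrier D. f (\<theta> x)) \<in> top_group_iso (hom_group D H) (hom_group D K)"
proof -
  define g where "g = inv_into (carrier H) f"
  have g: "g \<in> top_group_iso K H" unfolding g_def using top_group_iso_inv[OF H t f] .
  have fh: "f \<in> hom H K" "continuous_map (gtop H) (gtop K) f"
    using f by (auto simp: top_group_iso_def iso_def homeomorphic_imp_continuous_map)
  have gh: "g \<in> hom K H" "continuous_map (gtop K) (gtop H) g"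
    using g by (auto simp: top_group_iso_def iso_def homeomorphic_imp_continuous_map)
  have bij: "bij_betw f (carrier H) (carrier K)" using f by (simp add: top_group_iso_def iso_def)
  let ?F = "\<lambda>\<theta>. \<lambda>x\<in>carrier D. f (\<theta> x)" and ?G = "\<lambda>\<theta>. \<lambda>x\<in>carrier D. g (\<theta> x)"
  have GF: "?G (?F \<theta>) = \<theta>" if "\<theta> \<in> carrier (hom_group D H)" for \<theta>
  proof
    fix x show "?G (?F \<theta>) x = \<theta> x"
      using that bij by (cases "x \<in> carrier D")
        (auto simp: carrier_hom_group g_def hom_def bij_betw_def Pi_iff inv_into_f_f extensional_def)
  qed
  have FG: "?F (?G \<theta>) = \<theta>" if "\<theta> \<in> carrier (hom_group D K)" for \<theta>
  proof
    fix x show "?F (?G \<theta>) x = \<theta> x"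
      using that bij by (cases "x \<in> carrier D")
        (auto simp: carrier_hom_group g_def hom_def bij_betw_def Pi_iff f_inv_into_f extensional_def)
  qed
  note F = hom_group_post[OF D fh t(1)] and G = hom_group_post[OF D gh t(2)]
  have "bij_betw ?F (carrier (hom_group D H)) (carrier (hom_group D K))"
    by (rule bij_betw_byWitness[where f'="?G"]) (use F(1) G(1) GF FG in \<open>auto simp: hom_def Pi_iff\<close>)
  moreover have "homeomorphic_maps (gtop (hom_group D H)) (gtop (hom_group D K)) ?F ?G"
    unfolding homeomorphic_maps_def topspace_hom_group[OF t(1)] topspace_hom_group[OF t(2)]
    using F(2) G(2) GF FG by blast
  ultimately show ?thesis using F(1) by (auto simp: top_group_iso_def iso_def homeomorphic_map_maps)
qed

section \<open>The character group and Pontryagin duality\<close>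

context compact_ab_group
begin

abbreviation "D \<equiv> char_group G"

text \<open>The bridge from characters with values in \<real>/\<int> to the multiplicative ones of
  the Fourier analysis; the value 0 outside the carrier is the convention of
  \<open>CG\<close>.\<close>

definition to_mchar :: "('g \<Rightarrow> real set) \<Rightarrow> 'g \<Rightarrow> complex" where
  "to_mchar \<xi> x = (if x \<in> carrier G then exp_RmodZ (\<xi> x) else 0)"

lemma carrier_D:
  "\<xi> \<in> carrier D \<longleftrightarrow> \<xi> \<in> extensional (carrier G) \<and> \<xi> \<in> hom G RmodZ \<and> continuous_map X (gtop RmodZ) \<xi>"
  by (auto simp: char_group_def continuous_hom_def)

lemma D_closed: "\<xi> \<in> carrier D \<Longrightarrow> x \<in> carrier G \<Longrightarrow> \<xi> x \<in> carrier RmodZ"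
  by (auto simp: carrier_D hom_def)

lemma mchar_to_mchar:
  assumes "\<xi> \<in> carrier D" shows "mchar (to_mchar \<xi>)"
proof -
  have h: "\<xi> \<in> hom G RmodZ" "continuous_map X (gtop RmodZ) \<xi>" using assms by (auto simp: carrier_D)
  have "continuous_map (gtop RmodZ) (gtop circle_S1) exp_RmodZ"
    using exp_RmodZ_iso by (simp add: top_group_iso_def homeomorphic_imp_continuous_map)
  then have "continuous_map (gtop RmodZ) euclidean exp_RmodZ"
    by (simp add: circle_S1_def continuous_map_in_subtopology)
  from continuous_map_compose[OF h(2) this] have "cts (\<lambda>x. exp_RmodZ (\<xi> x))" by (simp add: o_def)
  then have "to_mchar \<xi> \<in> CG" by (rule CG_I) (auto simp: to_mchar_def)
  moreover have "norm (exp_RmodZ (\<xi> x)) = 1" if "x \<in> carrier G" for x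
    using D_closed[OF assms that] by (auto simp: carrier_RmodZ)
  moreover have "exp_RmodZ (\<xi> (x \<otimes> y)) = exp_RmodZ (\<xi> x) * exp_RmodZ (\<xi> y)"
    if "x \<in> carrier G" "y \<in> carrier G" for x y
    using h that by (auto simp: hom_def exp_RmodZ_mult Pi_iff)
  ultimately show ?thesis by (auto simp: mchar_def to_mchar_def)
qed

lemma to_mchar_inj: "inj_on to_mchar (carrier D)"
proof (rule inj_onI)
  fix \<xi> \<psi> assume a: "\<xi> \<in> carrier D" "\<psi> \<in> carrier D" "to_mchar \<xi> = to_mchar \<psi>"
  show "\<xi> = \<psi>"
  proof (rule extensionalityI)
    fix x assume x: "x \<in> carrier G"
    have "exp_RmodZ (\<xi> x) = exp_RmodZ (\<psi> x)" using fun_cong[OF a(3), of x] x by (simp add: to_mchar_def)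
    then show "\<xi> x = \<psi> x" using exp_RmodZ_inj a x D_closed by (auto simp: inj_on_def)
  qed (use a in \<open>auto simp: carrier_D\<close>)
qed

lemma to_mchar_surj:
  assumes "mchar \<psi>" obtains \<xi> where "\<xi> \<in> carrier D" "to_mchar \<xi> = \<psi>"
proof -
  define g where "g = inv_into (carrier RmodZ) exp_RmodZ"
  have "g \<in> top_group_iso circle_S1 RmodZ"
    unfolding g_def using comm_group_RmodZ exp_RmodZ_iso
    by (intro top_group_iso_inv) (auto simp: comm_group_def circle_S1_def)
  then have g: "g \<in> hom circle_S1 RmodZ" "continuous_map (gtop circle_S1) (gtop RmodZ) g"
    by (auto simp: top_group_iso_def iso_def homeomorphic_imp_continuous_map)
  have eg: "exp_RmodZ (g z) = z" if "norm z = 1" for z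
    unfolding g_def using that exp_RmodZ_bij by (intro f_inv_into_f) (auto simp: bij_betw_def)
  define \<xi> where "\<xi> = (\<lambda>x\<in>carrier G. g (\<psi> x))"
  have "continuous_map X (gtop circle_S1) \<psi>"
    using CG_cts[OF mchar_CG[OF assms]] mchar_norm[OF assms]
    by (auto simp: circle_S1_def continuous_map_in_subtopology)
  from continuous_map_compose[OF this g(2)] have "continuous_map X (gtop RmodZ) \<xi>"
    by (rule continuous_map_eq) (simp add: \<xi>_def)
  moreover have "\<xi> \<in> hom G RmodZ"
    unfolding hom_def using g(1) mchar_norm[OF assms] mchar_mult[OF assms]
    by (auto simp: \<xi>_def hom_def circle_S1_def)
  ultimately have "\<xi> \<in> carrier D" by (simp add: carrier_D \<xi>_def)
  moreover have "to_mchar \<xi> = \<psi>"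
    using eg mchar_norm[OF assms] CG_outside[OF mchar_CG[OF assms]]
    by (auto simp: to_mchar_def \<xi>_def)
  ultimately show ?thesis using that by blast
qed

lemma to_mchar_mult:
  assumes "\<xi> \<in> carrier D" "\<psi> \<in> carrier D"
  shows "to_mchar (\<xi> \<otimes>\<^bsub>D\<^esub> \<psi>) = (\<lambda>x. to_mchar \<xi> x * to_mchar \<psi> x)"
  using assms D_closed by (auto simp: to_mchar_def char_group_def exp_RmodZ_mult)

lemma to_mchar_one: "to_mchar \<one>\<^bsub>D\<^esub> = mtriv"
  by (auto simp: to_mchar_def char_group_def mtriv_def one_RmodZ)

lemma D_one_closed: "\<one>\<^bsub>D\<^esub> \<in> carrier D"
proof -
  interpret R: comm_group RmodZ by (rule comm_group_RmodZ)
  have "continuous_map X (gtop RmodZ) (\<lambda>x. \<one>\<^bsub>RmodZ\<^esub>)" by simp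
  then have "continuous_map X (gtop RmodZ) (\<lambda>x\<in>carrier G. \<one>\<^bsub>RmodZ\<^esub>)"
    by (rule continuous_map_eq) simp
  then show ?thesis by (auto simp: char_group_def continuous_hom_def hom_def)
qed

text \<open>Continuity of the sum is transported: the product of the two complex characters is a
  character, and the element of \<open>D\<close> that it comes from must be the pointwise
  sum.\<close>

lemma D_mult_closed:
  assumes "\<xi> \<in> carrier D" "\<psi> \<in> carrier D" shows "\<xi> \<otimes>\<^bsub>D\<^esub> \<psi> \<in> carrier D"
proof -
  obtain \<phi> where \<phi>: "\<phi> \<in> carrier D" "to_mchar \<phi> = (\<lambda>x. to_mchar \<xi> x * to_mchar \<psi> x)"
    using to_mchar_surj[OF mchar_times[OF mchar_to_mchar[OF assms(1)] mchar_to_mchar[OF assms(2)]]] by blast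
  interpret R: comm_group RmodZ by (rule comm_group_RmodZ)
  have "\<xi> \<otimes>\<^bsub>D\<^esub> \<psi> = \<phi>"
  proof (rule extensionalityI)
    show "\<xi> \<otimes>\<^bsub>D\<^esub> \<psi> \<in> extensional (carrier G)" by (simp add: char_group_def)
    fix x assume x: "x \<in> carrier G"
    have "exp_RmodZ ((\<xi> \<otimes>\<^bsub>D\<^esub> \<psi>) x) = exp_RmodZ (\<phi> x)"
      using fun_cong[OF \<phi>(2), of x] fun_cong[OF to_mchar_mult[OF assms], of x] x by (simp add: to_mchar_def)
    moreover have "(\<xi> \<otimes>\<^bsub>D\<^esub> \<psi>) x \<in> carrier RmodZ"
      using assms x D_closed by (auto simp: char_group_def)
    ultimately show "(\<xi> \<otimes>\<^bsub>D\<^esub> \<psi>) x = \<phi> x"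
      using exp_RmodZ_inj D_closed[OF \<phi>(1) x] by (auto simp: inj_on_def)
  qed (use \<phi> in \<open>auto simp: carrier_D\<close>)
  then show ?thesis using \<phi> by simp
qed

lemma comm_group_D: "comm_group D"
proof (rule comm_groupI)
  have eqI: "\<xi> = \<psi>" if "\<xi> \<in> carrier D" "\<psi> \<in> carrier D" "to_mchar \<xi> = to_mchar \<psi>" for \<xi> \<psi>
    using to_mchar_inj that by (auto simp: inj_on_def)
  fix x y z assume x: "x \<in> carrier D" and y: "y \<in> carrier D" and z: "z \<in> carrier D"
  show "x \<otimes>\<^bsub>D\<^esub> y \<otimes>\<^bsub>D\<^esub> z = x \<otimes>\<^bsub>D\<^esub> (y \<otimes>\<^bsub>D\<^esub> z)"
    using x y z by (intro eqI D_mult_closed) (auto simp: to_mchar_mult D_mult_closed mult_ac)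
  show "x \<otimes>\<^bsub>D\<^esub> y = y \<otimes>\<^bsub>D\<^esub> x"
    using x y by (intro eqI D_mult_closed) (auto simp: to_mchar_mult mult_ac)
next
  have eqI: "\<xi> = \<psi>" if "\<xi> \<in> carrier D" "\<psi> \<in> carrier D" "to_mchar \<xi> = to_mchar \<psi>" for \<xi> \<psi>
    using to_mchar_inj that by (auto simp: inj_on_def)
  fix x assume x: "x \<in> carrier D"
  have xm: "mchar (to_mchar x)" using x by (rule mchar_to_mchar)
  show "\<one>\<^bsub>D\<^esub> \<otimes>\<^bsub>D\<^esub> x = x"
    using x D_one_closed by (intro eqI D_mult_closed) (auto simp: to_mchar_mult to_mchar_one mtriv_def to_mchar_def)
  obtain y where y: "y \<in> carrier D" "to_mchar y = (\<lambda>g. cnj (to_mchar x g))"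
    using to_mchar_surj[OF mchar_cnj_fun[OF xm]] by blast
  have "y \<otimes>\<^bsub>D\<^esub> x = \<one>\<^bsub>D\<^esub>"
  proof (intro eqI D_mult_closed D_one_closed y(1) x)
    have "cnj (to_mchar x g) * to_mchar x g = mtriv g" for g
      using mchar_cnj[OF xm, of g] by (cases "g \<in> carrier G") (auto simp: mtriv_def mult.commute to_mchar_def)
    then show "to_mchar (y \<otimes>\<^bsub>D\<^esub> x) = to_mchar \<one>\<^bsub>D\<^esub>"
      using to_mchar_mult[OF y(1) x] y(2) to_mchar_one by (simp add: fun_eq_iff)
  qed
  then show "\<exists>y\<in>carrier D. y \<otimes>\<^bsub>D\<^esub> x = \<one>\<^bsub>D\<^esub>" using y by blast
qed (auto intro: D_mult_closed D_one_closed)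

definition ev :: "'g \<Rightarrow> ('g \<Rightarrow> real set) \<Rightarrow> complex" where
  "ev g = (\<lambda>\<xi>\<in>carrier D. exp_RmodZ (\<xi> g))"

lemma ev_eq: "g \<in> carrier G \<Longrightarrow> \<xi> \<in> carrier D \<Longrightarrow> ev g \<xi> = to_mchar \<xi> g"
  by (simp add: ev_def to_mchar_def)

lemma topspace_circle: "topspace (gtop circle_S1) = carrier circle_S1"
  by (simp add: circle_S1_def)

text \<open>Pontryagin duality. Injectivity is separation of points by characters, surjectivity is
  \<open>duality_surjective\<close>, and a continuous bijection from a compact onto a Hausdorff
  space is a homeomorphism.\<close>

theorem ev_iso: "ev \<in> top_group_iso G (hom_group D circle_S1)"
proof -
  interpret DG: comm_group D by (rule comm_group_D)
  have cl: "ev g \<in> carrier (hom_group D circle_S1)" if g: "g \<in> carrier G" for g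
  proof -
    have "ev g \<in> hom D circle_S1"
      unfolding hom_def using g mchar_norm[OF mchar_to_mchar]
      by (auto simp: ev_eq circle_S1_def to_mchar_mult)
    then show ?thesis by (simp add: carrier_hom_group ev_def)
  qed
  have hom: "ev \<in> hom G (hom_group D circle_S1)"
    unfolding hom_def
  proof (intro CollectI conjI ballI)
    show "ev \<in> carrier G \<rightarrow> carrier (hom_group D circle_S1)" using cl by auto
    fix x y assume xy: "x \<in> carrier G" "y \<in> carrier G"
    show "ev (x \<otimes> y) = ev x \<otimes>\<^bsub>hom_group D circle_S1\<^esub> ev y"
    proof
      fix \<xi> show "ev (x \<otimes> y) \<xi> = (ev x \<otimes>\<^bsub>hom_group D circle_S1\<^esub> ev y) \<xi>"
        using xy mchar_mult[OF mchar_to_mchar]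
        by (cases "\<xi> \<in> carrier D") (auto simp: ev_eq hom_group_def circle_S1_def, auto simp: ev_def)
    qed
  qed
  have inj: "inj_on ev (carrier G)"
  proof (rule inj_onI, rule ccontr)
    fix x y assume xy: "x \<in> carrier G" "y \<in> carrier G" "ev x = ev y" "x \<noteq> y"
    then have "x \<otimes> inv y \<noteq> \<one>" by (metis inv_equality inv_inv inv_closed)
    then obtain \<psi> where \<psi>: "mchar \<psi>" "\<psi> (x \<otimes> inv y) \<noteq> 1"
      using mchar_separates[of "x \<otimes> inv y"] xy by auto
    then obtain \<xi> where \<xi>: "\<xi> \<in> carrier D" "to_mchar \<xi> = \<psi>" using to_mchar_surj by blast
    have "\<psi> x = \<psi> y" using fun_cong[OF xy(3), of \<xi>] ev_eq[OF xy(1) \<xi>(1)] ev_eq[OF xy(2) \<xi>(1)] \<xi>(2) by simp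
    then have "\<psi> (x \<otimes> inv y) = 1"
      using mchar_mult[OF \<psi>(1) xy(1) inv_closed[OF xy(2)]] mchar_inv[OF \<psi>(1) xy(2)] mchar_cnj[OF \<psi>(1) xy(2)] by simp
    then show False using \<psi> by simp
  qed
  have surj: "carrier (hom_group D circle_S1) \<subseteq> ev ` carrier G"
  proof
    fix h assume h: "h \<in> carrier (hom_group D circle_S1)"
    define \<theta> where "\<theta> \<psi> = h (inv_into (carrier D) to_mchar \<psi>)" for \<psi>
    have \<theta>: "\<theta> (to_mchar \<xi>) = h \<xi>" if "\<xi> \<in> carrier D" for \<xi>
      using that to_mchar_inj by (simp add: \<theta>_def inv_into_f_f)
    have hm: "h (\<xi> \<otimes>\<^bsub>D\<^esub> \<psi>) = h \<xi> * h \<psi>" "norm (h \<xi>) = 1" if "\<xi> \<in> carrier D" "\<psi> \<in> carrier D" for \<xi> \<psi>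
      using h that by (auto simp: carrier_hom_group hom_def circle_S1_def)
    have mult: "\<theta> (\<lambda>x. \<psi> x * \<phi> x) = \<theta> \<psi> * \<theta> \<phi>" if m: "mchar \<psi>" "mchar \<phi>" for \<psi> \<phi>
    proof -
      obtain a where a: "a \<in> carrier D" "to_mchar a = \<psi>" using to_mchar_surj[OF m(1)] by blast
      obtain b where b: "b \<in> carrier D" "to_mchar b = \<phi>" using to_mchar_surj[OF m(2)] by blast
      have "(\<lambda>x. \<psi> x * \<phi> x) = to_mchar (a \<otimes>\<^bsub>D\<^esub> b)" using to_mchar_mult[OF a(1) b(1)] a b by simp
      then show ?thesis
        using \<theta>[OF a(1)] \<theta>[OF b(1)] \<theta>[OF D_mult_closed[OF a(1) b(1)]] hm(1)[OF a(1) b(1)] a b by simp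
    qed
    have nm: "norm (\<theta> \<psi>) = 1" if m: "mchar \<psi>" for \<psi>
    proof -
      obtain a where "a \<in> carrier D" "to_mchar a = \<psi>" using to_mchar_surj[OF m] by blast
      then show ?thesis using \<theta>[of a] hm(2)[of a] by auto
    qed
    obtain g where g: "g \<in> carrier G" "\<And>\<psi>. mchar \<psi> \<Longrightarrow> \<psi> g = \<theta> \<psi>"
      using duality_surjective[of \<theta>, OF mult nm] by blast
    have "h = ev g"
    proof (rule extensionalityI)
      show "h \<in> extensional (carrier D)" using h by (simp add: carrier_hom_group)
      show "ev g \<in> extensional (carrier D)" by (simp add: ev_def)
      fix \<xi> assume \<xi>: "\<xi> \<in> carrier D"
      show "h \<xi> = ev g \<xi>" using g(2)[OF mchar_to_mchar[OF \<xi>]] \<theta>[OF \<xi>] ev_eq[OF g(1) \<xi>] by simp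
    qed
    then show "h \<in> ev ` carrier G" using g by blast
  qed
  have bij: "ev ` carrier G = carrier (hom_group D circle_S1)" using surj cl by auto
  have cont: "continuous_map X (gtop (hom_group D circle_S1)) ev"
  proof -
    have "continuous_map X (gtop circle_S1) (\<lambda>g. ev g \<xi>)" if \<xi>: "\<xi> \<in> carrier D" for \<xi>
    proof -
      note m = mchar_to_mchar[OF \<xi>]
      have "continuous_map X (gtop circle_S1) (to_mchar \<xi>)"
        using CG_cts[OF mchar_CG[OF m]] mchar_norm[OF m] by (auto simp: circle_S1_def continuous_map_in_subtopology)
      then show ?thesis by (rule continuous_map_eq) (simp add: ev_eq \<xi>)
    qed
    then have "continuous_map X (product_topology (\<lambda>_. gtop circle_S1) (carrier D)) ev"
      by (auto simp: continuous_map_componentwise ev_def)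
    then show ?thesis unfolding hom_group_def
      using cl by (auto intro!: continuous_map_into_subtopology simp: carrier_hom_group)
  qed
  have "Hausdorff_space (gtop (hom_group D circle_S1))"
    unfolding hom_group_def circle_S1_def
    by (simp add: Hausdorff_space_subtopology Hausdorff_space_product_topology)
  then have "homeomorphic_map X (gtop (hom_group D circle_S1)) ev"
    using cont bij inj compact_G topspace_hom_group[OF topspace_circle]
    by (intro continuous_imp_homeomorphic_map) auto
  then show ?thesis using hom bij inj by (simp add: top_group_iso_def iso_def bij_betw_def)
qed

end

section \<open>Weakly complete vector spaces\<close>

lemma complex_algebra_simps [simp]:
  "carrier complex_algebra = UNIV" "x \<otimes>\<^bsub>complex_algebra\<^esub> y = x * y" "\<one>\<^bsub>complex_algebra\<^esub> = 1"
  "\<zero>\<^bsub>complex_algebra\<^esub> = 0" "x \<oplus>\<^bsub>complex_algebra\<^esub> y = x + y" "c \<odot>\<^bsub>complex_algebra\<^esub> x = c * x"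
  "vtop complex_algebra = euclidean"
  by (simp_all add: complex_algebra_def)

lemma complex_power_simps [simp]:
  "carrier (complex_power J) = extensional J"
  "f \<otimes>\<^bsub>complex_power J\<^esub> g = (\<lambda>j\<in>J. f j * g j)" "\<one>\<^bsub>complex_power J\<^esub> = (\<lambda>j\<in>J. 1)"
  "\<zero>\<^bsub>complex_power J\<^esub> = (\<lambda>j\<in>J. 0)" "f \<oplus>\<^bsub>complex_power J\<^esub> g = (\<lambda>j\<in>J. f j + g j)"
  "c \<odot>\<^bsub>complex_power J\<^esub> f = (\<lambda>j\<in>J. c * f j)"
  "vtop (complex_power J) = product_topology (\<lambda>_. euclidean) J"
  by (simp_all add: complex_power_def)

lemma cring_complex_algebra: "cring complex_algebra"
proof (rule cringI)
  show "abelian_group complex_algebra"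
    by (rule abelian_groupI) (auto intro: exI[of _ "- x" for x] simp: add.commute eq_neg_iff_add_eq_0)
  show "Group.comm_monoid complex_algebra" by (rule comm_monoidI) auto
qed (auto simp: algebra_simps)

lemma linear_maps_iff:
  "f \<in> linear_maps V W \<longleftrightarrow> (\<forall>v\<in>carrier V. f v \<in> carrier W) \<and>
     (\<forall>v\<in>carrier V. \<forall>w\<in>carrier V. f (v \<oplus>\<^bsub>V\<^esub> w) = f v \<oplus>\<^bsub>W\<^esub> f w) \<and>
     (\<forall>c. \<forall>v\<in>carrier V. f (c \<odot>\<^bsub>V\<^esub> v) = c \<odot>\<^bsub>W\<^esub> f v)"
  by (auto simp: linear_maps_def hom_def)

lemma linear_mapsD:
  assumes "f \<in> linear_maps V W"
  shows "v \<in> carrier V \<Longrightarrow> f v \<in> carrier W"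
    "v \<in> carrier V \<Longrightarrow> w \<in> carrier V \<Longrightarrow> f (v \<oplus>\<^bsub>V\<^esub> w) = f v \<oplus>\<^bsub>W\<^esub> f w"
    "v \<in> carrier V \<Longrightarrow> f (c \<odot>\<^bsub>V\<^esub> v) = c \<odot>\<^bsub>W\<^esub> f v"
  using assms by (auto simp: linear_maps_iff)

lemma continuous_linearD:
  assumes "f \<in> continuous_linear V W"
  shows "f \<in> linear_maps V W" "continuous_map (vtop V) (vtop W) f"
    "v \<in> carrier V \<Longrightarrow> f v \<in> carrier W"
    "v \<in> carrier V \<Longrightarrow> w \<in> carrier V \<Longrightarrow> f (v \<oplus>\<^bsub>V\<^esub> w) = f v \<oplus>\<^bsub>W\<^esub> f w"
    "v \<in> carrier V \<Longrightarrow> f (c \<odot>\<^bsub>V\<^esub> v) = c \<odot>\<^bsub>W\<^esub> f v"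
  using assms by (auto simp: continuous_linear_def linear_maps_iff)

lemma continuous_linearI:
  assumes "\<And>v. v \<in> carrier V \<Longrightarrow> f v \<in> carrier W"
    "\<And>v w. v \<in> carrier V \<Longrightarrow> w \<in> carrier V \<Longrightarrow> f (v \<oplus>\<^bsub>V\<^esub> w) = f v \<oplus>\<^bsub>W\<^esub> f w"
    "\<And>c v. v \<in> carrier V \<Longrightarrow> f (c \<odot>\<^bsub>V\<^esub> v) = c \<odot>\<^bsub>W\<^esub> f v"
    "continuous_map (vtop V) (vtop W) f"
  shows "f \<in> continuous_linear V W"
  using assms by (auto simp: continuous_linear_def linear_maps_iff)

lemma continuous_linear_compose:
  assumes "f \<in> continuous_linear V W" "g \<in> continuous_linear W U"
  shows "(\<lambda>v. g (f v)) \<in> continuous_linear V U"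
  using assms continuous_map_compose[of "vtop V" "vtop W" f "vtop U" g]
  by (auto simp: continuous_linear_def linear_maps_iff o_def)

lemma tvsD:
  assumes "topological_vector_space V"
  shows "Module.module complex_algebra V" "topspace (vtop V) = carrier V" "abelian_group V"
    "v \<in> carrier V \<Longrightarrow> w \<in> carrier V \<Longrightarrow> v \<oplus>\<^bsub>V\<^esub> w \<in> carrier V"
    "v \<in> carrier V \<Longrightarrow> c \<odot>\<^bsub>V\<^esub> v \<in> carrier V"
    "\<zero>\<^bsub>V\<^esub> \<in> carrier V"
proof -
  show m: "Module.module complex_algebra V" and "topspace (vtop V) = carrier V"
    using assms by (simp_all add: topological_vector_space_def)
  then interpret Module.module complex_algebra V by simp
  show "abelian_group V" by unfold_locales
  show "v \<in> carrier V \<Longrightarrow> w \<in> carrier V \<Longrightarrow> v \<oplus>\<^bsub>V\<^esub> w \<in> carrier V" by simp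
  show "v \<in> carrier V \<Longrightarrow> c \<odot>\<^bsub>V\<^esub> v \<in> carrier V" using smult_closed[of c v] by simp
  show "\<zero>\<^bsub>V\<^esub> \<in> carrier V" by simp
qed

lemma continuous_map_fst_component:
  "j \<in> J \<Longrightarrow> continuous_map (prod_topology (product_topology (\<lambda>_. euclidean) J) Y) euclidean (\<lambda>z. fst z j :: complex)"
  using continuous_map_compose[OF continuous_map_fst continuous_map_product_projection[of j J "\<lambda>_. euclidean :: complex topology"]]
  by (simp add: o_def)

lemma continuous_map_snd_component:
  "j \<in> J \<Longrightarrow> continuous_map (prod_topology Y (product_topology (\<lambda>_. euclidean) J)) euclidean (\<lambda>z. snd z j :: complex)"
  using continuous_map_compose[OF continuous_map_snd continuous_map_product_projection[of j J "\<lambda>_. euclidean :: complex topology"]]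
  by (simp add: o_def)

lemma tvs_complex_power: "topological_vector_space (complex_power J)"
  unfolding topological_vector_space_def
proof (intro conjI)
  show "Module.module complex_algebra (complex_power J)"
  proof (rule moduleI)
    show "abelian_group (complex_power J)"
    proof (rule abelian_groupI)
      fix x :: "'a \<Rightarrow> complex" assume "x \<in> carrier (complex_power J)"
      then show "\<exists>y\<in>carrier (complex_power J). y \<oplus>\<^bsub>complex_power J\<^esub> x = \<zero>\<^bsub>complex_power J\<^esub>"
        by (intro bexI[of _ "\<lambda>j\<in>J. - x j"]) auto
    qed (auto simp: fun_eq_iff extensional_def)
  qed (auto simp: cring_complex_algebra fun_eq_iff extensional_def algebra_simps)
  show "continuous_map (prod_topology (vtop (complex_power J)) (vtop (complex_power J))) (vtop (complex_power J))
     (\<lambda>(v, w). v \<oplus>\<^bsub>complex_power J\<^esub> w)"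
    using continuous_map_fst_component continuous_map_snd_component by (auto simp: continuous_map_componentwise case_prod_beta' intro!: continuous_map_add)
  show "continuous_map (prod_topology euclidean (vtop (complex_power J))) (vtop (complex_power J))
     (\<lambda>(c, v). c \<odot>\<^bsub>complex_power J\<^esub> v)"
    using continuous_map_snd_component by (auto simp: continuous_map_componentwise case_prod_beta' intro!: continuous_map_complex_mult continuous_map_fst)
qed (auto simp: PiE_def)

lemma coordinate_continuous_linear:
  assumes "j \<in> J" shows "(\<lambda>\<phi>. \<phi> j) \<in> continuous_linear (complex_power J) complex_algebra"
  using assms by (intro continuous_linearI) (auto intro: continuous_map_product_projection)

lemma continuous_linear_into_power:
  assumes V: "topological_vector_space V"
    and ext: "\<And>v. v \<in> carrier V \<Longrightarrow> f v \<in> extensional J"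
    and co: "\<And>j. j \<in> J \<Longrightarrow> (\<lambda>v. f v j) \<in> continuous_linear V complex_algebra"
  shows "f \<in> continuous_linear V (complex_power J)"
proof (rule continuous_linearI)
  fix v w assume v: "v \<in> carrier V" and w: "w \<in> carrier V"
  show "f (v \<oplus>\<^bsub>V\<^esub> w) = f v \<oplus>\<^bsub>complex_power J\<^esub> f w"
  proof
    fix j show "f (v \<oplus>\<^bsub>V\<^esub> w) j = (f v \<oplus>\<^bsub>complex_power J\<^esub> f w) j"
      using continuous_linearD(4)[OF co v w] ext[OF tvsD(4)[OF V v w]] by (cases "j \<in> J") (auto simp: extensional_def)
  qed
next
  fix c v assume v: "v \<in> carrier V"
  show "f (c \<odot>\<^bsub>V\<^esub> v) = c \<odot>\<^bsub>complex_power J\<^esub> f v"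
  proof
    fix j show "f (c \<odot>\<^bsub>V\<^esub> v) j = (c \<odot>\<^bsub>complex_power J\<^esub> f v) j"
      using continuous_linearD(5)[OF co v] ext[OF tvsD(5)[OF V v]] by (cases "j \<in> J") (auto simp: extensional_def)
  qed
next
  show "continuous_map (vtop V) (vtop (complex_power J)) f"
    using ext continuous_linearD(2)[OF co] tvsD(2)[OF V] by (auto simp: continuous_map_componentwise)
qed (use ext in auto)

lemma continuous_linear_sum:
  assumes "finite S" "\<And>i. i \<in> S \<Longrightarrow> f i \<in> continuous_linear V complex_algebra"
  shows "(\<lambda>v. \<Sum>i\<in>S. c i * f i v) \<in> continuous_linear V complex_algebra"
proof (rule continuous_linearI)
  fix v w assume v: "v \<in> carrier V" and w: "w \<in> carrier V"
  show "(\<Sum>i\<in>S. c i * f i (v \<oplus>\<^bsub>V\<^esub> w)) = (\<Sum>i\<in>S. c i * f i v) \<oplus>\<^bsub>complex_algebra\<^esub> (\<Sum>i\<in>S. c i * f i w)"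
    using continuous_linearD(4)[OF assms(2) v w] by (simp add: distrib_left sum.distrib)
next
  fix a v assume v: "v \<in> carrier V"
  show "(\<Sum>i\<in>S. c i * f i (a \<odot>\<^bsub>V\<^esub> v)) = a \<odot>\<^bsub>complex_algebra\<^esub> (\<Sum>i\<in>S. c i * f i v)"
    using continuous_linearD(5)[OF assms(2) v] by (simp add: sum_distrib_left mult_ac)
next
  show "continuous_map (vtop V) (vtop complex_algebra) (\<lambda>v. \<Sum>i\<in>S. c i * f i v)"
    using continuous_linearD(2)[OF assms(2)] assms(1)
    by (auto intro!: continuous_map_sum continuous_map_cmult)
qed simp

lemma continuous_linear_diff:
  assumes "f \<in> continuous_linear V complex_algebra" "g \<in> continuous_linear V complex_algebra"
  shows "(\<lambda>v. f v - g v) \<in> continuous_linear V complex_algebra"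
  by (rule continuous_linearI)
    (use continuous_linearD[OF assms(1)] continuous_linearD[OF assms(2)] in \<open>auto simp: algebra_simps intro!: continuous_map_diff\<close>)

lemma top_linear_iso_continuous: "f \<in> top_linear_iso V W \<Longrightarrow> f \<in> continuous_linear V W"
  by (simp add: top_linear_iso_def continuous_linear_def homeomorphic_imp_continuous_map)

lemma top_linear_isoI:
  assumes f: "f \<in> continuous_linear V W" and g: "g \<in> continuous_linear W V"
    and t: "topspace (vtop V) = carrier V" "topspace (vtop W) = carrier W"
    and "\<And>v. v \<in> carrier V \<Longrightarrow> g (f v) = v" "\<And>w. w \<in> carrier W \<Longrightarrow> f (g w) = w"
  shows "f \<in> top_linear_iso V W"
proof -
  have "homeomorphic_maps (vtop V) (vtop W) f g"
    unfolding homeomorphic_maps_def using continuous_linearD(2)[OF f] continuous_linearD(2)[OF g] assms by auto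
  then show ?thesis using f by (auto simp: top_linear_iso_def continuous_linear_def homeomorphic_map_maps)
qed

lemma top_linear_iso_bij:
  assumes "f \<in> top_linear_iso V W" "topspace (vtop V) = carrier V" "topspace (vtop W) = carrier W"
  shows "bij_betw f (carrier V) (carrier W)"
  using assms by (simp add: top_linear_iso_def bij_betw_def homeomorphic_eq_everything_map)

lemma top_linear_iso_inverse:
  assumes f: "f \<in> top_linear_iso V W" and V: "topological_vector_space V" and W: "topological_vector_space W"
  obtains g where "g \<in> continuous_linear W V" "\<And>v. v \<in> carrier V \<Longrightarrow> g (f v) = v" "\<And>w. w \<in> carrier W \<Longrightarrow> f (g w) = w"
proof -
  obtain g where "homeomorphic_maps (vtop V) (vtop W) f g"
    using f by (auto simp: top_linear_iso_def homeomorphic_map_maps)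
  then have gc: "continuous_map (vtop W) (vtop V) g"
    and gf: "\<And>v. v \<in> carrier V \<Longrightarrow> g (f v) = v" and fg: "\<And>w. w \<in> carrier W \<Longrightarrow> f (g w) = w"
    using tvsD(2)[OF V] tvsD(2)[OF W] by (auto simp: homeomorphic_maps_def)
  have g: "g w \<in> carrier V" if "w \<in> carrier W" for w
    using gc that tvsD(2)[OF V] tvsD(2)[OF W] by (auto simp: continuous_map_def)
  note fl = continuous_linearD[OF top_linear_iso_continuous[OF f]]
  have "g \<in> continuous_linear W V"
  proof (rule continuous_linearI[OF g _ _ gc])
    fix v w assume v: "v \<in> carrier W" and w: "w \<in> carrier W"
    have "g (v \<oplus>\<^bsub>W\<^esub> w) = g (f (g v \<oplus>\<^bsub>V\<^esub> g w))" using fl(4)[OF g[OF v] g[OF w]] fg v w by simp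
    then show "g (v \<oplus>\<^bsub>W\<^esub> w) = g v \<oplus>\<^bsub>V\<^esub> g w" using gf tvsD(4)[OF V g[OF v] g[OF w]] by simp
  next
    fix c w assume w: "w \<in> carrier W"
    have "g (c \<odot>\<^bsub>W\<^esub> w) = g (f (c \<odot>\<^bsub>V\<^esub> g w))" using fl(5)[OF g[OF w]] fg w by simp
    then show "g (c \<odot>\<^bsub>W\<^esub> w) = c \<odot>\<^bsub>V\<^esub> g w" using gf tvsD(5)[OF V g[OF w]] by simp
  qed
  then show ?thesis using that gf fg by blast
qed

lemma weakly_complete_tvs: "weakly_complete_space V \<Longrightarrow> topological_vector_space V"
  by (simp add: weakly_complete_space_def)

lemma weakly_complete_chart:
  assumes "weakly_complete_space (V :: 'a top_algebra)"
  obtains J :: "'a set" and \<kappa> \<iota> where "\<kappa> \<in> continuous_linear V (complex_power J)"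
    "\<iota> \<in> continuous_linear (complex_power J) V"
    "\<And>v. v \<in> carrier V \<Longrightarrow> \<iota> (\<kappa> v) = v" "\<And>w. w \<in> extensional J \<Longrightarrow> \<kappa> (\<iota> w) = w"
proof -
  obtain J :: "'a set" and \<kappa> where k: "\<kappa> \<in> top_linear_iso V (complex_power J)"
    using assms by (auto simp: weakly_complete_space_def)
  show ?thesis
    using top_linear_iso_inverse[OF k weakly_complete_tvs[OF assms] tvs_complex_power]
      top_linear_iso_continuous[OF k] that by (metis complex_power_simps(1))
qed

lemma reindex_complex_power:
  assumes "bij_betw h J' J"
  shows "(\<lambda>\<phi>. \<lambda>i\<in>J'. \<phi> (h i)) \<in> top_linear_iso (complex_power J) (complex_power J')"
proof (rule top_linear_isoI[where g="\<lambda>\<phi>. \<lambda>j\<in>J. \<phi> (inv_into J' h j)"])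
  have h: "h i \<in> J" if "i \<in> J'" for i using assms that by (auto simp: bij_betw_def)
  have h': "inv_into J' h j \<in> J'" "h (inv_into J' h j) = j" if "j \<in> J" for j
    using assms that by (auto simp: bij_betw_def inv_into_into f_inv_into_f)
  have h'h: "inv_into J' h (h i) = i" if "i \<in> J'" for i using assms that by (auto simp: bij_betw_def)
  show "(\<lambda>\<phi>. \<lambda>i\<in>J'. \<phi> (h i)) \<in> continuous_linear (complex_power J) (complex_power J')"
    by (rule continuous_linear_into_power[OF tvs_complex_power]) (use h in \<open>auto intro: coordinate_continuous_linear\<close>)
  show "(\<lambda>\<phi>. \<lambda>j\<in>J. \<phi> (inv_into J' h j)) \<in> continuous_linear (complex_power J') (complex_power J)"
    by (rule continuous_linear_into_power[OF tvs_complex_power]) (use h' in \<open>auto intro: coordinate_continuous_linear\<close>)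
  fix v assume "v \<in> carrier (complex_power J)"
  then show "(\<lambda>j\<in>J. (\<lambda>i\<in>J'. v (h i)) (inv_into J' h j)) = v"
    by (auto simp: fun_eq_iff extensional_def h')
next
  have h: "h i \<in> J" "inv_into J' h (h i) = i" if "i \<in> J'" for i using assms that by (auto simp: bij_betw_def)
  fix w assume "w \<in> carrier (complex_power J')"
  then show "(\<lambda>i\<in>J'. (\<lambda>j\<in>J. w (inv_into J' h j)) (h i)) = w"
    by (auto simp: fun_eq_iff extensional_def h)
qed (auto simp: PiE_def)

definition delta :: "'j set \<Rightarrow> 'j \<Rightarrow> 'j \<Rightarrow> complex" where
  "delta J i = (\<lambda>j\<in>J. if j = i then 1 else 0)"

lemma delta_ext [simp]: "delta J i \<in> extensional J" by (simp add: delta_def)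

lemma delta_inj: "inj_on (delta J) J"
proof (rule inj_onI)
  fix i j assume "i \<in> J" "j \<in> J" "delta J i = delta J j"
  then have "delta J i i = delta J j i" by simp
  then show "i = j" using \<open>i \<in> J\<close> by (simp add: delta_def split: if_splits)
qed

text \<open>The definition asks for an index set in the type of the vectors; the unit vectors are
  such a copy of \<open>J\<close>.\<close>

lemma weakly_complete_complex_power: "weakly_complete_space (complex_power J)"
proof -
  have "bij_betw (inv_into J (delta J)) (delta J ` J) J"
    using delta_inj by (intro bij_betw_inv_into) (simp add: bij_betw_def)
  from reindex_complex_power[OF this] show ?thesis
    unfolding weakly_complete_space_def using tvs_complex_power by blast
qed

section \<open>Finite support of continuous functionals and bilinear forms\<close>

lemma complex_power_box:
  assumes "openin (vtop (complex_power J)) N" "(\<lambda>j\<in>J. 0) \<in> N"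
  obtains S r where "finite S" "S \<subseteq> J" "r > 0"
    "\<And>\<phi>. \<phi> \<in> extensional J \<Longrightarrow> (\<And>j. j \<in> S \<Longrightarrow> norm (\<phi> j) < r) \<Longrightarrow> \<phi> \<in> N"
proof -
  obtain U where U: "finite {j \<in> J. U j \<noteq> UNIV}" "\<And>j. j \<in> J \<Longrightarrow> open (U j)"
    "(\<lambda>j\<in>J. 0) \<in> PiE J U" "PiE J U \<subseteq> N"
    using assms by (auto simp: openin_product_topology_alt)
  define S where "S = {j \<in> J. U j \<noteq> UNIV}"
  have "\<exists>r>0. ball 0 r \<subseteq> U j" if "j \<in> S" for j
  proof -
    have "0 \<in> U j" using U(3) that by (force simp: S_def PiE_def Pi_def)
    then show ?thesis using U(2)[of j] that by (auto simp: S_def open_contains_ball)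
  qed
  then obtain r where r: "\<And>j. j \<in> S \<Longrightarrow> r j > 0 \<and> ball 0 (r j) \<subseteq> U j" by metis
  \<comment> \<open>The extra 1 keeps the minimum defined when no coordinate is restricted.\<close>
  define R where "R = Min (insert 1 (r ` S))"
  have fS: "finite S" using U(1) by (simp add: S_def)
  have R: "R > 0" using fS r by (auto simp: R_def)
  have Rle: "R \<le> r j" if "j \<in> S" for j using fS that by (auto simp: R_def)
  show ?thesis
  proof (rule that[OF fS _ R])
    show "S \<subseteq> J" by (auto simp: S_def)
    fix \<phi> :: "'a \<Rightarrow> complex" assume \<phi>: "\<phi> \<in> extensional J" "\<And>j. j \<in> S \<Longrightarrow> norm (\<phi> j) < R"
    have "\<phi> j \<in> U j" if "j \<in> J" for j
    proof (cases "j \<in> S")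
      case True
      then have "\<phi> j \<in> ball 0 (r j)" using \<phi>(2)[OF True] Rle[OF True] by auto
      then show ?thesis using r True by blast
    next
      case False
      then show ?thesis using that by (simp add: S_def)
    qed
    then show "\<phi> \<in> N" using U(4) \<phi>(1) by (auto simp: PiE_def)
  qed
qed

text \<open>Continuity enters only through the assumption that \<open>f\<close> kills vectors
  vanishing on \<open>S\<close>. In this form the expansion serves functionals as well as both
  partial maps of a bilinear form.\<close>

lemma linear_expansion:
  assumes f: "f \<in> linear_maps (complex_power J) complex_algebra" and S: "finite S" "S \<subseteq> J"
    and z: "\<And>\<phi>. \<phi> \<in> extensional J \<Longrightarrow> (\<And>j. j \<in> S \<Longrightarrow> \<phi> j = 0) \<Longrightarrow> f \<phi> = 0"
    and \<phi>: "\<phi> \<in> extensional J"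
  shows "f \<phi> = (\<Sum>j\<in>S. f (delta J j) * \<phi> j)"
proof -
  have f_add: "f (\<lambda>j\<in>J. \<phi> j + \<psi> j) = f \<phi> + f \<psi>" if "\<phi> \<in> extensional J" "\<psi> \<in> extensional J" for \<phi> \<psi>
    using linear_mapsD(2)[OF f, of \<phi> \<psi>] that by simp
  have f_cm: "f (\<lambda>j\<in>J. c * \<phi> j) = c * f \<phi>" if "\<phi> \<in> extensional J" for \<phi> c
    using linear_mapsD(3)[OF f, of \<phi> c] that by simp
  have part: "f (\<lambda>j\<in>J. if j \<in> S then \<phi> j else 0) = (\<Sum>j\<in>S. f (delta J j) * \<phi> j)"
    using S
  proof (induction S)
    case empty
    show ?case using f_cm[of "\<lambda>j\<in>J. 0" 0] by (simp add: restrict_def extensional_def)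
  next
    case (insert i S)
    have "f (\<lambda>j\<in>J. if j \<in> insert i S then \<phi> j else 0) =
       f (\<lambda>j\<in>J. (\<lambda>j\<in>J. if j \<in> S then \<phi> j else 0) j + (\<lambda>j\<in>J. \<phi> i * delta J i j) j)"
      using insert by (intro arg_cong[where f=f]) (auto simp: delta_def)
    also have "\<dots> = f (\<lambda>j\<in>J. if j \<in> S then \<phi> j else 0) + \<phi> i * f (delta J i)"
      by (subst f_add) (auto simp: f_cm)
    also have "f (\<lambda>j\<in>J. if j \<in> S then \<phi> j else 0) = (\<Sum>j\<in>S. f (delta J j) * \<phi> j)"
      using insert by blast
    finally show ?case unfolding sum.insert[OF insert.hyps] by (simp only: mult.commute add.commute)
  qed
  have "f \<phi> = f (\<lambda>j\<in>J. (\<lambda>j\<in>J. if j \<in> S then \<phi> j else 0) j + (\<lambda>j\<in>J. if j \<in> S then 0 else \<phi> j) j)"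
    using \<phi> by (intro arg_cong[where f=f]) (auto simp: extensional_def)
  also have "\<dots> = f (\<lambda>j\<in>J. if j \<in> S then \<phi> j else 0) + f (\<lambda>j\<in>J. if j \<in> S then 0 else \<phi> j)"
    by (rule f_add) (rule restrict_extensional)+
  also have "f (\<lambda>j\<in>J. if j \<in> S then 0 else \<phi> j) = 0" by (rule z) (use S in auto)
  finally show ?thesis unfolding part by (simp only: add_0_right)
qed

lemma complex_zero_if_bounded:
  fixes z :: complex assumes "\<And>c. norm (c * z) < 1" shows "z = 0"
  using assms[of "inverse z"] by (cases "z = 0") auto

text \<open>Continuity bounds \<open>f\<close> by 1 on a box restricting only the coordinates in
  \<open>S\<close>. The vectors vanishing on \<open>S\<close> form a subspace inside this box, and a
  linear form bounded on a subspace is 0 there.\<close>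

lemma functional_finite_support:
  assumes f: "f \<in> continuous_linear (complex_power J) complex_algebra"
  obtains S where "finite S" "S \<subseteq> J" "\<And>\<phi>. \<phi> \<in> extensional J \<Longrightarrow> f \<phi> = (\<Sum>j\<in>S. f (delta J j) * \<phi> j)"
proof -
  define N where "N = {\<phi> \<in> topspace (vtop (complex_power J)). f \<phi> \<in> ball 0 1}"
  have "openin (vtop (complex_power J)) N"
    unfolding N_def using continuous_linearD(2)[OF f] by (intro openin_continuous_map_preimage) auto
  moreover have "f (\<lambda>j\<in>J. 0) = 0" using continuous_linearD(5)[OF f, of "\<lambda>j\<in>J. 0" 0] by (simp add: restrict_def extensional_def)
  then have "(\<lambda>j\<in>J. 0) \<in> N" by (simp add: N_def)
  ultimately obtain S r where S: "finite S" "S \<subseteq> J" "r > 0"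
    "\<And>\<phi>. \<phi> \<in> extensional J \<Longrightarrow> (\<And>j. j \<in> S \<Longrightarrow> norm (\<phi> j) < r) \<Longrightarrow> \<phi> \<in> N"
    using complex_power_box by blast
  have z: "f \<phi> = 0" if "\<phi> \<in> extensional J" "\<And>j. j \<in> S \<Longrightarrow> \<phi> j = 0" for \<phi>
  proof (rule complex_zero_if_bounded)
    fix c
    have "(\<lambda>j\<in>J. c * \<phi> j) \<in> N" by (rule S(4)) (use that S in auto)
    then show "norm (c * f \<phi>) < 1" using continuous_linearD(5)[OF f, of \<phi> c] that by (simp add: N_def)
  qed
  show ?thesis
    using that[OF S(1,2)] linear_expansion[OF continuous_linearD(1)[OF f] S(1,2) z] by blast
qed

text \<open>Joint continuity provides a box in each factor. If \<phi> vanishes on \<open>S\<close>,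
  all its multiples lie in the first box; once \<psi> is scaled into the second box by a nonzero
  factor, the form is bounded on a whole line and so vanishes. The sets \<open>S\<close> and
  \<open>T\<close> thus do not depend on the other argument.\<close>

lemma bilinear_finite_support:
  assumes b: "b \<in> continuous_bilinear (complex_power I) (complex_power J) complex_algebra"
  obtains S T where "finite S" "S \<subseteq> I" "finite T" "T \<subseteq> J"
    "\<And>\<phi> \<psi>. \<phi> \<in> extensional I \<Longrightarrow> \<psi> \<in> extensional J \<Longrightarrow>
       b \<phi> \<psi> = (\<Sum>i\<in>S. \<Sum>j\<in>T. b (delta I i) (delta J j) * (\<phi> i * \<psi> j))"
proof -
  let ?V = "complex_power I" and ?W = "complex_power J"
  have lr: "b \<phi> \<in> linear_maps ?W complex_algebra" if "\<phi> \<in> extensional I" for \<phi>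
    using b that by (simp add: continuous_bilinear_def)
  have ll: "(\<lambda>\<phi>. b \<phi> \<psi>) \<in> linear_maps ?V complex_algebra" if "\<psi> \<in> extensional J" for \<psi>
    using b that by (simp add: continuous_bilinear_def)
  have bc: "continuous_map (prod_topology (vtop ?V) (vtop ?W)) euclidean (\<lambda>(v, w). b v w)"
    using b by (simp add: continuous_bilinear_def)
  have cl: "b (\<lambda>i\<in>I. c * \<phi> i) \<psi> = c * b \<phi> \<psi>" if "\<phi> \<in> extensional I" "\<psi> \<in> extensional J" for \<phi> \<psi> c
    using linear_mapsD(3)[OF ll[OF that(2)], of \<phi> c] that by simp
  have cr: "b \<phi> (\<lambda>i\<in>J. c * \<psi> i) = c * b \<phi> \<psi>" if "\<phi> \<in> extensional I" "\<psi> \<in> extensional J" for \<phi> \<psi> c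
    using linear_mapsD(3)[OF lr[OF that(1)], of \<psi> c] that by simp
  define N where "N = {z \<in> topspace (prod_topology (vtop ?V) (vtop ?W)). (\<lambda>(v, w). b v w) z \<in> ball 0 1}"
  have N: "openin (prod_topology (vtop ?V) (vtop ?W)) N"
    unfolding N_def using bc by (intro openin_continuous_map_preimage) auto
  have "b (\<lambda>i\<in>I. 0) (\<lambda>j\<in>J. 0) = 0" using cl[of "\<lambda>i\<in>I. 0" "\<lambda>j\<in>J. 0" 0] by (simp add: restrict_def extensional_def)
  then have N0: "(\<lambda>i\<in>I. 0, \<lambda>j\<in>J. 0) \<in> N" by (simp add: N_def)
  obtain M1 M2 where M: "openin (vtop ?V) M1" "openin (vtop ?W) M2"
     "(\<lambda>i\<in>I. 0) \<in> M1" "(\<lambda>j\<in>J. 0) \<in> M2" "M1 \<times> M2 \<subseteq> N"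
    using openin_prod_topology_alt[THEN iffD1, rule_format, OF N N0] by blast
  obtain S r where S: "finite S" "S \<subseteq> I" "r > 0"
    "\<And>\<phi>. \<phi> \<in> extensional I \<Longrightarrow> (\<And>j. j \<in> S \<Longrightarrow> norm (\<phi> j) < r) \<Longrightarrow> \<phi> \<in> M1"
    using complex_power_box[OF M(1,3)] by blast
  obtain T t where T: "finite T" "T \<subseteq> J" "t > 0"
    "\<And>\<phi>. \<phi> \<in> extensional J \<Longrightarrow> (\<And>j. j \<in> T \<Longrightarrow> norm (\<phi> j) < t) \<Longrightarrow> \<phi> \<in> M2"
    using complex_power_box[OF M(2,4)] by blast
  have lt1: "norm (b \<phi> \<psi>) < 1" if "\<phi> \<in> M1" "\<psi> \<in> M2" for \<phi> \<psi>
    using that M(5) by (auto simp: N_def)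
  \<comment> \<open>The factor is \<open>t / s\<close>, where \<open>s\<close> exceeds every modulus
    in question; the summand 1 keeps \<open>s\<close> positive.\<close>
  have scale: "\<exists>e. e \<noteq> 0 \<and> (\<forall>j\<in>T. norm (e * \<phi> j) < t)" if "finite T" "t > 0" for T t and \<phi> :: "'x \<Rightarrow> complex"
  proof -
    define s where "s = 1 + (\<Sum>j\<in>T. norm (\<phi> j))"
    have s: "s > 0" unfolding s_def by (intro add_pos_nonneg sum_nonneg) auto
    have "norm (complex_of_real (t / s) * \<phi> j) < t" if "j \<in> T" for j
    proof -
      have "norm (\<phi> j) \<le> (\<Sum>j\<in>T. norm (\<phi> j))"
        using that \<open>finite T\<close> by (intro member_le_sum) auto
      then have "norm (\<phi> j) < s" by (simp add: s_def)
      then have "t / s * norm (\<phi> j) < t" using s \<open>t > 0\<close> by (simp add: field_simps)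
      then show ?thesis using s \<open>t > 0\<close> by (simp add: norm_mult norm_divide)
    qed
    moreover have "complex_of_real (t / s) \<noteq> 0" using s \<open>t > 0\<close> by simp
    ultimately show ?thesis by blast
  qed
  have zl: "b \<phi> \<psi> = 0" if \<phi>: "\<phi> \<in> extensional I" "\<And>i. i \<in> S \<Longrightarrow> \<phi> i = 0" and \<psi>: "\<psi> \<in> extensional J" for \<phi> \<psi>
  proof -
    obtain e where e: "e \<noteq> 0" "\<forall>j\<in>T. norm (e * \<psi> j) < t" using scale[OF T(1,3)] by blast
    have "e * b \<phi> \<psi> = 0"
    proof (rule complex_zero_if_bounded)
      fix c
      have "norm (b (\<lambda>i\<in>I. c * \<phi> i) (\<lambda>j\<in>J. e * \<psi> j)) < 1"
        by (intro lt1 S(4) T(4)) (use \<phi> S T e in auto)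
      then show "norm (c * (e * b \<phi> \<psi>)) < 1"
        by (simp only: cl[OF \<phi>(1) restrict_extensional] cr[OF \<phi>(1) \<psi>])
    qed
    then show ?thesis using e by simp
  qed
  have zr: "b \<phi> \<psi> = 0" if \<phi>: "\<phi> \<in> extensional I" and \<psi>: "\<psi> \<in> extensional J" "\<And>i. i \<in> T \<Longrightarrow> \<psi> i = 0" for \<phi> \<psi>
  proof -
    obtain e where e: "e \<noteq> 0" "\<forall>j\<in>S. norm (e * \<phi> j) < r" using scale[OF S(1,3)] by blast
    have "e * b \<phi> \<psi> = 0"
    proof (rule complex_zero_if_bounded)
      fix c
      have "norm (b (\<lambda>i\<in>I. e * \<phi> i) (\<lambda>j\<in>J. c * \<psi> j)) < 1"
        by (intro lt1 S(4) T(4)) (use \<psi> S T e in auto)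
      then show "norm (c * (e * b \<phi> \<psi>)) < 1"
        by (simp only: cl[OF \<phi> restrict_extensional] cr[OF \<phi> \<psi>(1)] mult.left_commute[of c])
    qed
    then show ?thesis using e by simp
  qed
  show ?thesis
  proof (rule that[OF S(1,2) T(1,2)])
    fix \<phi> :: "'a \<Rightarrow> complex" and \<psi> :: "'b \<Rightarrow> complex" assume \<phi>: "\<phi> \<in> extensional I" and \<psi>: "\<psi> \<in> extensional J"
    have "b \<phi> \<psi> = (\<Sum>i\<in>S. b (delta I i) \<psi> * \<phi> i)"
      using linear_expansion[OF ll[OF \<psi>] S(1,2) zl[OF _ _ \<psi>] \<phi>] by simp
    also have "\<dots> = (\<Sum>i\<in>S. (\<Sum>j\<in>T. b (delta I i) (delta J j) * \<psi> j) * \<phi> i)"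
      using linear_expansion[OF lr[OF delta_ext] T(1,2) zr[OF delta_ext] \<psi>] by simp
    also have "\<dots> = (\<Sum>i\<in>S. \<Sum>j\<in>T. b (delta I i) (delta J j) * (\<phi> i * \<psi> j))"
      by (simp add: sum_distrib_left sum_distrib_right mult_ac)
    finally show "b \<phi> \<psi> = (\<Sum>i\<in>S. \<Sum>j\<in>T. b (delta I i) (delta J j) * (\<phi> i * \<psi> j))" .
  qed
qed

lemma bilinear_compose:
  assumes b: "b \<in> continuous_bilinear V W U" and f: "f \<in> continuous_linear V' V" and g: "g \<in> continuous_linear W' W"
    and h: "h \<in> continuous_linear U U'"
  shows "(\<lambda>v w. h (b (f v) (g w))) \<in> continuous_bilinear V' W' U'"
proof -
  have "continuous_map (prod_topology (vtop V') (vtop W')) (prod_topology (vtop V) (vtop W)) (\<lambda>z. (f (fst z), g (snd z)))"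
    using continuous_map_compose[OF continuous_map_fst continuous_linearD(2)[OF f]]
      continuous_map_compose[OF continuous_map_snd continuous_linearD(2)[OF g]]
    by (intro continuous_map_pairedI) (auto simp: o_def)
  moreover have "continuous_map (prod_topology (vtop V) (vtop W)) (vtop U) (\<lambda>(v, w). b v w)"
    using b by (simp add: continuous_bilinear_def)
  ultimately have "continuous_map (prod_topology (vtop V') (vtop W')) (vtop U) ((\<lambda>(v, w). b v w) \<circ> (\<lambda>z. (f (fst z), g (snd z))))"
    by (rule continuous_map_compose)
  from continuous_map_compose[OF this continuous_linearD(2)[OF h]]
  have "continuous_map (prod_topology (vtop V') (vtop W')) (vtop U') (\<lambda>(v, w). h (b (f v) (g w)))"
    by (simp add: o_def case_prod_beta')
  then show ?thesis
    using b continuous_linearD(1)[OF f] continuous_linearD(1)[OF g] continuous_linearD(1)[OF h]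
    unfolding continuous_bilinear_def linear_maps_iff by auto
qed

section \<open>Powers of \<complex> as test algebras, and transfer of structure\<close>

lemma weakly_complete_algebra_complex_power: "weakly_complete_algebra (complex_power J)"
  unfolding weakly_complete_algebra_def
proof (intro conjI weakly_complete_complex_power)
  show "Ring.ring (complex_power J)"
    by (rule ringI[OF tvsD(3)[OF tvs_complex_power] monoidI])
      (auto simp: fun_eq_iff extensional_def algebra_simps)
  show "(\<lambda>x y. x \<otimes>\<^bsub>complex_power J\<^esub> y) \<in> continuous_bilinear (complex_power J) (complex_power J) (complex_power J)"
    unfolding continuous_bilinear_def
  proof (intro CollectI conjI ballI)
    fix x :: "'a \<Rightarrow> complex"
    show "(\<otimes>\<^bsub>complex_power J\<^esub>) x \<in> linear_maps (complex_power J) (complex_power J)"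
      "(\<lambda>v. v \<otimes>\<^bsub>complex_power J\<^esub> x) \<in> linear_maps (complex_power J) (complex_power J)"
      unfolding linear_maps_iff by (simp_all add: fun_eq_iff restrict_def extensional_def algebra_simps)
  next
    show "continuous_map (prod_topology (vtop (complex_power J)) (vtop (complex_power J))) (vtop (complex_power J))
       (\<lambda>(v, w). v \<otimes>\<^bsub>complex_power J\<^esub> w)"
      using continuous_map_fst_component continuous_map_snd_component
      by (auto simp: continuous_map_componentwise case_prod_beta' intro!: continuous_map_complex_mult)
  qed
qed

text \<open>The vector space structure ignores product and unit. This is meant for an algebra
  obtained from a power of \<complex> by replacing just these two.\<close>

lemma tvs_cong:
  assumes "carrier V' = carrier V" "ring.zero V' = ring.zero V" "ring.add V' = ring.add V"
    "smult V' = smult V" "vtop V' = vtop V" and V: "topological_vector_space V"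
  shows "topological_vector_space V'"
proof -
  interpret Module.module complex_algebra V using tvsD(1)[OF V] .
  have "Module.module complex_algebra V'"
  proof (rule moduleI)
    show "abelian_group V'"
      by (rule abelian_groupI) (use assms(1-5) a_assoc a_comm in \<open>auto intro: l_neg bexI[of _ "\<ominus>\<^bsub>V\<^esub> x" for x]\<close>)
  qed (use assms(1-5) R.is_cring smult_closed smult_l_distr smult_r_distr smult_assoc1 smult_one in auto)
  then show ?thesis using V assms(1-5) by (simp add: topological_vector_space_def)
qed

lemma continuous_linear_cong:
  assumes f: "f \<in> continuous_linear V W" and V: "topological_vector_space V"
    and eq: "\<And>v. v \<in> carrier V \<Longrightarrow> g v = f v"
  shows "g \<in> continuous_linear V W"
proof (rule continuous_linearI)
  show "continuous_map (vtop V) (vtop W) g"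
    using continuous_map_eq[OF continuous_linearD(2)[OF f], of g] eq tvsD(2)[OF V] by simp
qed (use continuous_linearD[OF f] eq tvsD[OF V] in auto)

lemma bilinear_section:
  assumes b: "b \<in> continuous_bilinear V W U"
    and t: "topspace (vtop V) = carrier V" "topspace (vtop W) = carrier W"
  shows "v \<in> carrier V \<Longrightarrow> b v \<in> continuous_linear W U"
    and "w \<in> carrier W \<Longrightarrow> (\<lambda>v. b v w) \<in> continuous_linear V U"
proof -
  have c: "continuous_map (prod_topology (vtop V) (vtop W)) (vtop U) (\<lambda>(v, w). b v w)"
    using b by (simp add: continuous_bilinear_def)
  show "b v \<in> continuous_linear W U" if v: "v \<in> carrier V"
  proof -
    have "continuous_map (vtop W) (prod_topology (vtop V) (vtop W)) (\<lambda>w. (v, w))"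
      using v t by (intro continuous_map_pairedI) auto
    from continuous_map_compose[OF this c] show ?thesis
      using b v by (simp add: continuous_bilinear_def continuous_linear_def o_def)
  qed
  show "(\<lambda>v. b v w) \<in> continuous_linear V U" if w: "w \<in> carrier W"
  proof -
    have "continuous_map (vtop V) (prod_topology (vtop V) (vtop W)) (\<lambda>v. (v, w))"
      using w t by (intro continuous_map_pairedI) auto
    from continuous_map_compose[OF this c] show ?thesis
      using b w by (simp add: continuous_bilinear_def continuous_linear_def o_def)
  qed
qed

section \<open>The group algebra of a compact abelian group\<close>

locale compact_ab_group_algebra = compact_ab_group G for G :: "'g top_group" (structure) +
  fixes A :: "'a top_algebra" and \<eta> :: "'g \<Rightarrow> 'a"
  assumes group_algebra: "group_algebra G A \<eta>"
begin

abbreviation "P \<equiv> complex_power (carrier D)"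

lemma wcA: "weakly_complete_algebra A"
  using group_algebra by (simp add: group_algebra_def)

lemma wsA: "weakly_complete_space A" and ringA: "Ring.ring A"
  and bilA: "(\<lambda>x y. x \<otimes>\<^bsub>A\<^esub> y) \<in> continuous_bilinear A A A"
  using wcA by (simp_all add: weakly_complete_algebra_def)

lemma tvsA: "topological_vector_space A" using weakly_complete_tvs[OF wsA] .

sublocale A: Ring.ring A by (rule ringA)

lemmas tA = tvsD(2)[OF tvsA]

lemma topspace_P: "topspace (vtop P) = carrier P"
  using tvsD(2)[OF tvs_complex_power] .

lemma \<eta>_Units: "g \<in> carrier G \<Longrightarrow> \<eta> g \<in> Units A"
  and \<eta>_mult: "g \<in> carrier G \<Longrightarrow> h \<in> carrier G \<Longrightarrow> \<eta> (g \<otimes> h) = \<eta> g \<otimes>\<^bsub>A\<^esub> \<eta> h"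
  and \<eta>_cont: "continuous_map X (vtop A) \<eta>"
  using group_algebra
  by (auto simp: group_algebra_def continuous_hom_def hom_def unit_group_def continuous_map_in_subtopology)

lemma \<eta>_closed: "g \<in> carrier G \<Longrightarrow> \<eta> g \<in> carrier A"
  using \<eta>_Units A.Units_closed by blast

lemma \<eta>_one: "\<eta> \<one> = \<one>\<^bsub>A\<^esub>"
proof -
  have "\<eta> \<one> \<otimes>\<^bsub>A\<^esub> \<eta> \<one> = \<eta> \<one> \<otimes>\<^bsub>A\<^esub> \<one>\<^bsub>A\<^esub>" using \<eta>_mult[of \<one> \<one>] \<eta>_closed[of \<one>] by simp
  then show ?thesis using A.Units_l_cancel[OF \<eta>_Units[OF one_closed] \<eta>_closed[OF one_closed] A.one_closed] by blast
qed

lemma universal_exists: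
  fixes B :: "('a \<Rightarrow> complex) top_algebra"
  assumes "weakly_complete_algebra B" "f \<in> continuous_hom G (unit_group B)"
  obtains F where "F \<in> algebra_hom A B" "\<And>g. g \<in> carrier G \<Longrightarrow> F (\<eta> g) = f g"
proof -
  have "\<exists>!F. F \<in> algebra_hom A B \<and> F \<in> extensional (carrier A) \<and> (\<forall>g\<in>carrier G. F (\<eta> g) = f g)"
    using group_algebra assms by (simp add: group_algebra_def)
  then show ?thesis using that by blast
qed

lemma universal_unique:
  fixes B :: "('a \<Rightarrow> complex) top_algebra"
  assumes "weakly_complete_algebra B" "f \<in> continuous_hom G (unit_group B)"
    and F: "F \<in> algebra_hom A B" "F \<in> extensional (carrier A)" "\<And>g. g \<in> carrier G \<Longrightarrow> F (\<eta> g) = f g"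
    and H: "H \<in> algebra_hom A B" "H \<in> extensional (carrier A)" "\<And>g. g \<in> carrier G \<Longrightarrow> H (\<eta> g) = f g"
  shows "F = H"
proof -
  have "\<exists>!F. F \<in> algebra_hom A B \<and> F \<in> extensional (carrier A) \<and> (\<forall>g\<in>carrier G. F (\<eta> g) = f g)"
    using group_algebra assms(1,2) by (simp add: group_algebra_def)
  then show ?thesis using F H by blast
qed

lemma ev_ext [simp]: "ev g \<in> extensional (carrier D)" by (simp add: ev_def)

lemma ev_mult: "g \<in> carrier G \<Longrightarrow> h \<in> carrier G \<Longrightarrow> ev (g \<otimes> h) = (\<lambda>\<xi>\<in>carrier D. ev g \<xi> * ev h \<xi>)"
  using mchar_mult[OF mchar_to_mchar] by (auto simp: fun_eq_iff ev_eq restrict_def) (simp add: ev_def)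

lemma ev_one: "ev \<one> = \<one>\<^bsub>P\<^esub>"
  using mchar_one[OF mchar_to_mchar] by (auto simp: fun_eq_iff ev_eq restrict_def) (simp add: ev_def)

text \<open>The universal property is applied to a copy of \<complex> among the admissible test
  algebras: the power over a single point \<open>u\<close> of the type of \<open>A\<close>. Any
  point serves, hence \<open>undefined\<close>.\<close>

lemma character_functional:
  assumes \<xi>: "\<xi> \<in> carrier D"
  shows "\<exists>F. F \<in> continuous_linear A complex_algebra \<and>
    (\<forall>a\<in>carrier A. \<forall>b\<in>carrier A. F (a \<otimes>\<^bsub>A\<^esub> b) = F a * F b) \<and> F \<one>\<^bsub>A\<^esub> = 1 \<and>
    (\<forall>g\<in>carrier G. F (\<eta> g) = ev g \<xi>)"
proof -
  define u :: 'a where "u = undefined"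
  let ?B = "complex_power {u}"
  note m = mchar_to_mchar[OF \<xi>]
  define f where "f g = (\<lambda>i\<in>{u}. to_mchar \<xi> g)" for g
  have U: "(\<lambda>i\<in>{u}. z) \<in> Units ?B" if "z \<noteq> 0" for z
  proof -
    have "(\<lambda>i\<in>{u}. z) \<otimes>\<^bsub>?B\<^esub> (\<lambda>i\<in>{u}. inverse z) = \<one>\<^bsub>?B\<^esub>"
      "(\<lambda>i\<in>{u}. inverse z) \<otimes>\<^bsub>?B\<^esub> (\<lambda>i\<in>{u}. z) = \<one>\<^bsub>?B\<^esub>"
      using that by (auto simp: fun_eq_iff restrict_def)
    then show ?thesis unfolding Units_def by (auto intro!: bexI[of _ "\<lambda>i\<in>{u}. inverse z"])
  qed
  have "f \<in> hom G (unit_group ?B)"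
    unfolding hom_def
  proof (intro CollectI conjI ballI)
    show "f \<in> carrier G \<rightarrow> carrier (unit_group ?B)"
    proof
      fix g assume "g \<in> carrier G"
      then have "to_mchar \<xi> g \<noteq> 0" using mchar_norm[OF m] by force
      then show "f g \<in> carrier (unit_group ?B)" using U by (simp add: unit_group_def f_def)
    qed
    show "f (g \<otimes> h) = f g \<otimes>\<^bsub>unit_group ?B\<^esub> f h" if "g \<in> carrier G" "h \<in> carrier G" for g h
      using mchar_mult[OF m that] by (auto simp: unit_group_def f_def fun_eq_iff)
  qed
  moreover have "continuous_map X (vtop ?B) f"
    using CG_cts[OF mchar_CG[OF m]] by (auto simp: continuous_map_componentwise f_def)
  ultimately have "f \<in> continuous_hom G (unit_group ?B)"
    by (auto simp: continuous_hom_def continuous_map_in_subtopology unit_group_def hom_def)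
  then obtain F where F: "F \<in> algebra_hom A ?B" "\<And>g. g \<in> carrier G \<Longrightarrow> F (\<eta> g) = f g"
    using universal_exists[OF weakly_complete_algebra_complex_power] by blast
  have FL: "F \<in> continuous_linear A ?B" and FR: "F \<in> ring_hom A ?B" using F by (auto simp: algebra_hom_def)
  have "(\<lambda>a. F a u) \<in> continuous_linear A complex_algebra"
    using continuous_linear_compose[OF FL coordinate_continuous_linear[of u "{u}"]] by simp
  moreover have "F (a \<otimes>\<^bsub>A\<^esub> b) u = F a u * F b u" if "a \<in> carrier A" "b \<in> carrier A" for a b
    using ring_hom_mult[OF FR that] by simp
  moreover have "F \<one>\<^bsub>A\<^esub> u = 1" using ring_hom_one[OF FR] by simp
  moreover have "F (\<eta> g) u = ev g \<xi>" if "g \<in> carrier G" for g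
    using F(2)[OF that] ev_eq[OF that \<xi>] by (simp add: f_def)
  ultimately show ?thesis by blast
qed

text \<open>By continuity \<open>\<omega> (x y)\<close> depends on finitely many coordinates of \<open>x\<close> and \<open>y\<close>, so the
  translates of \<open>\<omega> \<circ> \<eta>\<close> span a finite-dimensional space.\<close>

lemma functional_trig_poly:
  assumes \<omega>: "\<omega> \<in> continuous_linear A complex_algebra"
  shows "\<exists>T c. finite T \<and> T \<subseteq> carrier D \<and> (\<forall>g\<in>carrier G. \<omega> (\<eta> g) = (\<Sum>\<xi>\<in>T. c \<xi> * ev g \<xi>))"
proof -
  obtain J :: "'a set" and \<kappa> \<iota> where \<kappa>: "\<kappa> \<in> continuous_linear A (complex_power J)"
    and \<iota>: "\<iota> \<in> continuous_linear (complex_power J) A"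
    and \<iota>\<kappa>: "\<And>v. v \<in> carrier A \<Longrightarrow> \<iota> (\<kappa> v) = v"
    using weakly_complete_chart[OF wsA] by metis
  have \<kappa>c: "\<kappa> v \<in> extensional J" if "v \<in> carrier A" for v using continuous_linearD(3)[OF \<kappa> that] by simp
  define b where "b \<phi> \<psi> = \<omega> (\<iota> \<phi> \<otimes>\<^bsub>A\<^esub> \<iota> \<psi>)" for \<phi> \<psi>
  have "b \<in> continuous_bilinear (complex_power J) (complex_power J) complex_algebra"
    unfolding b_def[abs_def] by (rule bilinear_compose[OF bilA \<iota> \<iota> \<omega>])
  from bilinear_finite_support[OF this] obtain S T where S: "finite S" "S \<subseteq> J" and T: "finite T" "T \<subseteq> J"
    and bST: "\<And>\<phi> \<psi>. \<phi> \<in> extensional J \<Longrightarrow> \<psi> \<in> extensional J \<Longrightarrow>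
       b \<phi> \<psi> = (\<Sum>i\<in>S. \<Sum>j\<in>T. b (delta J i) (delta J j) * (\<phi> i * \<psi> j))"
    by blast
  have co: "cts (\<lambda>g. \<kappa> (\<eta> g) j)" if "j \<in> J" for j
    using continuous_map_compose[OF continuous_map_compose[OF \<eta>_cont continuous_linearD(2)[OF \<kappa>]]
        continuous_linearD(2)[OF coordinate_continuous_linear[OF that]]] by (simp add: o_def)
  have f: "cts (\<lambda>g. \<omega> (\<eta> g))"
    using continuous_map_compose[OF \<eta>_cont continuous_linearD(2)[OF \<omega>]] by (simp add: o_def)
  define ca where "ca = (\<lambda>(i, j) g. b (delta J i) (delta J j) * \<kappa> (\<eta> g) i)"
  define cb where "cb = (\<lambda>(i :: 'a, j) g. \<kappa> (\<eta> g) j)"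
  have fab: "\<omega> (\<eta> (g \<otimes> h)) = (\<Sum>p\<in>S \<times> T. ca p g * cb p h)" if g: "g \<in> carrier G" and h: "h \<in> carrier G" for g h
  proof -
    have "\<omega> (\<eta> (g \<otimes> h)) = b (\<kappa> (\<eta> g)) (\<kappa> (\<eta> h))"
      using g h by (simp add: b_def \<eta>_mult \<iota>\<kappa> \<eta>_closed)
    also have "\<dots> = (\<Sum>i\<in>S. \<Sum>j\<in>T. b (delta J i) (delta J j) * (\<kappa> (\<eta> g) i * \<kappa> (\<eta> h) j))"
      by (intro bST \<kappa>c \<eta>_closed g h)
    also have "\<dots> = (\<Sum>p\<in>S \<times> T. ca p g * cb p h)"
      by (simp add: sum.cartesian_product ca_def cb_def case_prod_beta' mult.assoc)
    finally show ?thesis .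
  qed
  have fin: "finite (S \<times> T)" using S T by simp
  have cbc: "cts (cb p)" if "p \<in> S \<times> T" for p using that co T by (auto simp: cb_def)
  obtain T0 c where T0: "finite T0" "T0 \<subseteq> Collect mchar"
    "\<And>g. g \<in> carrier G \<Longrightarrow> \<omega> (\<eta> g) = (\<Sum>\<psi>\<in>T0. c \<psi> * \<psi> g)"
    using translation_finite_trig_poly[OF f fin cbc fab] by blast
  define R where "R = {\<xi> \<in> carrier D. to_mchar \<xi> \<in> T0}"
  have bij: "bij_betw to_mchar R T0"
    unfolding bij_betw_def
  proof (intro conjI equalityI subsetI)
    show "inj_on to_mchar R" using to_mchar_inj by (rule inj_on_subset) (auto simp: R_def)
    show "\<psi> \<in> to_mchar ` R" if \<psi>: "\<psi> \<in> T0" for \<psi>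
    proof -
      have "mchar \<psi>" using T0 \<psi> by auto
      then obtain \<xi> where "\<xi> \<in> carrier D" "to_mchar \<xi> = \<psi>" by (rule to_mchar_surj)
      then show ?thesis using \<psi> by (auto simp: R_def)
    qed
  qed (auto simp: R_def)
  have "\<omega> (\<eta> g) = (\<Sum>\<xi>\<in>R. c (to_mchar \<xi>) * ev g \<xi>)" if g: "g \<in> carrier G" for g
  proof -
    have "\<omega> (\<eta> g) = (\<Sum>\<xi>\<in>R. c (to_mchar \<xi>) * to_mchar \<xi> g)"
      unfolding T0(3)[OF g] using sum.reindex_bij_betw[OF bij, of "\<lambda>\<psi>. c \<psi> * \<psi> g"] by simp
    also have "\<dots> = (\<Sum>\<xi>\<in>R. c (to_mchar \<xi>) * ev g \<xi>)"
      by (rule sum.cong) (auto simp: ev_eq g R_def)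
    finally show ?thesis .
  qed
  moreover have "finite R" using bij T0(1) bij_betw_finite by blast
  moreover have "R \<subseteq> carrier D" by (auto simp: R_def)
  ultimately show ?thesis by (intro exI[of _ R] exI[of _ "\<lambda>\<xi>. c (to_mchar \<xi>)"]) blast
qed

text \<open>Density of the span of \<open>G\<close> in the power of \<complex>, in dual form: by
  finite support a functional restricts to a trigonometric polynomial on \<open>G\<close>, and a
  polynomial that vanishes has zero coefficients.\<close>

lemma functional_zero_on_ev:
  assumes f: "f \<in> continuous_linear P complex_algebra" and z: "\<And>g. g \<in> carrier G \<Longrightarrow> f (ev g) = 0"
    and \<phi>: "\<phi> \<in> extensional (carrier D)"
  shows "f \<phi> = 0"
proof -
  obtain S where S: "finite S" "S \<subseteq> carrier D"
    "\<And>\<phi>. \<phi> \<in> extensional (carrier D) \<Longrightarrow> f \<phi> = (\<Sum>j\<in>S. f (delta (carrier D) j) * \<phi> j)"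
    using functional_finite_support[OF f] by blast
  define d where "d \<psi> = f (delta (carrier D) (inv_into (carrier D) to_mchar \<psi>))" for \<psi>
  have inj: "inj_on to_mchar S" using to_mchar_inj S(2) by (rule inj_on_subset)
  have d: "d (to_mchar \<xi>) = f (delta (carrier D) \<xi>)" if "\<xi> \<in> S" for \<xi>
    using that S(2) to_mchar_inj by (auto simp: d_def inv_into_f_f)
  have "f (delta (carrier D) \<xi>) = 0" if \<xi>: "\<xi> \<in> S" for \<xi>
  proof -
    have "d (to_mchar \<xi>) = 0"
    proof (rule mchar_sum_zero[where T="to_mchar ` S" and c=d])
      show "finite (to_mchar ` S)" "to_mchar ` S \<subseteq> Collect mchar" "to_mchar \<xi> \<in> to_mchar ` S"
        using S \<xi> mchar_to_mchar by auto
      fix g assume g: "g \<in> carrier G"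
      have "(\<Sum>\<psi>\<in>to_mchar ` S. d \<psi> * \<psi> g) = (\<Sum>\<xi>\<in>S. d (to_mchar \<xi>) * to_mchar \<xi> g)"
        using sum.reindex[OF inj, of "\<lambda>\<psi>. d \<psi> * \<psi> g"] by (simp add: o_def)
      also have "\<dots> = (\<Sum>\<xi>\<in>S. f (delta (carrier D) \<xi>) * ev g \<xi>)"
        by (rule sum.cong) (use S g d ev_eq in auto)
      also have "\<dots> = f (ev g)" using S(3)[OF ev_ext] by simp
      also have "\<dots> = 0" by (rule z[OF g])
      finally show "(\<Sum>\<psi>\<in>to_mchar ` S. d \<psi> * \<psi> g) = 0" .
    qed
    then show ?thesis using d[OF \<xi>] by simp
  qed
  then show ?thesis using S(3)[OF \<phi>] by simp
qed

lemma functional_eq_on_ev: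
  assumes f: "f \<in> continuous_linear P complex_algebra" and h: "h \<in> continuous_linear P complex_algebra"
    and eq: "\<And>g. g \<in> carrier G \<Longrightarrow> f (ev g) = h (ev g)" and \<phi>: "\<phi> \<in> extensional (carrier D)"
  shows "f \<phi> = h \<phi>"
  using functional_zero_on_ev[OF continuous_linear_diff[OF f h] _ \<phi>] eq by simp

text \<open>The composite of \<pi> with \<open>s\<close> is the identity on \<open>P\<close> because
  \<open>G\<close> spans a dense subspace there. For the other order, \<open>s\<close> must first be
  shown multiplicative: only then is the composite an algebra endomorphism of \<open>A\<close>, to
  which uniqueness in the universal property applies.\<close>

theorem group_algebra_iso:
  obtains \<Phi> where "\<Phi> \<in> top_algebra_iso A P" "\<And>g. g \<in> carrier G \<Longrightarrow> \<Phi> (\<eta> g) = ev g"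
proof -
  obtain J :: "'a set" and \<kappa> \<iota> where \<kappa>: "\<kappa> \<in> continuous_linear A (complex_power J)"
    and \<iota>: "\<iota> \<in> continuous_linear (complex_power J) A"
    and \<iota>\<kappa>: "\<And>v. v \<in> carrier A \<Longrightarrow> \<iota> (\<kappa> v) = v"
    and \<kappa>\<iota>: "\<And>w. w \<in> extensional J \<Longrightarrow> \<kappa> (\<iota> w) = w"
    using weakly_complete_chart[OF wsA] by metis
  have \<kappa>c: "\<kappa> v \<in> extensional J" if "v \<in> carrier A" for v using continuous_linearD(3)[OF \<kappa> that] by simp
  have \<iota>c: "\<iota> w \<in> carrier A" if "w \<in> extensional J" for w using continuous_linearD(3)[OF \<iota>] that by simp
  have \<kappa>j: "(\<lambda>a. \<kappa> a j) \<in> continuous_linear A complex_algebra" if "j \<in> J" for j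
    using continuous_linear_compose[OF \<kappa> coordinate_continuous_linear[OF that]] by simp
  have A_eq: "a = b" if "a \<in> carrier A" "b \<in> carrier A" "\<And>j. j \<in> J \<Longrightarrow> \<kappa> a j = \<kappa> b j" for a b
  proof -
    have "\<kappa> a = \<kappa> b" by (rule extensionalityI[OF \<kappa>c[OF that(1)] \<kappa>c[OF that(2)]]) (use that in auto)
    then show ?thesis using \<iota>\<kappa> that by metis
  qed

  obtain F where F: "\<And>\<xi>. \<xi> \<in> carrier D \<Longrightarrow> F \<xi> \<in> continuous_linear A complex_algebra"
    and F_mult: "\<And>\<xi> a b. \<xi> \<in> carrier D \<Longrightarrow> a \<in> carrier A \<Longrightarrow> b \<in> carrier A \<Longrightarrow> F \<xi> (a \<otimes>\<^bsub>A\<^esub> b) = F \<xi> a * F \<xi> b"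
    and F_one: "\<And>\<xi>. \<xi> \<in> carrier D \<Longrightarrow> F \<xi> \<one>\<^bsub>A\<^esub> = 1"
    and F_ev: "\<And>\<xi> g. \<xi> \<in> carrier D \<Longrightarrow> g \<in> carrier G \<Longrightarrow> F \<xi> (\<eta> g) = ev g \<xi>"
  proof -
    have "\<forall>\<xi>\<in>carrier D. \<exists>F. F \<in> continuous_linear A complex_algebra \<and>
      (\<forall>a\<in>carrier A. \<forall>b\<in>carrier A. F (a \<otimes>\<^bsub>A\<^esub> b) = F a * F b) \<and> F \<one>\<^bsub>A\<^esub> = 1 \<and>
      (\<forall>g\<in>carrier G. F (\<eta> g) = ev g \<xi>)"
      using character_functional by blast
    from bchoice[OF this] show thesis using that by blast
  qed
  define \<pi> where "\<pi> a = (\<lambda>\<xi>\<in>carrier D. F \<xi> a)" for a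
  have \<pi>: "\<pi> \<in> continuous_linear A P"
    by (rule continuous_linear_into_power[OF tvsA]) (use F in \<open>auto simp: \<pi>_def\<close>)
  have \<pi>_ev: "\<pi> (\<eta> g) = ev g" if "g \<in> carrier G" for g
    using F_ev that by (auto simp: \<pi>_def fun_eq_iff ev_def)
  have \<pi>_ring: "\<pi> \<in> ring_hom A P"
    by (rule ring_hom_memI)
      (use F_mult F_one continuous_linearD(3,4)[OF \<pi>] in \<open>auto simp: \<pi>_def fun_eq_iff\<close>)

  obtain T c where Tc: "\<And>j. j \<in> J \<Longrightarrow> finite (T j) \<and> T j \<subseteq> carrier D \<and>
      (\<forall>g\<in>carrier G. \<kappa> (\<eta> g) j = (\<Sum>\<xi>\<in>T j. c j \<xi> * ev g \<xi>))"
    using functional_trig_poly[OF \<kappa>j] by metis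
  \<comment> \<open>In coordinate \<open>j\<close> the map \<eta> is a trigonometric polynomial in
    \<open>g\<close>. Substituting an arbitrary \<phi> for \<open>ev g\<close> and returning through
    the chart extends \<eta> to a linear map on \<open>P\<close>.\<close>
  define s where "s \<phi> = \<iota> (\<lambda>j\<in>J. \<Sum>\<xi>\<in>T j. c j \<xi> * \<phi> \<xi>)" for \<phi>
  have "(\<lambda>\<phi>. \<lambda>j\<in>J. \<Sum>\<xi>\<in>T j. c j \<xi> * \<phi> \<xi>) \<in> continuous_linear P (complex_power J)"
    by (rule continuous_linear_into_power[OF tvs_complex_power])
      (use Tc in \<open>auto intro!: continuous_linear_sum coordinate_continuous_linear\<close>)
  from continuous_linear_compose[OF this \<iota>] have s: "s \<in> continuous_linear P A" by (simp add: s_def[abs_def])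
  have sc: "s \<phi> \<in> carrier A" if "\<phi> \<in> extensional (carrier D)" for \<phi> using continuous_linearD(3)[OF s] that by simp
  have s_ev: "s (ev g) = \<eta> g" if g: "g \<in> carrier G" for g
  proof -
    have "(\<lambda>j\<in>J. \<Sum>\<xi>\<in>T j. c j \<xi> * ev g \<xi>) = \<kappa> (\<eta> g)"
      by (rule extensionalityI[of _ J]) (use Tc g \<kappa>c[OF \<eta>_closed[OF g]] in auto)
    then show ?thesis using \<iota>\<kappa>[OF \<eta>_closed[OF g]] by (simp add: s_def)
  qed
  have \<pi>s: "\<pi> (s \<phi>) = \<phi>" if \<phi>: "\<phi> \<in> extensional (carrier D)" for \<phi>
  proof (rule extensionalityI[OF _ \<phi>])
    show "\<pi> (s \<phi>) \<in> extensional (carrier D)" by (simp add: \<pi>_def)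
    fix \<xi> assume \<xi>: "\<xi> \<in> carrier D"
    have 1: "(\<lambda>\<phi>. \<pi> (s \<phi>) \<xi>) \<in> continuous_linear P complex_algebra"
      using continuous_linear_compose[OF continuous_linear_compose[OF s \<pi>] coordinate_continuous_linear[OF \<xi>]] by simp
    show "\<pi> (s \<phi>) \<xi> = \<phi> \<xi>"
      by (rule functional_eq_on_ev[OF 1 coordinate_continuous_linear[OF \<xi>] _ \<phi>]) (simp add: s_ev \<pi>_ev)
  qed
  have bilP: "(\<lambda>x y. x \<otimes>\<^bsub>P\<^esub> y) \<in> continuous_bilinear P P P"
    using weakly_complete_algebra_complex_power unfolding weakly_complete_algebra_def by blast
  \<comment> \<open>On evaluations this is multiplicativity of \<eta>. Both sides are continuous and
    linear in each variable, so the identity is extended first in \<phi>, with an evaluation in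
    second place, and then in \<psi>.\<close>
  have s_mult: "s (\<phi> \<otimes>\<^bsub>P\<^esub> \<psi>) = s \<phi> \<otimes>\<^bsub>A\<^esub> s \<psi>"
    if \<phi>: "\<phi> \<in> extensional (carrier D)" and \<psi>: "\<psi> \<in> extensional (carrier D)" for \<phi> \<psi>
  proof (rule A_eq)
    show "s (\<phi> \<otimes>\<^bsub>P\<^esub> \<psi>) \<in> carrier A" "s \<phi> \<otimes>\<^bsub>A\<^esub> s \<psi> \<in> carrier A" using sc \<phi> \<psi> by auto
    fix j assume j: "j \<in> J"
    have L1: "(\<lambda>\<phi>. \<kappa> (s (\<phi> \<otimes>\<^bsub>P\<^esub> \<psi>)) j) \<in> continuous_linear P complex_algebra" if "\<psi> \<in> extensional (carrier D)" for \<psi>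
      by (rule continuous_linear_compose[OF continuous_linear_compose[OF bilinear_section(2)[OF bilP topspace_P topspace_P] s] \<kappa>j[OF j]])
        (use that in simp)
    have L2: "(\<lambda>\<psi>. \<kappa> (s (\<phi> \<otimes>\<^bsub>P\<^esub> \<psi>)) j) \<in> continuous_linear P complex_algebra"
      by (rule continuous_linear_compose[OF continuous_linear_compose[OF bilinear_section(1)[OF bilP topspace_P topspace_P] s] \<kappa>j[OF j]])
        (use \<phi> in simp)
    have R1: "(\<lambda>\<phi>. \<kappa> (s \<phi> \<otimes>\<^bsub>A\<^esub> s \<psi>) j) \<in> continuous_linear P complex_algebra" if "\<psi> \<in> extensional (carrier D)" for \<psi>
      by (rule continuous_linear_compose[OF continuous_linear_compose[OF s bilinear_section(2)[OF bilA tA tA]] \<kappa>j[OF j]])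
        (rule sc[OF that])
    have R2: "(\<lambda>\<psi>. \<kappa> (s \<phi> \<otimes>\<^bsub>A\<^esub> s \<psi>) j) \<in> continuous_linear P complex_algebra"
      by (rule continuous_linear_compose[OF continuous_linear_compose[OF s bilinear_section(1)[OF bilA tA tA]] \<kappa>j[OF j]])
        (rule sc[OF \<phi>])
    have ev_ev: "\<kappa> (s (ev g \<otimes>\<^bsub>P\<^esub> ev h)) j = \<kappa> (s (ev g) \<otimes>\<^bsub>A\<^esub> s (ev h)) j" if "g \<in> carrier G" "h \<in> carrier G" for g h
    proof -
      have "ev g \<otimes>\<^bsub>P\<^esub> ev h = ev (g \<otimes> h)" using ev_mult[OF that] by simp
      then show ?thesis using that by (simp only: s_ev \<eta>_mult m_closed)
    qed
    have "\<kappa> (s (\<phi> \<otimes>\<^bsub>P\<^esub> ev h)) j = \<kappa> (s \<phi> \<otimes>\<^bsub>A\<^esub> s (ev h)) j" if h: "h \<in> carrier G" for h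
      by (rule functional_eq_on_ev[OF L1[OF ev_ext] R1[OF ev_ext] ev_ev[OF _ h] \<phi>])
    then show "\<kappa> (s (\<phi> \<otimes>\<^bsub>P\<^esub> \<psi>)) j = \<kappa> (s \<phi> \<otimes>\<^bsub>A\<^esub> s \<psi>) j"
      by (rule functional_eq_on_ev[OF L2 R2 _ \<psi>])
  qed
  have s_one: "s \<one>\<^bsub>P\<^esub> = \<one>\<^bsub>A\<^esub>" using s_ev[OF one_closed] \<eta>_one by (simp only: ev_one)

  \<comment> \<open>The algebra structure of \<open>A\<close> moved along the chart. Elements of
    \<open>A\<close> have type \<open>'a\<close>, which is not the type of a test algebra, whereas
    \<open>B\<close> consists of functions on a set of type \<open>'a\<close>.\<close>
  define B where "B = (complex_power J)\<lparr>monoid.mult := (\<lambda>x y. \<kappa> (\<iota> x \<otimes>\<^bsub>A\<^esub> \<iota> y)), one := \<kappa> \<one>\<^bsub>A\<^esub>\<rparr>"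
  have B: "carrier B = extensional J" "x \<otimes>\<^bsub>B\<^esub> y = \<kappa> (\<iota> x \<otimes>\<^bsub>A\<^esub> \<iota> y)" "\<one>\<^bsub>B\<^esub> = \<kappa> \<one>\<^bsub>A\<^esub>"
    "ring.zero B = ring.zero (complex_power J)" "ring.add B = ring.add (complex_power J)"
    "smult B = smult (complex_power J)" "vtop B = vtop (complex_power J)" for x y
    by (simp_all add: B_def)
  have tvsB: "topological_vector_space B"
    by (rule tvs_cong[OF _ B(4-7) tvs_complex_power]) (simp add: B)
  have lin_cong: "linear_maps V B = linear_maps V (complex_power J)" "linear_maps B V = linear_maps (complex_power J) V" for V :: "'z top_algebra"
    by (auto simp: linear_maps_iff B)
  have \<kappa>_add: "\<kappa> (v \<oplus>\<^bsub>A\<^esub> w) = \<kappa> v \<oplus>\<^bsub>B\<^esub> \<kappa> w" if "v \<in> carrier A" "w \<in> carrier A" for v w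
    using continuous_linearD(4)[OF \<kappa> that] by (simp add: B)
  have \<iota>_add: "\<iota> (v \<oplus>\<^bsub>B\<^esub> w) = \<iota> v \<oplus>\<^bsub>A\<^esub> \<iota> w" if "v \<in> extensional J" "w \<in> extensional J" for v w
    using continuous_linearD(4)[OF \<iota>, of v w] that by (simp add: B)
  have wcB: "weakly_complete_algebra B"
    unfolding weakly_complete_algebra_def
  proof (intro conjI)
    show "weakly_complete_space B"
      using weakly_complete_complex_power[of J] tvsB
      unfolding weakly_complete_space_def top_linear_iso_def lin_cong B(7) by blast
    have "Group.monoid B"
      by (rule monoidI) (auto simp: B \<iota>\<kappa> \<kappa>\<iota> \<kappa>c \<iota>c A.m_assoc)
    then show "Ring.ring B"
      by (rule ringI[OF tvsD(3)[OF tvsB]])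
        (simp_all only: B(1,2) \<iota>_add \<kappa>_add \<iota>c A.m_closed A.l_distr A.r_distr)
    have "(\<lambda>x y. \<kappa> (\<iota> x \<otimes>\<^bsub>A\<^esub> \<iota> y)) \<in> continuous_bilinear (complex_power J) (complex_power J) (complex_power J)"
      by (rule bilinear_compose[OF bilA \<iota> \<iota> \<kappa>])
    then show "(\<lambda>x y. x \<otimes>\<^bsub>B\<^esub> y) \<in> continuous_bilinear B B B"
      unfolding continuous_bilinear_def lin_cong B by simp
  qed
  define f where "f g = \<kappa> (\<eta> g)" for g
  have "f \<in> hom G (unit_group B)"
    unfolding hom_def
  proof (intro CollectI conjI ballI)
    show "f \<in> carrier G \<rightarrow> carrier (unit_group B)"
    proof
      fix g assume g: "g \<in> carrier G"
      obtain v where v: "v \<in> carrier A" "v \<otimes>\<^bsub>A\<^esub> \<eta> g = \<one>\<^bsub>A\<^esub>" "\<eta> g \<otimes>\<^bsub>A\<^esub> v = \<one>\<^bsub>A\<^esub>"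
        using \<eta>_Units[OF g] by (auto simp: Units_def)
      then have "f g \<in> Units B"
        unfolding Units_def using g \<eta>_closed[OF g]
        by (auto simp: f_def B \<kappa>c \<iota>\<kappa> intro!: bexI[of _ "\<kappa> v"])
      then show "f g \<in> carrier (unit_group B)" by (simp add: unit_group_def)
    qed
    show "f (g \<otimes> h) = f g \<otimes>\<^bsub>unit_group B\<^esub> f h" if "g \<in> carrier G" "h \<in> carrier G" for g h
      using that by (simp add: unit_group_def f_def B \<iota>\<kappa> \<eta>_closed \<eta>_mult)
  qed
  moreover have "continuous_map X (vtop B) f"
    using continuous_map_compose[OF \<eta>_cont continuous_linearD(2)[OF \<kappa>]] by (simp add: o_def f_def[abs_def] B)
  ultimately have fB: "f \<in> continuous_hom G (unit_group B)"
    by (auto simp: continuous_hom_def continuous_map_in_subtopology unit_group_def hom_def)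
  have alg: "(\<lambda>a\<in>carrier A. \<kappa> (k a)) \<in> algebra_hom A B"
    if k: "k \<in> continuous_linear A A" "k \<in> ring_hom A A" for k
  proof -
    have "(\<lambda>a. \<kappa> (k a)) \<in> continuous_linear A (complex_power J)"
      using continuous_linear_compose[OF k(1) \<kappa>] .
    then have "(\<lambda>a\<in>carrier A. \<kappa> (k a)) \<in> continuous_linear A (complex_power J)"
      by (rule continuous_linear_cong[OF _ tvsA]) simp
    then have "(\<lambda>a\<in>carrier A. \<kappa> (k a)) \<in> continuous_linear A B"
      unfolding continuous_linear_def lin_cong B(7) .
    moreover have "(\<lambda>a\<in>carrier A. \<kappa> (k a)) \<in> ring_hom A B"
    proof (rule ring_hom_memI)
      note kc = ring_hom_closed[OF k(2)]
      show "(\<lambda>a\<in>carrier A. \<kappa> (k a)) x \<in> carrier B" if "x \<in> carrier A" for x using that kc \<kappa>c by (simp add: B)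
      show "(\<lambda>a\<in>carrier A. \<kappa> (k a)) (x \<otimes>\<^bsub>A\<^esub> y) = (\<lambda>a\<in>carrier A. \<kappa> (k a)) x \<otimes>\<^bsub>B\<^esub> (\<lambda>a\<in>carrier A. \<kappa> (k a)) y"
        if "x \<in> carrier A" "y \<in> carrier A" for x y using that kc ring_hom_mult[OF k(2)] \<iota>\<kappa> by (simp add: B(2))
      show "(\<lambda>a\<in>carrier A. \<kappa> (k a)) (x \<oplus>\<^bsub>A\<^esub> y) = (\<lambda>a\<in>carrier A. \<kappa> (k a)) x \<oplus>\<^bsub>B\<^esub> (\<lambda>a\<in>carrier A. \<kappa> (k a)) y"
        if "x \<in> carrier A" "y \<in> carrier A" for x y
        using that kc ring_hom_add[OF k(2)] \<kappa>_add[of "k x" "k y"] by simp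
      show "(\<lambda>a\<in>carrier A. \<kappa> (k a)) \<one>\<^bsub>A\<^esub> = \<one>\<^bsub>B\<^esub>" using ring_hom_one[OF k(2)] by (simp add: B)
    qed
    ultimately show ?thesis by (simp add: algebra_hom_def)
  qed
  have id: "(\<lambda>a. a) \<in> continuous_linear A A" "(\<lambda>a. a) \<in> ring_hom A A"
    by (auto intro!: continuous_linearI ring_hom_memI)
  have s\<pi>c: "(\<lambda>a. s (\<pi> a)) \<in> continuous_linear A A" using continuous_linear_compose[OF \<pi> s] .
  have \<pi>c: "\<pi> a \<in> extensional (carrier D)" for a by (simp add: \<pi>_def)
  have s\<pi>r: "(\<lambda>a. s (\<pi> a)) \<in> ring_hom A A"
  proof (rule ring_hom_memI)
    show "s (\<pi> (x \<otimes>\<^bsub>A\<^esub> y)) = s (\<pi> x) \<otimes>\<^bsub>A\<^esub> s (\<pi> y)" if "x \<in> carrier A" "y \<in> carrier A" for x y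
      using ring_hom_mult[OF \<pi>_ring that] s_mult[OF \<pi>c \<pi>c] by (simp only:)
    show "s (\<pi> \<one>\<^bsub>A\<^esub>) = \<one>\<^bsub>A\<^esub>" using ring_hom_one[OF \<pi>_ring] s_one by (simp only:)
  qed (use continuous_linearD(3,4)[OF s\<pi>c] in auto)
  \<comment> \<open>Both maps extend \<open>f\<close>, so uniqueness identifies the transported
    copies of the composite \<open>s (\<pi> a)\<close> and of the identity.\<close>
  have eq: "(\<lambda>a\<in>carrier A. \<kappa> (s (\<pi> a))) = (\<lambda>a\<in>carrier A. \<kappa> a)"
    by (rule universal_unique[OF wcB fB alg[OF s\<pi>c s\<pi>r] _ _ alg[OF id]])
      (auto simp: \<eta>_closed \<pi>_ev s_ev f_def)
  have s\<pi>: "s (\<pi> a) = a" if a: "a \<in> carrier A" for a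
  proof -
    have "\<kappa> (s (\<pi> a)) = \<kappa> a" using fun_cong[OF eq, of a] a by simp
    then show ?thesis using \<iota>\<kappa>[OF a] \<iota>\<kappa>[OF sc[OF \<pi>c]] by metis
  qed
  have "\<pi> \<in> top_linear_iso A P"
  proof (rule top_linear_isoI[OF \<pi> s tA topspace_P])
    show "s (\<pi> v) = v" if "v \<in> carrier A" for v using s\<pi>[OF that] .
    show "\<pi> (s w) = w" if "w \<in> carrier P" for w using \<pi>s that by simp
  qed
  then have "\<pi> \<in> top_algebra_iso A P" using \<pi>_ring by (simp add: top_algebra_iso_def)
  then show ?thesis using that \<pi>_ev by blast
qed

end

section \<open>Tensor products of powers of \<open>\<complex>\<close>\<close>

lemma continuous_bilinear_complex_mult:
  "(\<lambda>x y. x * y) \<in> continuous_bilinear complex_algebra complex_algebra complex_algebra"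
proof -
  have "continuous_map (prod_topology euclidean euclidean) euclidean (\<lambda>z. fst z * snd z :: complex)"
    by (intro continuous_map_complex_mult continuous_map_fst continuous_map_snd)
  then show ?thesis
    by (auto simp: continuous_bilinear_def linear_maps_iff algebra_simps case_prod_beta')
qed

text \<open>The unit vectors span a dense subspace, again in dual form through finite
  support.\<close>

lemma functional_eq_on_delta:
  assumes f: "f \<in> continuous_linear (complex_power J) complex_algebra"
    and h: "h \<in> continuous_linear (complex_power J) complex_algebra"
    and eq: "\<And>j. j \<in> J \<Longrightarrow> f (delta J j) = h (delta J j)" and \<phi>: "\<phi> \<in> extensional J"
  shows "f \<phi> = h \<phi>"
proof -
  define d where "d v = f v - h v" for v
  have "d \<in> continuous_linear (complex_power J) complex_algebra"
    using continuous_linear_diff[OF f h] by (simp add: d_def[abs_def])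
  then obtain S where S: "finite S" "S \<subseteq> J"
    "\<And>\<phi>. \<phi> \<in> extensional J \<Longrightarrow> d \<phi> = (\<Sum>j\<in>S. d (delta J j) * \<phi> j)"
    using functional_finite_support[of d J] by blast
  have "(\<Sum>j\<in>S. d (delta J j) * \<phi> j) = 0"
    by (rule sum.neutral) (use S(2) eq in \<open>auto simp: d_def\<close>)
  then show ?thesis using S(3)[OF \<phi>] by (simp add: d_def)
qed

text \<open>The scheme of \<open>group_algebra_iso\<close> with unit vectors in the role of the
  group elements: scalar bilinear maps extend to \<open>E\<close> and assemble to \<Psi>, finite
  support of the coordinates of \<open>t\<close> gives the right inverse \<open>s\<close>, and
  uniqueness makes it two-sided. Only linear maps are involved, so the target of the chart is itself
  an admissible test space.\<close>

lemma tensor_product_complex_power: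
  fixes E :: "'e top_algebra"
  assumes T: "tensor_product V W E t"
    and V: "topological_vector_space V" and W: "topological_vector_space W"
    and \<Phi>: "\<Phi> \<in> top_linear_iso V (complex_power I)" and \<Omega>: "\<Omega> \<in> top_linear_iso W (complex_power K)"
  obtains \<Psi> where "\<Psi> \<in> top_linear_iso E (complex_power (I \<times> K))"
    "\<And>v w i k. v \<in> carrier V \<Longrightarrow> w \<in> carrier W \<Longrightarrow> i \<in> I \<Longrightarrow> k \<in> K \<Longrightarrow> \<Psi> (t v w) (i, k) = \<Phi> v i * \<Omega> w k"
proof -
  have wsE: "weakly_complete_space E" and t: "t \<in> continuous_bilinear V W E"
    using T by (auto simp: tensor_product_def)
  have universal: "\<exists>!L. L \<in> continuous_linear E U \<and> L \<in> extensional (carrier E) \<and>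
      (\<forall>v\<in>carrier V. \<forall>w\<in>carrier W. L (t v w) = b v w)"
    if "weakly_complete_space U" "b \<in> continuous_bilinear V W U" for U :: "('e \<Rightarrow> complex) top_algebra" and b
    using T that unfolding tensor_product_def by blast
  note tvsE = weakly_complete_tvs[OF wsE]
  have tc: "t v w \<in> carrier E" if "v \<in> carrier V" "w \<in> carrier W" for v w
    using t that by (auto simp: continuous_bilinear_def linear_maps_iff)
  note \<Phi>L = top_linear_iso_continuous[OF \<Phi>] and \<Omega>L = top_linear_iso_continuous[OF \<Omega>]
  obtain \<Phi>' where \<Phi>': "\<Phi>' \<in> continuous_linear (complex_power I) V"
    "\<And>v. v \<in> carrier V \<Longrightarrow> \<Phi>' (\<Phi> v) = v" "\<And>w. w \<in> carrier (complex_power I) \<Longrightarrow> \<Phi> (\<Phi>' w) = w"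
    using top_linear_iso_inverse[OF \<Phi> V tvs_complex_power] by blast
  obtain \<Omega>' where \<Omega>': "\<Omega>' \<in> continuous_linear (complex_power K) W"
    "\<And>v. v \<in> carrier W \<Longrightarrow> \<Omega>' (\<Omega> v) = v" "\<And>w. w \<in> carrier (complex_power K) \<Longrightarrow> \<Omega> (\<Omega>' w) = w"
    using top_linear_iso_inverse[OF \<Omega> W tvs_complex_power] by blast

  have "\<exists>L. L \<in> continuous_linear E complex_algebra \<and>
      (\<forall>v\<in>carrier V. \<forall>w\<in>carrier W. L (t v w) = \<Phi> v (fst p) * \<Omega> w (snd p))" if p: "p \<in> I \<times> K" for p
  proof -
    \<comment> \<open>One point of the type of \<open>E\<close>, so that the power over it is a copy
      of \<complex> among the test spaces.\<close>
    define u :: 'e where "u = undefined"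
    have "(\<lambda>z. \<lambda>_\<in>{u}. z) \<in> continuous_linear complex_algebra (complex_power {u})"
      by (rule continuous_linearI) (auto simp: fun_eq_iff continuous_map_componentwise)
    moreover have "(\<lambda>v. \<Phi> v (fst p)) \<in> continuous_linear V complex_algebra"
      by (rule continuous_linear_compose[OF \<Phi>L coordinate_continuous_linear]) (use p in auto)
    moreover have "(\<lambda>w. \<Omega> w (snd p)) \<in> continuous_linear W complex_algebra"
      by (rule continuous_linear_compose[OF \<Omega>L coordinate_continuous_linear]) (use p in auto)
    ultimately have "(\<lambda>v w. \<lambda>_\<in>{u}. \<Phi> v (fst p) * \<Omega> w (snd p)) \<in> continuous_bilinear V W (complex_power {u})"
      using bilinear_compose[OF continuous_bilinear_complex_mult] by blast
    from universal[OF weakly_complete_complex_power this] obtain L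
      where L: "L \<in> continuous_linear E (complex_power {u})"
        "\<And>v w. v \<in> carrier V \<Longrightarrow> w \<in> carrier W \<Longrightarrow> L (t v w) = (\<lambda>_\<in>{u}. \<Phi> v (fst p) * \<Omega> w (snd p))"
      by blast
    have "(\<lambda>e. L e u) \<in> continuous_linear E complex_algebra"
      using continuous_linear_compose[OF L(1) coordinate_continuous_linear[of u "{u}"]] by simp
    then show ?thesis using L(2) by (intro exI[of _ "\<lambda>e. L e u"]) simp
  qed
  then have "\<forall>p\<in>I \<times> K. \<exists>L. L \<in> continuous_linear E complex_algebra \<and>
      (\<forall>v\<in>carrier V. \<forall>w\<in>carrier W. L (t v w) = \<Phi> v (fst p) * \<Omega> w (snd p))" by blast
  from bchoice[OF this] obtain L where L0: "\<forall>p\<in>I \<times> K. L p \<in> continuous_linear E complex_algebra \<and>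
      (\<forall>v\<in>carrier V. \<forall>w\<in>carrier W. L p (t v w) = \<Phi> v (fst p) * \<Omega> w (snd p))" ..
  have L: "L p \<in> continuous_linear E complex_algebra" if "p \<in> I \<times> K" for p
    using L0 that by blast
  have Lt: "L p (t v w) = \<Phi> v (fst p) * \<Omega> w (snd p)" if "p \<in> I \<times> K" "v \<in> carrier V" "w \<in> carrier W" for p v w
    using L0 that by blast
  define \<Psi> where "\<Psi> e = (\<lambda>p\<in>I \<times> K. L p e)" for e
  have \<Psi>: "\<Psi> \<in> continuous_linear E (complex_power (I \<times> K))"
    by (rule continuous_linear_into_power[OF tvsE]) (use L in \<open>auto simp: \<Psi>_def\<close>)
  define tens where "tens \<phi> \<psi> = (\<lambda>p\<in>I \<times> K. \<phi> (fst p) * \<psi> (snd p) :: complex)" for \<phi> \<psi>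
  have \<Psi>t: "\<Psi> (t v w) = tens (\<Phi> v) (\<Omega> w)" if "v \<in> carrier V" "w \<in> carrier W" for v w
    using Lt that by (auto simp: \<Psi>_def tens_def fun_eq_iff)

  obtain J :: "'e set" and \<kappa> \<iota> where \<kappa>: "\<kappa> \<in> continuous_linear E (complex_power J)"
    and \<iota>: "\<iota> \<in> continuous_linear (complex_power J) E"
    and \<iota>\<kappa>: "\<And>v. v \<in> carrier E \<Longrightarrow> \<iota> (\<kappa> v) = v"
    using weakly_complete_chart[OF wsE] by metis
  have "\<exists>S c. finite S \<and> S \<subseteq> I \<times> K \<and> (\<forall>\<phi>\<in>extensional I. \<forall>\<psi>\<in>extensional K.
      \<kappa> (t (\<Phi>' \<phi>) (\<Omega>' \<psi>)) j = (\<Sum>p\<in>S. c p * tens \<phi> \<psi> p))" if j: "j \<in> J" for j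
  proof -
    define b where "b \<phi> \<psi> = \<kappa> (t (\<Phi>' \<phi>) (\<Omega>' \<psi>)) j" for \<phi> \<psi>
    have "(\<lambda>e. \<kappa> e j) \<in> continuous_linear E complex_algebra"
      using continuous_linear_compose[OF \<kappa> coordinate_continuous_linear[OF j]] by simp
    from bilinear_compose[OF t \<Phi>'(1) \<Omega>'(1) this]
    have "b \<in> continuous_bilinear (complex_power I) (complex_power K) complex_algebra" by (simp add: b_def[abs_def])
    from bilinear_finite_support[OF this] obtain S R where S: "finite S" "S \<subseteq> I" "finite R" "R \<subseteq> K"
      "\<And>\<phi> \<psi>. \<phi> \<in> extensional I \<Longrightarrow> \<psi> \<in> extensional K \<Longrightarrow>
         b \<phi> \<psi> = (\<Sum>i\<in>S. \<Sum>k\<in>R. b (delta I i) (delta K k) * (\<phi> i * \<psi> k))" by blast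
    define c where "c p = b (delta I (fst p)) (delta K (snd p))" for p
    have "b \<phi> \<psi> = (\<Sum>p\<in>S \<times> R. c p * tens \<phi> \<psi> p)" if "\<phi> \<in> extensional I" "\<psi> \<in> extensional K" for \<phi> \<psi>
      unfolding S(5)[OF that] sum.cartesian_product
      by (rule sum.cong) (use S in \<open>auto simp: c_def tens_def\<close>)
    moreover have "finite (S \<times> R)" "S \<times> R \<subseteq> I \<times> K" using S by auto
    ultimately show ?thesis unfolding b_def by blast
  qed
  then have "\<forall>j\<in>J. \<exists>S c. finite S \<and> S \<subseteq> I \<times> K \<and> (\<forall>\<phi>\<in>extensional I. \<forall>\<psi>\<in>extensional K.
      \<kappa> (t (\<Phi>' \<phi>) (\<Omega>' \<psi>)) j = (\<Sum>p\<in>S. c p * tens \<phi> \<psi> p))" by blast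
  from bchoice[OF this] obtain S where "\<forall>j\<in>J. \<exists>c. finite (S j) \<and> S j \<subseteq> I \<times> K \<and> (\<forall>\<phi>\<in>extensional I. \<forall>\<psi>\<in>extensional K.
      \<kappa> (t (\<Phi>' \<phi>) (\<Omega>' \<psi>)) j = (\<Sum>p\<in>S j. c p * tens \<phi> \<psi> p))" ..
  from bchoice[OF this] obtain c where Sc0: "\<forall>j\<in>J. finite (S j) \<and> S j \<subseteq> I \<times> K \<and> (\<forall>\<phi>\<in>extensional I. \<forall>\<psi>\<in>extensional K.
      \<kappa> (t (\<Phi>' \<phi>) (\<Omega>' \<psi>)) j = (\<Sum>p\<in>S j. c j p * tens \<phi> \<psi> p))" ..
  have Sc: "finite (S j) \<and> S j \<subseteq> I \<times> K" if "j \<in> J" for j using Sc0 that by blast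
  have Sc_sum: "\<kappa> (t (\<Phi>' \<phi>) (\<Omega>' \<psi>)) j = (\<Sum>p\<in>S j. c j p * tens \<phi> \<psi> p)"
    if "j \<in> J" "\<phi> \<in> extensional I" "\<psi> \<in> extensional K" for j \<phi> \<psi> using Sc0 that by blast
  \<comment> \<open>In coordinate \<open>j\<close> the map \<open>t\<close> is a finite combination
    of entries of the elementary tensor; \<open>s\<close> applies the same combination to an
    arbitrary \<open>F\<close>.\<close>
  define s where "s F = \<iota> (\<lambda>j\<in>J. \<Sum>p\<in>S j. c j p * F p)" for F
  have "(\<lambda>F. \<lambda>j\<in>J. \<Sum>p\<in>S j. c j p * F p) \<in> continuous_linear (complex_power (I \<times> K)) (complex_power J)"
    by (rule continuous_linear_into_power[OF tvs_complex_power])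
      (use Sc in \<open>auto intro!: continuous_linear_sum coordinate_continuous_linear\<close>)
  from continuous_linear_compose[OF this \<iota>] have s: "s \<in> continuous_linear (complex_power (I \<times> K)) E"
    by (simp add: s_def[abs_def])
  have s_tens: "s (tens \<phi> \<psi>) = t (\<Phi>' \<phi>) (\<Omega>' \<psi>)" if \<phi>: "\<phi> \<in> extensional I" and \<psi>: "\<psi> \<in> extensional K" for \<phi> \<psi>
  proof -
    have c: "t (\<Phi>' \<phi>) (\<Omega>' \<psi>) \<in> carrier E"
      using tc continuous_linearD(3)[OF \<Phi>'(1)] continuous_linearD(3)[OF \<Omega>'(1)] \<phi> \<psi> by simp
    have "(\<lambda>j\<in>J. \<Sum>p\<in>S j. c j p * tens \<phi> \<psi> p) = \<kappa> (t (\<Phi>' \<phi>) (\<Omega>' \<psi>))"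
      by (rule extensionalityI[of _ J]) (use continuous_linearD(3)[OF \<kappa> c] Sc_sum \<phi> \<psi> in auto)
    then show ?thesis using \<iota>\<kappa>[OF c] by (simp add: s_def)
  qed
  have s\<Psi>t: "s (\<Psi> (t v w)) = t v w" if v: "v \<in> carrier V" and w: "w \<in> carrier W" for v w
    using s_tens[of "\<Phi> v" "\<Omega> w"] \<Phi>'(2)[OF v] \<Omega>'(2)[OF w] \<Psi>t[OF v w]
      continuous_linearD(3)[OF \<Phi>L v] continuous_linearD(3)[OF \<Omega>L w] by simp
  have s\<Psi>: "s (\<Psi> e) = e" if e: "e \<in> carrier E" for e
  proof -
    have "(\<lambda>v w. \<kappa> (t v w)) \<in> continuous_bilinear V W (complex_power J)"
    proof -
      have "(\<lambda>v. v) \<in> continuous_linear V V" "(\<lambda>v. v) \<in> continuous_linear W W" by (auto intro!: continuous_linearI)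
      from bilinear_compose[OF t this \<kappa>] show ?thesis .
    qed
    from universal[OF weakly_complete_complex_power this]
    have uniq: "L1 = L2" if "L1 \<in> continuous_linear E (complex_power J)" "L1 \<in> extensional (carrier E)"
      "\<forall>v\<in>carrier V. \<forall>w\<in>carrier W. L1 (t v w) = \<kappa> (t v w)"
      "L2 \<in> continuous_linear E (complex_power J)" "L2 \<in> extensional (carrier E)"
      "\<forall>v\<in>carrier V. \<forall>w\<in>carrier W. L2 (t v w) = \<kappa> (t v w)" for L1 L2 using that by blast
    have "(\<lambda>e\<in>carrier E. \<kappa> (s (\<Psi> e))) = (\<lambda>e\<in>carrier E. \<kappa> e)"
    proof (rule uniq)
      show "(\<lambda>e\<in>carrier E. \<kappa> (s (\<Psi> e))) \<in> continuous_linear E (complex_power J)"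
        by (rule continuous_linear_cong[OF continuous_linear_compose[OF continuous_linear_compose[OF \<Psi> s] \<kappa>] tvsE]) simp
      show "(\<lambda>e\<in>carrier E. \<kappa> e) \<in> continuous_linear E (complex_power J)"
        by (rule continuous_linear_cong[OF \<kappa> tvsE]) simp
    qed (use tc s\<Psi>t in auto)
    then have "\<kappa> (s (\<Psi> e)) = \<kappa> e" using e by (metis restrict_apply')
    moreover have "s (\<Psi> e) \<in> carrier E"
      using continuous_linearD(3)[OF continuous_linear_compose[OF \<Psi> s] e] .
    ultimately show ?thesis using \<iota>\<kappa> e by metis
  qed
  have \<Psi>s: "\<Psi> (s F) = F" if F: "F \<in> extensional (I \<times> K)" for F
  proof (rule extensionalityI[OF _ F])
    show "\<Psi> (s F) \<in> extensional (I \<times> K)" by (simp add: \<Psi>_def)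
    fix p assume p: "p \<in> I \<times> K"
    have 1: "(\<lambda>F. \<Psi> (s F) p) \<in> continuous_linear (complex_power (I \<times> K)) complex_algebra"
      using continuous_linear_compose[OF continuous_linear_compose[OF s \<Psi>] coordinate_continuous_linear[OF p]] by simp
    show "\<Psi> (s F) p = F p"
    proof (rule functional_eq_on_delta[OF 1 coordinate_continuous_linear[OF p] _ F])
      fix q assume q: "q \<in> I \<times> K"
      \<comment> \<open>A unit vector of the product is an elementary tensor of unit vectors, where
        the identity is already known.\<close>
      have "delta (I \<times> K) q = tens (delta I (fst q)) (delta K (snd q))"
        using q by (auto simp: delta_def tens_def fun_eq_iff)
      moreover have "\<Psi> (s (tens (delta I (fst q)) (delta K (snd q)))) = tens (delta I (fst q)) (delta K (snd q))"
        using \<Psi>t[of "\<Phi>' (delta I (fst q))" "\<Omega>' (delta K (snd q))"] s_tens[of "delta I (fst q)" "delta K (snd q)"]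
          \<Phi>'(3)[of "delta I (fst q)"] \<Omega>'(3)[of "delta K (snd q)"]
          continuous_linearD(3)[OF \<Phi>'(1), of "delta I (fst q)"] continuous_linearD(3)[OF \<Omega>'(1), of "delta K (snd q)"] by simp
      ultimately show "\<Psi> (s (delta (I \<times> K) q)) p = delta (I \<times> K) q p" by simp
    qed
  qed
  have "\<Psi> \<in> top_linear_iso E (complex_power (I \<times> K))"
  proof (rule top_linear_isoI[OF \<Psi> s tvsD(2)[OF tvsE] tvsD(2)[OF tvs_complex_power]])
    show "s (\<Psi> v) = v" if "v \<in> carrier E" for v using s\<Psi>[OF that] .
    show "\<Psi> (s w) = w" if "w \<in> carrier (complex_power (I \<times> K))" for w using \<Psi>s that by simp
  qed
  moreover have "\<Psi> (t v w) (i, k) = \<Phi> v i * \<Omega> w k"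
    if "v \<in> carrier V" "w \<in> carrier W" "i \<in> I" "k \<in> K" for v w i k
    using \<Psi>t[OF that(1,2)] that by (simp add: tens_def)
  ultimately show ?thesis using that by blast
qed

section \<open>Additive homomorphisms into \<open>\<complex>\<close>\<close>

text \<open>A maximal linearly independent set of evaluation functionals on \<open>Hom(D, \<complex>)\<close> provides
  coordinates. Linear relations between evaluations, such as additivity, carry over from
  homomorphisms to arbitrary coordinate vectors, so every coordinate vector is attained.\<close>

lemma additive_hom_coordinates:
  assumes closed: "\<And>x y. x \<in> carrier D \<Longrightarrow> y \<in> carrier D \<Longrightarrow> x \<otimes>\<^bsub>D\<^esub> y \<in> carrier D"
  obtains Y T r where "Y \<subseteq> carrier D" "\<And>x. x \<in> carrier D \<Longrightarrow> finite (T x)" "\<And>x. x \<in> carrier D \<Longrightarrow> T x \<subseteq> Y"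
    "\<And>h x. h \<in> carrier (hom_group D complex_additive) \<Longrightarrow> x \<in> carrier D \<Longrightarrow> h x = (\<Sum>y\<in>T x. r x y * h y)"
    "\<And>\<psi>. (\<lambda>x\<in>carrier D. \<Sum>y\<in>T x. r x y * \<psi> y) \<in> carrier (hom_group D complex_additive)"
    "\<And>\<psi> y. y \<in> Y \<Longrightarrow> (\<Sum>z\<in>T y. r y z * \<psi> z) = (\<psi> y :: complex)"
proof -
  define H where "H = carrier (hom_group D complex_additive)"
  \<comment> \<open>Evaluation at \<open>x\<close> as a vector in the space of complex functions;
    the value 0 off \<open>H\<close> makes relations on \<open>H\<close> relations between
    functions.\<close>
  define e where "e x = (\<lambda>h. if h \<in> H then h x else 0 :: complex)" for x
  obtain B where B: "B \<subseteq> e ` carrier D" "fun_vs.independent B" "e ` carrier D \<subseteq> fun_vs.span B"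
    using fun_vs.maximal_independent_subset by blast
  define Y where "Y = inv_into (carrier D) e ` B"
  have Y: "Y \<subseteq> carrier D" using B(1) by (auto simp: Y_def inv_into_into)
  have e_inv: "e (inv_into (carrier D) e \<beta>) = \<beta>" if "\<beta> \<in> B" for \<beta>
    using that B(1) by (intro f_inv_into_f) auto
  have bij: "bij_betw e Y B"
    unfolding Y_def by (rule bij_betw_byWitness[where f'="inv_into (carrier D) e"]) (auto simp: e_inv)
  have eY: "e y \<in> B" if "y \<in> Y" for y using bij that by (auto simp: bij_betw_def)
  define r where "r x y = fun_vs.representation B (e x) (e y)" for x y
  define T where "T x = {y \<in> Y. r x y \<noteq> 0}" for x
  have bijT: "bij_betw e (T x) {\<beta>. fun_vs.representation B (e x) \<beta> \<noteq> 0}" for x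
  proof -
    have "e ` T x = {\<beta>. fun_vs.representation B (e x) \<beta> \<noteq> 0}"
    proof (intro equalityI subsetI)
      fix \<beta> assume "\<beta> \<in> {\<beta>. fun_vs.representation B (e x) \<beta> \<noteq> 0}"
      then have \<beta>: "fun_vs.representation B (e x) \<beta> \<noteq> 0" "\<beta> \<in> B" using fun_vs.representation_ne_zero by auto
      then obtain y where "y \<in> Y" "\<beta> = e y" using bij by (auto simp: bij_betw_def)
      then show "\<beta> \<in> e ` T x" using \<beta> by (auto simp: T_def r_def)
    qed (auto simp: T_def r_def)
    moreover have "inj_on e (T x)" using bij by (auto simp: bij_betw_def T_def intro: inj_on_subset)
    ultimately show ?thesis by (simp add: bij_betw_def)
  qed
  have fT: "finite (T x)" for x using bij_betw_finite[OF bijT] fun_vs.finite_representation by blast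
  have rep: "e x h = (\<Sum>y\<in>T x. r x y * e y h)" if x: "x \<in> carrier D" for x h
  proof -
    have "e x = (\<Sum>\<beta> | fun_vs.representation B (e x) \<beta> \<noteq> 0. fun_scale (fun_vs.representation B (e x) \<beta>) \<beta>)"
      using fun_vs.sum_nonzero_representation_eq[OF B(2), of "e x"] B(3) x by auto
    also have "\<dots> = (\<Sum>y\<in>T x. fun_scale (r x y) (e y))"
      using sum.reindex_bij_betw[OF bijT, of "\<lambda>\<beta>. fun_scale (fun_vs.representation B (e x) \<beta>) \<beta>" x] by (simp add: r_def)
    finally have "e x h = (\<Sum>y\<in>T x. fun_scale (r x y) (e y)) h" by (rule fun_cong)
    then show ?thesis by (simp add: sum_fun_apply fun_scale_def)
  qed
  have H_add: "h (x \<otimes>\<^bsub>D\<^esub> y) = h x + h y" if "h \<in> H" "x \<in> carrier D" "y \<in> carrier D" for h x y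
    using that by (auto simp: H_def carrier_hom_group hom_def complex_additive_def)
  \<comment> \<open>Basis expansions depend linearly on the vector, so the additive relation between
    evaluations passes to the coefficients. Hence the formula below defines a homomorphism for every
    choice of \<psi>.\<close>
  have r_add: "r (x \<otimes>\<^bsub>D\<^esub> y) z = r x z + r y z" if x: "x \<in> carrier D" and y: "y \<in> carrier D" for x y z
  proof -
    have "e (x \<otimes>\<^bsub>D\<^esub> y) = e x + e y" using H_add x y by (auto simp: e_def fun_eq_iff)
    moreover have "e x \<in> fun_vs.span B" "e y \<in> fun_vs.span B" using B(3) x y by auto
    ultimately show ?thesis using fun_vs.representation_add[OF B(2)] by (simp add: r_def)
  qed
  \<comment> \<open>The three elements in an additivity relation have different supports; their sums
    are compared over the union.\<close>
  have ext_sum: "(\<Sum>z\<in>T x. r x z * \<psi> z) = (\<Sum>z\<in>F. r x z * \<psi> z)" if "finite F" "T x \<subseteq> F" "F \<subseteq> Y" for x F \<psi>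
    by (rule sum.mono_neutral_left) (use that in \<open>auto simp: T_def\<close>)
  show ?thesis
  proof (rule that[of Y T r])
    show "Y \<subseteq> carrier D" by (rule Y)
    show "finite (T x)" "T x \<subseteq> Y" for x using fT by (auto simp: T_def)
    show "h x = (\<Sum>y\<in>T x. r x y * h y)"
      if h: "h \<in> carrier (hom_group D complex_additive)" and x: "x \<in> carrier D" for h x
      using rep[OF x, of h] h by (simp add: e_def H_def)
    show "(\<lambda>x\<in>carrier D. \<Sum>y\<in>T x. r x y * \<psi> y) \<in> carrier (hom_group D complex_additive)" for \<psi>
      unfolding carrier_hom_group hom_def
    proof (intro CollectI conjI ballI)
      fix x y assume x: "x \<in> carrier D" and y: "y \<in> carrier D"
      let ?F = "T x \<union> T y \<union> T (x \<otimes>\<^bsub>D\<^esub> y)"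
      have F: "finite ?F" "?F \<subseteq> Y" using fT by (auto simp: T_def)
      have "(\<Sum>z\<in>T (x \<otimes>\<^bsub>D\<^esub> y). r (x \<otimes>\<^bsub>D\<^esub> y) z * \<psi> z) = (\<Sum>z\<in>?F. r (x \<otimes>\<^bsub>D\<^esub> y) z * \<psi> z)"
        by (rule ext_sum[OF F(1) _ F(2)]) auto
      also have "\<dots> = (\<Sum>z\<in>?F. r x z * \<psi> z) + (\<Sum>z\<in>?F. r y z * \<psi> z)"
        by (simp add: r_add[OF x y] distrib_right sum.distrib)
      also have "\<dots> = (\<Sum>z\<in>T x. r x z * \<psi> z) + (\<Sum>z\<in>T y. r y z * \<psi> z)"
      proof -
        have "(\<Sum>z\<in>T x. r x z * \<psi> z) = (\<Sum>z\<in>?F. r x z * \<psi> z)"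
          by (rule ext_sum[OF F(1) _ F(2)]) auto
        moreover have "(\<Sum>z\<in>T y. r y z * \<psi> z) = (\<Sum>z\<in>?F. r y z * \<psi> z)"
          by (rule ext_sum[OF F(1) _ F(2)]) auto
        ultimately show ?thesis by (simp only:)
      qed
      finally show "(\<lambda>x\<in>carrier D. \<Sum>y\<in>T x. r x y * \<psi> y) (x \<otimes>\<^bsub>D\<^esub> y) =
        (\<lambda>x\<in>carrier D. \<Sum>y\<in>T x. r x y * \<psi> y) x \<otimes>\<^bsub>complex_additive\<^esub> (\<lambda>x\<in>carrier D. \<Sum>y\<in>T x. r x y * \<psi> y) y"
        using x y closed by (simp add: complex_additive_def)
    qed (auto simp: complex_additive_def)
    show "(\<Sum>z\<in>T y. r y z * \<psi> z) = \<psi> y" if y: "y \<in> Y" for \<psi> y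
    proof -
      have r: "r y z = (if z = y then 1 else 0)" if z: "z \<in> Y" for z
      proof -
        have "e z = e y \<longleftrightarrow> z = y" using bij y z by (auto simp: bij_betw_def inj_on_def)
        then show ?thesis using fun_vs.representation_basis[OF B(2) eY[OF y]] by (simp add: r_def)
      qed
      then have "T y = {y}" using y by (auto simp: T_def split: if_splits)
      then show ?thesis using r[OF y] by simp
    qed
  qed
qed

section \<open>Comultiplication, grouplike and primitive elements\<close>

lemma tvs_subspace:
  assumes V: "topological_vector_space V" and S: "S \<subseteq> carrier V" "\<zero>\<^bsub>V\<^esub> \<in> S"
    "\<And>x y. x \<in> S \<Longrightarrow> y \<in> S \<Longrightarrow> x \<oplus>\<^bsub>V\<^esub> y \<in> S" "\<And>c x. x \<in> S \<Longrightarrow> c \<odot>\<^bsub>V\<^esub> x \<in> S"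
    and V': "carrier V' = S" "ring.zero V' = ring.zero V" "ring.add V' = ring.add V"
    "smult V' = smult V" "vtop V' = subtopology (vtop V) S"
  shows "topological_vector_space V'"
proof -
  interpret Module.module complex_algebra V using tvsD(1)[OF V] .
  have neg: "(- 1) \<odot>\<^bsub>V\<^esub> x \<oplus>\<^bsub>V\<^esub> x = \<zero>\<^bsub>V\<^esub>" if "x \<in> carrier V" for x
    using smult_l_distr[of "- 1" 1 x] smult_l_null[OF that] smult_one[OF that] that by simp
  have "Module.module complex_algebra V'"
  proof (rule moduleI)
    show "abelian_group V'"
    proof (rule abelian_groupI)
      fix x assume "x \<in> carrier V'"
      then show "\<exists>y\<in>carrier V'. y \<oplus>\<^bsub>V'\<^esub> x = \<zero>\<^bsub>V'\<^esub>"
        using S neg V' by (intro bexI[of _ "(- 1) \<odot>\<^bsub>V\<^esub> x"]) auto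
    next
      fix x y assume "x \<in> carrier V'" "y \<in> carrier V'"
      then show "x \<oplus>\<^bsub>V'\<^esub> y = y \<oplus>\<^bsub>V'\<^esub> x" using S(1) a_comm[of x y] V' by auto
    next
      fix x y z assume "x \<in> carrier V'" "y \<in> carrier V'" "z \<in> carrier V'"
      then show "(x \<oplus>\<^bsub>V'\<^esub> y) \<oplus>\<^bsub>V'\<^esub> z = x \<oplus>\<^bsub>V'\<^esub> (y \<oplus>\<^bsub>V'\<^esub> z)" using S(1) a_assoc[of x y z] V' by auto
    next
      fix x assume "x \<in> carrier V'"
      then show "\<zero>\<^bsub>V'\<^esub> \<oplus>\<^bsub>V'\<^esub> x = x" using S(1) l_zero[of x] V' by auto
    qed (use S V' in auto)
    fix a b x y
    show "(a \<oplus>\<^bsub>complex_algebra\<^esub> b) \<odot>\<^bsub>V'\<^esub> x = a \<odot>\<^bsub>V'\<^esub> x \<oplus>\<^bsub>V'\<^esub> b \<odot>\<^bsub>V'\<^esub> x" if "x \<in> carrier V'"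
      using smult_l_distr[of a b x] that S(1) V' by auto
    show "a \<odot>\<^bsub>V'\<^esub> (x \<oplus>\<^bsub>V'\<^esub> y) = a \<odot>\<^bsub>V'\<^esub> x \<oplus>\<^bsub>V'\<^esub> a \<odot>\<^bsub>V'\<^esub> y" if "x \<in> carrier V'" "y \<in> carrier V'"
      using smult_r_distr[of a x y] that S(1) V' by auto
    show "(a \<otimes>\<^bsub>complex_algebra\<^esub> b) \<odot>\<^bsub>V'\<^esub> x = a \<odot>\<^bsub>V'\<^esub> (b \<odot>\<^bsub>V'\<^esub> x)" if "x \<in> carrier V'"
      using smult_assoc1[of a b x] that S(1) V' by auto
    show "\<one>\<^bsub>complex_algebra\<^esub> \<odot>\<^bsub>V'\<^esub> x = x" if "x \<in> carrier V'"
      using smult_one[of x] that S(1) V' by auto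
  qed (use S V' cring_complex_algebra in auto)
  moreover have "topspace (vtop V') = carrier V'" using V' S(1) tvsD(2)[OF V] by auto
  moreover have "continuous_map (prod_topology (vtop V') (vtop V')) (vtop V') (\<lambda>(v, w). v \<oplus>\<^bsub>V'\<^esub> w)"
  proof -
    have "continuous_map (prod_topology (vtop V) (vtop V)) (vtop V) (\<lambda>(v, w). v \<oplus>\<^bsub>V\<^esub> w)"
      using V by (simp add: topological_vector_space_def)
    then have "continuous_map (subtopology (prod_topology (vtop V) (vtop V)) (S \<times> S)) (vtop V) (\<lambda>(v, w). v \<oplus>\<^bsub>V\<^esub> w)"
      by (rule continuous_map_from_subtopology)
    then show ?thesis using S V' by (auto simp: subtopology_Times intro!: continuous_map_into_subtopology)
  qed
  moreover have "continuous_map (prod_topology euclidean (vtop V')) (vtop V') (\<lambda>(c, v). c \<odot>\<^bsub>V'\<^esub> v)"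
  proof -
    have "continuous_map (prod_topology euclidean (vtop V)) (vtop V) (\<lambda>(c, v). c \<odot>\<^bsub>V\<^esub> v)"
      using V by (simp add: topological_vector_space_def)
    then have "continuous_map (subtopology (prod_topology euclidean (vtop V)) (UNIV \<times> S)) (vtop V) (\<lambda>(c, v). c \<odot>\<^bsub>V\<^esub> v)"
      by (rule continuous_map_from_subtopology)
    then show ?thesis using S V' by (auto simp: subtopology_Times intro!: continuous_map_into_subtopology)
  qed
  ultimately show ?thesis by (simp add: topological_vector_space_def)
qed

lemma commutator_lie_simps [simp]:
  "carrier (commutator_lie A S) = S" "x \<otimes>\<^bsub>commutator_lie A S\<^esub> y = x \<otimes>\<^bsub>A\<^esub> y \<ominus>\<^bsub>A\<^esub> y \<otimes>\<^bsub>A\<^esub> x"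
  "ring.zero (commutator_lie A S) = ring.zero A" "ring.add (commutator_lie A S) = ring.add A"
  "smult (commutator_lie A S) = smult A" "vtop (commutator_lie A S) = subtopology (vtop A) S"
  by (simp_all add: commutator_lie_def)

lemma top_group_iso_cong:
  assumes f: "f \<in> top_group_iso H K" and t: "topspace (gtop H) = carrier H"
    and H: "\<And>x y. x \<in> carrier H \<Longrightarrow> y \<in> carrier H \<Longrightarrow> x \<otimes>\<^bsub>H\<^esub> y \<in> carrier H"
    and eq: "\<And>x. x \<in> carrier H \<Longrightarrow> g x = f x"
  shows "g \<in> top_group_iso H K"
proof -
  have "g \<in> hom H K" using f H eq by (auto simp: top_group_iso_def iso_def hom_def)
  moreover have "bij_betw g (carrier H) (carrier K)"
    using f bij_betw_cong[of "carrier H" g f] eq by (auto simp: top_group_iso_def iso_def)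
  moreover have "homeomorphic_map (gtop H) (gtop K) g"
    using f homeomorphic_map_eq[of "gtop H" "gtop K" f g] eq t by (auto simp: top_group_iso_def)
  ultimately show ?thesis by (simp add: top_group_iso_def iso_def)
qed

text \<open>For a group inside \<complex>, pointwise convergence is the subspace topology of the
  power of \<complex>. So a homeomorphism onto that power restricts to one onto the group of
  homomorphisms.\<close>

lemma gtop_hom_group_subspace:
  assumes H: "gtop H = top_of_set (carrier H)"
  shows "gtop (hom_group D H) = subtopology (product_topology (\<lambda>_. euclidean) (carrier D)) (carrier (hom_group D H))"
proof -
  have "gtop (hom_group D H) = subtopology (subtopology (product_topology (\<lambda>_. euclidean) (carrier D))
      (PiE (carrier D) (\<lambda>_. carrier H))) (carrier (hom_group D H))"
    unfolding hom_group_def by (simp add: H carrier_hom_group flip: subtopology_product_topology)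
  also have "\<dots> = subtopology (product_topology (\<lambda>_. euclidean) (carrier D)) (carrier (hom_group D H))"
  proof -
    have "PiE (carrier D) (\<lambda>_. carrier H) \<inter> carrier (hom_group D H) = carrier (hom_group D H)"
      by (auto simp: carrier_hom_group hom_def PiE_def)
    then show ?thesis by (simp add: subtopology_subtopology)
  qed
  finally show ?thesis .
qed

text \<open>The two identifications are parameters, so that all statements about comultiplication,
  grouplike and primitive elements refer to the same \<Phi> and to a \<Psi> compatible with
  it.\<close>

locale compact_ab_hopf = compact_ab_group_algebra G A \<eta>
  for G :: "'g top_group" (structure) and A :: "'a top_algebra" and \<eta> :: "'g \<Rightarrow> 'a" +
  fixes E :: "'e top_algebra" and t :: "'a \<Rightarrow> 'a \<Rightarrow> 'e" and \<gamma> :: "'a \<Rightarrow> 'e" and k :: "'a \<Rightarrow> complex"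
    and \<Phi> :: "'a \<Rightarrow> ('g \<Rightarrow> real set) \<Rightarrow> complex" and \<Psi> :: "'e \<Rightarrow> ('g \<Rightarrow> real set) \<times> ('g \<Rightarrow> real set) \<Rightarrow> complex"
  assumes tensor: "tensor_algebra A A E t" and comult: "comultiplication G A \<eta> E t \<gamma>"
    and coid: "coidentity G A \<eta> k"
    and \<Phi>: "\<Phi> \<in> top_algebra_iso A P" and \<Phi>_\<eta>: "\<And>g. g \<in> carrier G \<Longrightarrow> \<Phi> (\<eta> g) = ev g"
    and \<Psi>: "\<Psi> \<in> top_linear_iso E (complex_power (carrier D \<times> carrier D))"
    and \<Psi>_t: "\<And>a b \<xi> \<zeta>. a \<in> carrier A \<Longrightarrow> b \<in> carrier A \<Longrightarrow> \<xi> \<in> carrier D \<Longrightarrow> \<zeta> \<in> carrier D \<Longrightarrow>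
      \<Psi> (t a b) (\<xi>, \<zeta>) = \<Phi> a \<xi> * \<Phi> b \<zeta>"
begin

sublocale D: comm_group D by (rule comm_group_D)

lemma \<Phi>_iso: "\<Phi> \<in> top_linear_iso A P" and \<Phi>_ring: "\<Phi> \<in> ring_hom A P"
  using \<Phi> by (auto simp: top_algebra_iso_def)

lemmas \<Phi>_linear = top_linear_iso_continuous[OF \<Phi>_iso]
lemmas \<Psi>_linear = top_linear_iso_continuous[OF \<Psi>]

lemma \<Phi>_homeo: "homeomorphic_map (vtop A) (vtop P) \<Phi>" using \<Phi>_iso by (simp add: top_linear_iso_def)

lemma \<Phi>_bij: "bij_betw \<Phi> (carrier A) (extensional (carrier D))"
  using top_linear_iso_bij[OF \<Phi>_iso tA topspace_P] by simp

lemma \<Phi>_eqI: "a \<in> carrier A \<Longrightarrow> b \<in> carrier A \<Longrightarrow> \<Phi> a = \<Phi> b \<Longrightarrow> a = b"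
  using \<Phi>_bij by (auto simp: bij_betw_def inj_on_def)

lemma \<Phi>_ext: "a \<in> carrier A \<Longrightarrow> \<Phi> a \<in> extensional (carrier D)"
  using \<Phi>_bij by (auto simp: bij_betw_def)

lemma \<Phi>_coordinate: "\<xi> \<in> carrier D \<Longrightarrow> (\<lambda>a. \<Phi> a \<xi>) \<in> continuous_linear A complex_algebra"
  using continuous_linear_compose[OF \<Phi>_linear coordinate_continuous_linear] by simp

lemma \<Phi>_mult: "a \<in> carrier A \<Longrightarrow> b \<in> carrier A \<Longrightarrow> \<Phi> (a \<otimes>\<^bsub>A\<^esub> b) = (\<lambda>\<xi>\<in>carrier D. \<Phi> a \<xi> * \<Phi> b \<xi>)"
  using ring_hom_mult[OF \<Phi>_ring] by simp

lemma \<Phi>_add: "a \<in> carrier A \<Longrightarrow> b \<in> carrier A \<Longrightarrow> \<Phi> (a \<oplus>\<^bsub>A\<^esub> b) = (\<lambda>\<xi>\<in>carrier D. \<Phi> a \<xi> + \<Phi> b \<xi>)"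
  using ring_hom_add[OF \<Phi>_ring] by simp

lemma \<Phi>_smult: "a \<in> carrier A \<Longrightarrow> \<Phi> (c \<odot>\<^bsub>A\<^esub> a) = (\<lambda>\<xi>\<in>carrier D. c * \<Phi> a \<xi>)"
  using continuous_linearD(5)[OF \<Phi>_linear] by simp

lemma \<Phi>_one: "\<Phi> \<one>\<^bsub>A\<^esub> = (\<lambda>\<xi>\<in>carrier D. 1)"
  using ring_hom_one[OF \<Phi>_ring] by simp

lemma \<Phi>_zero: "\<Phi> \<zero>\<^bsub>A\<^esub> = (\<lambda>\<xi>\<in>carrier D. 0)"
proof -
  have "\<Phi> (\<zero>\<^bsub>A\<^esub> \<oplus>\<^bsub>A\<^esub> \<zero>\<^bsub>A\<^esub>) = \<Phi> \<zero>\<^bsub>A\<^esub>" by simp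
  then have eq: "(\<lambda>\<xi>\<in>carrier D. \<Phi> \<zero>\<^bsub>A\<^esub> \<xi> + \<Phi> \<zero>\<^bsub>A\<^esub> \<xi>) = \<Phi> \<zero>\<^bsub>A\<^esub>" using \<Phi>_add[of "\<zero>\<^bsub>A\<^esub>" "\<zero>\<^bsub>A\<^esub>"] by simp
  have "\<Phi> \<zero>\<^bsub>A\<^esub> \<xi> = 0" if "\<xi> \<in> carrier D" for \<xi>
    using fun_cong[OF eq, of \<xi>] that by simp
  then show ?thesis using \<Phi>_ext[of "\<zero>\<^bsub>A\<^esub>"] by (auto simp: fun_eq_iff extensional_def)
qed

lemma A_commute: "a \<in> carrier A \<Longrightarrow> b \<in> carrier A \<Longrightarrow> a \<otimes>\<^bsub>A\<^esub> b = b \<otimes>\<^bsub>A\<^esub> a"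
  by (rule \<Phi>_eqI) (auto simp: \<Phi>_mult mult.commute)

lemma \<Phi>_inverse:
  obtains \<Phi>' where "\<Phi>' \<in> continuous_linear P A" "\<And>v. v \<in> carrier A \<Longrightarrow> \<Phi>' (\<Phi> v) = v"
    "\<And>w. w \<in> extensional (carrier D) \<Longrightarrow> \<Phi> (\<Phi>' w) = w"
proof (rule top_linear_iso_inverse[OF \<Phi>_iso tvsA tvs_complex_power])
  fix \<Phi>' assume "\<Phi>' \<in> continuous_linear P A" "\<And>v. v \<in> carrier A \<Longrightarrow> \<Phi>' (\<Phi> v) = v"
    "\<And>w. w \<in> carrier P \<Longrightarrow> \<Phi> (\<Phi>' w) = w"
  then show thesis by (intro that[of \<Phi>']) auto
qed

text \<open>Density of the span of \<eta> \<open>G\<close> in \<open>A\<close>, carried back from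
  \<open>P\<close>. Formulas for \<gamma> and \<open>k\<close> thus need checking only on group
  elements.\<close>

lemma A_functional_eq:
  assumes f: "f \<in> continuous_linear A complex_algebra" and h: "h \<in> continuous_linear A complex_algebra"
    and eq: "\<And>g. g \<in> carrier G \<Longrightarrow> f (\<eta> g) = h (\<eta> g)" and a: "a \<in> carrier A"
  shows "f a = h a"
proof -
  obtain \<Phi>' where \<Phi>': "\<Phi>' \<in> continuous_linear P A" "\<And>v. v \<in> carrier A \<Longrightarrow> \<Phi>' (\<Phi> v) = v"
    "\<And>w. w \<in> extensional (carrier D) \<Longrightarrow> \<Phi> (\<Phi>' w) = w"
    using \<Phi>_inverse by blast
  have ev: "\<Phi>' (ev g) = \<eta> g" if "g \<in> carrier G" for g
    using \<Phi>'(2)[OF \<eta>_closed[OF that]] \<Phi>_\<eta>[OF that] by simp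
  have "f (\<Phi>' (\<Phi> a)) = h (\<Phi>' (\<Phi> a))"
    by (rule functional_eq_on_ev[OF continuous_linear_compose[OF \<Phi>'(1) f] continuous_linear_compose[OF \<Phi>'(1) h] _ \<Phi>_ext[OF a]])
      (simp add: ev eq)
  then show ?thesis using \<Phi>'(2)[OF a] by simp
qed

lemma wsE: "weakly_complete_space E" and t_bilinear: "t \<in> continuous_bilinear A A E"
  using tensor by (auto simp: tensor_algebra_def tensor_product_def)

lemmas tvsE = weakly_complete_tvs[OF wsE]

lemma t_closed: "a \<in> carrier A \<Longrightarrow> b \<in> carrier A \<Longrightarrow> t a b \<in> carrier E"
  using t_bilinear by (auto simp: continuous_bilinear_def linear_maps_iff)

lemma \<gamma>_linear: "\<gamma> \<in> continuous_linear A E" and \<gamma>_\<eta>: "g \<in> carrier G \<Longrightarrow> \<gamma> (\<eta> g) = t (\<eta> g) (\<eta> g)"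
  using comult by (auto simp: comultiplication_def algebra_hom_def)

lemma \<Psi>_eqI:
  assumes "x \<in> carrier E" "y \<in> carrier E"
    "\<And>\<xi> \<zeta>. \<xi> \<in> carrier D \<Longrightarrow> \<zeta> \<in> carrier D \<Longrightarrow> \<Psi> x (\<xi>, \<zeta>) = \<Psi> y (\<xi>, \<zeta>)"
  shows "x = y"
proof -
  have "bij_betw \<Psi> (carrier E) (carrier (complex_power (carrier D \<times> carrier D)))"
    by (rule top_linear_iso_bij[OF \<Psi> tvsD(2)[OF tvsE] tvsD(2)[OF tvs_complex_power]])
  moreover have "\<Psi> x = \<Psi> y"
    by (rule extensionalityI[of _ "carrier D \<times> carrier D"])
      (use continuous_linearD(3)[OF \<Psi>_linear] assms in auto)
  ultimately show ?thesis using assms by (auto simp: bij_betw_def inj_on_def)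
qed

text \<open>Both sides are continuous linear forms in \<open>a\<close>; on a group element the
  identity is multiplicativity of \<open>ev g\<close> in the character.\<close>

lemma \<Psi>_\<gamma>:
  assumes a: "a \<in> carrier A" and \<xi>: "\<xi> \<in> carrier D" and \<zeta>: "\<zeta> \<in> carrier D"
  shows "\<Psi> (\<gamma> a) (\<xi>, \<zeta>) = \<Phi> a (\<xi> \<otimes>\<^bsub>D\<^esub> \<zeta>)"
proof (rule A_functional_eq[OF _ \<Phi>_coordinate _ a])
  have "(\<xi>, \<zeta>) \<in> carrier D \<times> carrier D" using \<xi> \<zeta> by simp
  from continuous_linear_compose[OF continuous_linear_compose[OF \<gamma>_linear \<Psi>_linear] coordinate_continuous_linear[OF this]]
  show "(\<lambda>a. \<Psi> (\<gamma> a) (\<xi>, \<zeta>)) \<in> continuous_linear A complex_algebra" .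
  show "\<xi> \<otimes>\<^bsub>D\<^esub> \<zeta> \<in> carrier D" using \<xi> \<zeta> by simp
  fix g assume g: "g \<in> carrier G"
  have "\<Psi> (\<gamma> (\<eta> g)) (\<xi>, \<zeta>) = ev g \<xi> * ev g \<zeta>"
    using g \<xi> \<zeta> by (simp add: \<gamma>_\<eta> \<Psi>_t \<eta>_closed \<Phi>_\<eta>)
  also have "\<dots> = ev g (\<xi> \<otimes>\<^bsub>D\<^esub> \<zeta>)" using g \<xi> \<zeta> by (simp add: ev_eq to_mchar_mult)
  finally show "\<Psi> (\<gamma> (\<eta> g)) (\<xi>, \<zeta>) = \<Phi> (\<eta> g) (\<xi> \<otimes>\<^bsub>D\<^esub> \<zeta>)" using g by (simp add: \<Phi>_\<eta>)
qed

lemma k_eq: "a \<in> carrier A \<Longrightarrow> k a = \<Phi> a \<one>\<^bsub>D\<^esub>"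
proof (rule A_functional_eq[OF _ \<Phi>_coordinate[OF D.one_closed]])
  show "k \<in> continuous_linear A complex_algebra" using coid by (simp add: coidentity_def algebra_hom_def)
  fix g assume g: "g \<in> carrier G"
  show "k (\<eta> g) = \<Phi> (\<eta> g) \<one>\<^bsub>D\<^esub>"
    using g coid by (simp add: coidentity_def \<Phi>_\<eta> ev_eq[OF g D.one_closed] to_mchar_one mtriv_def)
qed

text \<open>In coordinates the first condition is multiplicativity on \<open>D\<close> and the
  second is the value 1 at the neutral character. Given both, inverses in \<open>D\<close> force
  nonzero values; conversely, a nonzero value at the neutral character that equals its own square is
  1.\<close>

lemma grouplike_iff:
  assumes a: "a \<in> carrier A"
  shows "\<gamma> a = t a a \<and> k a = 1 \<longleftrightarrow> \<Phi> a \<in> carrier (hom_group D complex_units)"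
proof
  assume gl: "\<gamma> a = t a a \<and> k a = 1"
  have m: "\<Phi> a (\<xi> \<otimes>\<^bsub>D\<^esub> \<zeta>) = \<Phi> a \<xi> * \<Phi> a \<zeta>" if "\<xi> \<in> carrier D" "\<zeta> \<in> carrier D" for \<xi> \<zeta>
    using \<Psi>_\<gamma>[OF a that] \<Psi>_t[OF a a that] gl by simp
  have 1: "\<Phi> a \<one>\<^bsub>D\<^esub> = 1" using k_eq[OF a] gl by simp
  have "\<Phi> a \<xi> \<noteq> 0" if "\<xi> \<in> carrier D" for \<xi>
    using m[OF that D.inv_closed[OF that]] 1 that by auto
  then show "\<Phi> a \<in> carrier (hom_group D complex_units)"
    using \<Phi>_ext[OF a] m by (auto simp: carrier_hom_group hom_def complex_units_def)
next
  assume "\<Phi> a \<in> carrier (hom_group D complex_units)"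
  then have m: "\<Phi> a (\<xi> \<otimes>\<^bsub>D\<^esub> \<zeta>) = \<Phi> a \<xi> * \<Phi> a \<zeta>" "\<Phi> a \<xi> \<noteq> 0"
    if "\<xi> \<in> carrier D" "\<zeta> \<in> carrier D" for \<xi> \<zeta>
    using that by (auto simp: carrier_hom_group hom_def complex_units_def)
  have "\<Phi> a \<one>\<^bsub>D\<^esub> = 1" using m[OF D.one_closed D.one_closed] by simp
  then have "k a = 1" using k_eq[OF a] by simp
  moreover have "\<gamma> a = t a a"
    by (rule \<Psi>_eqI[OF continuous_linearD(3)[OF \<gamma>_linear a] t_closed[OF a a]])
      (simp add: \<Psi>_\<gamma>[OF a] \<Psi>_t[OF a a] m)
  ultimately show "\<gamma> a = t a a \<and> k a = 1" by simp
qed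

text \<open>As \<Phi> sends the unit to the constant 1, the two summands have entries \<Phi>
  \<open>a\<close> \<xi> and \<Phi> \<open>a\<close> \<zeta>, and comparison with
  \<open>\<Psi>_\<gamma>\<close> leaves additivity.\<close>

lemma primitive_iff:
  assumes a: "a \<in> carrier A"
  shows "\<gamma> a = t a \<one>\<^bsub>A\<^esub> \<oplus>\<^bsub>E\<^esub> t \<one>\<^bsub>A\<^esub> a \<longleftrightarrow> \<Phi> a \<in> carrier (hom_group D complex_additive)"
proof -
  let ?p = "t a \<one>\<^bsub>A\<^esub> \<oplus>\<^bsub>E\<^esub> t \<one>\<^bsub>A\<^esub> a"
  have tc: "t a \<one>\<^bsub>A\<^esub> \<in> carrier E" "t \<one>\<^bsub>A\<^esub> a \<in> carrier E" using a t_closed by auto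
  have p: "\<Psi> ?p (\<xi>, \<zeta>) = \<Phi> a \<xi> + \<Phi> a \<zeta>" if "\<xi> \<in> carrier D" "\<zeta> \<in> carrier D" for \<xi> \<zeta>
    using continuous_linearD(4)[OF \<Psi>_linear tc] that a by (simp add: \<Psi>_t \<Phi>_one)
  have "\<gamma> a = ?p \<longleftrightarrow> (\<forall>\<xi>\<in>carrier D. \<forall>\<zeta>\<in>carrier D. \<Phi> a (\<xi> \<otimes>\<^bsub>D\<^esub> \<zeta>) = \<Phi> a \<xi> + \<Phi> a \<zeta>)"
  proof
    assume "\<gamma> a = ?p"
    then show "\<forall>\<xi>\<in>carrier D. \<forall>\<zeta>\<in>carrier D. \<Phi> a (\<xi> \<otimes>\<^bsub>D\<^esub> \<zeta>) = \<Phi> a \<xi> + \<Phi> a \<zeta>"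
      using p \<Psi>_\<gamma>[OF a] by metis
  next
    assume "\<forall>\<xi>\<in>carrier D. \<forall>\<zeta>\<in>carrier D. \<Phi> a (\<xi> \<otimes>\<^bsub>D\<^esub> \<zeta>) = \<Phi> a \<xi> + \<Phi> a \<zeta>"
    then show "\<gamma> a = ?p"
      by (intro \<Psi>_eqI[OF continuous_linearD(3)[OF \<gamma>_linear a] tvsD(4)[OF tvsE tc]]) (simp add: p \<Psi>_\<gamma>[OF a])
  qed
  then show ?thesis
    using \<Phi>_ext[OF a] by (auto simp: carrier_hom_group hom_def complex_additive_def)
qed

lemma \<Phi>_preimage:
  assumes "C \<subseteq> extensional (carrier D)"
  shows "\<Phi> ` {a \<in> carrier A. \<Phi> a \<in> C} = C"
proof (intro equalityI subsetI)
  fix c assume c: "c \<in> C"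
  then have "c \<in> \<Phi> ` carrier A" using \<Phi>_bij assms by (auto simp: bij_betw_def)
  then show "c \<in> \<Phi> ` {a \<in> carrier A. \<Phi> a \<in> C}" using c by blast
qed auto

lemma \<Phi>_homeo_preimage:
  assumes "C \<subseteq> extensional (carrier D)"
  shows "homeomorphic_map (subtopology (vtop A) {a \<in> carrier A. \<Phi> a \<in> C}) (subtopology (vtop P) C) \<Phi>"
  by (rule homeomorphic_map_subtopologies_alt[OF \<Phi>_homeo]) (auto simp: tA)

lemma grouplike_iso:
  "\<Phi> ` carrier (grouplike_group A t \<gamma> k) = carrier (hom_group D complex_units)"
  "\<Phi> \<in> top_group_iso (grouplike_group A t \<gamma> k) (hom_group D complex_units)"
proof -
  define C where "C = carrier (hom_group D complex_units)"
  have C: "C \<subseteq> extensional (carrier D)" by (auto simp: C_def carrier_hom_group)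
  have eq: "{a \<in> carrier A. \<gamma> a = t a a \<and> k a = 1} = {a \<in> carrier A. \<Phi> a \<in> C}"
    using grouplike_iff by (auto simp: C_def)
  have c: "carrier (grouplike_group A t \<gamma> k) = {a \<in> carrier A. \<Phi> a \<in> C}"
    by (simp add: grouplike_group_def eq)
  show img: "\<Phi> ` carrier (grouplike_group A t \<gamma> k) = carrier (hom_group D complex_units)"
    unfolding c using \<Phi>_preimage[OF C] by (simp add: C_def)
  have "\<Phi> \<in> hom (grouplike_group A t \<gamma> k) (hom_group D complex_units)"
    unfolding hom_def
  proof (intro CollectI conjI ballI)
    show "\<Phi> \<in> carrier (grouplike_group A t \<gamma> k) \<rightarrow> carrier (hom_group D complex_units)" using img by auto
    fix x y assume "x \<in> carrier (grouplike_group A t \<gamma> k)" "y \<in> carrier (grouplike_group A t \<gamma> k)"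
    then show "\<Phi> (x \<otimes>\<^bsub>grouplike_group A t \<gamma> k\<^esub> y) = \<Phi> x \<otimes>\<^bsub>hom_group D complex_units\<^esub> \<Phi> y"
      unfolding c by (simp add: grouplike_group_def hom_group_def complex_units_def \<Phi>_mult)
  qed
  moreover have "inj_on \<Phi> (carrier (grouplike_group A t \<gamma> k))"
    unfolding c using \<Phi>_eqI by (auto simp: inj_on_def)
  moreover have "homeomorphic_map (gtop (grouplike_group A t \<gamma> k)) (gtop (hom_group D complex_units)) \<Phi>"
  proof -
    have "gtop (grouplike_group A t \<gamma> k) = subtopology (vtop A) {a \<in> carrier A. \<Phi> a \<in> C}"
      by (simp add: grouplike_group_def eq)
    moreover have "gtop (hom_group D complex_units) = subtopology (vtop P) C"
      using gtop_hom_group_subspace[of complex_units D] by (simp add: C_def complex_units_def)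
    ultimately show ?thesis using \<Phi>_homeo_preimage[OF C] by simp
  qed
  ultimately show "\<Phi> \<in> top_group_iso (grouplike_group A t \<gamma> k) (hom_group D complex_units)"
    using img by (simp add: top_group_iso_def iso_def bij_betw_def)
qed

section \<open>The Lie algebra of primitive elements\<close>

abbreviation "additive_homs \<equiv> carrier (hom_group D complex_additive)"

definition "primitives = {a \<in> carrier A. \<Phi> a \<in> additive_homs}"

lemma primitive_lie_eq: "primitive_lie A E t \<gamma> = commutator_lie A primitives"
proof -
  have "{a \<in> carrier A. \<gamma> a = t a \<one>\<^bsub>A\<^esub> \<oplus>\<^bsub>E\<^esub> t \<one>\<^bsub>A\<^esub> a} = primitives"
    unfolding primitives_def using primitive_iff by auto
  then show ?thesis by (simp add: primitive_lie_def)
qed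

lemma additive_homs_ext: "additive_homs \<subseteq> extensional (carrier D)"
  by (auto simp: carrier_hom_group)

lemma primitives_closed: "primitives \<subseteq> carrier A" "\<zero>\<^bsub>A\<^esub> \<in> primitives"
  "x \<in> primitives \<Longrightarrow> y \<in> primitives \<Longrightarrow> x \<oplus>\<^bsub>A\<^esub> y \<in> primitives"
  "x \<in> primitives \<Longrightarrow> c \<odot>\<^bsub>A\<^esub> x \<in> primitives"
  using tvsD(5)[OF tvsA]
  by (auto simp: primitives_def carrier_hom_group hom_def complex_additive_def \<Phi>_zero \<Phi>_add \<Phi>_smult algebra_simps)

lemma tvs_primitives: "topological_vector_space (commutator_lie A primitives)"
  by (rule tvs_subspace[OF tvsA primitives_closed]) auto

lemma primitive_bracket: "x \<in> primitives \<Longrightarrow> y \<in> primitives \<Longrightarrow> x \<otimes>\<^bsub>A\<^esub> y \<ominus>\<^bsub>A\<^esub> y \<otimes>\<^bsub>A\<^esub> x = \<zero>\<^bsub>A\<^esub>"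
proof -
  assume "x \<in> primitives" "y \<in> primitives"
  then have xy: "x \<in> carrier A" "y \<in> carrier A" using primitives_closed(1) by auto
  show ?thesis unfolding A_commute[OF xy] a_minus_def using xy by (intro A.r_neg) simp
qed

text \<open>An additive homomorphism is determined by its values on \<open>Y\<close>, and these can
  be prescribed freely. So restriction to \<open>Y\<close> identifies the primitive elements with a
  power of \<complex>, and both directions are continuous because every value is a finite sum of
  coordinates.\<close>

lemma weakly_complete_primitives: "weakly_complete_space (commutator_lie A primitives)"
proof -
  let ?L = "commutator_lie A primitives"
  obtain Y T r where Y: "Y \<subseteq> carrier D" and T: "\<And>x. x \<in> carrier D \<Longrightarrow> finite (T x)" "\<And>x. x \<in> carrier D \<Longrightarrow> T x \<subseteq> Y"
    and expand: "\<And>h x. h \<in> additive_homs \<Longrightarrow> x \<in> carrier D \<Longrightarrow> h x = (\<Sum>y\<in>T x. r x y * h y)"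
    and build: "\<And>\<psi>. (\<lambda>x\<in>carrier D. \<Sum>y\<in>T x. r x y * \<psi> y) \<in> additive_homs"
    and basis: "\<And>\<psi> y. y \<in> Y \<Longrightarrow> (\<Sum>z\<in>T y. r y z * \<psi> z) = (\<psi> y :: complex)"
    using additive_hom_coordinates[OF D.m_closed] by blast
  obtain \<Phi>' where \<Phi>': "\<Phi>' \<in> continuous_linear P A" "\<And>v. v \<in> carrier A \<Longrightarrow> \<Phi>' (\<Phi> v) = v"
    "\<And>w. w \<in> extensional (carrier D) \<Longrightarrow> \<Phi> (\<Phi>' w) = w"
    using \<Phi>_inverse by blast
  \<comment> \<open>The index set has to consist of elements of type \<open>'a\<close>, so each
    \<open>y\<close> is labelled by the element of \<open>A\<close> that corresponds to its unit
    vector. These elements are labels only.\<close>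
  define h where "h y = \<Phi>' (delta (carrier D) y)" for y
  have "inj_on h Y"
  proof (rule inj_onI)
    fix x y assume xy: "x \<in> Y" "y \<in> Y" "h x = h y"
    then have "delta (carrier D) x = delta (carrier D) y" unfolding h_def by (metis \<Phi>'(3) delta_ext)
    then show "x = y" by (rule inj_onD[OF delta_inj]) (use Y xy in auto)
  qed
  define g where "g = inv_into Y h"
  have gh: "g (h y) = y" if "y \<in> Y" for y using that \<open>inj_on h Y\<close> by (simp add: g_def)
  define J where "J = h ` Y"
  have g: "g j \<in> Y" "h (g j) = j" if "j \<in> J" for j using that gh by (auto simp: J_def)
  define \<rho> where "\<rho> a = (\<lambda>j\<in>J. \<Phi> a (g j))" for a
  define \<sigma> where "\<sigma> \<phi> = \<Phi>' (\<lambda>x\<in>carrier D. \<Sum>y\<in>T x. r x y * \<phi> (h y))" for \<phi>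
  have sub: "f \<in> continuous_linear ?L complex_algebra" if "f \<in> continuous_linear A complex_algebra" for f
    using that primitives_closed(1)
    by (auto simp: continuous_linear_def linear_maps_iff continuous_map_from_subtopology subset_iff)
  have \<rho>: "\<rho> \<in> continuous_linear ?L (complex_power J)"
    by (rule continuous_linear_into_power[OF tvs_primitives])
      (use g Y in \<open>auto simp: \<rho>_def intro!: sub \<Phi>_coordinate\<close>)
  have "(\<lambda>\<phi>. \<lambda>x\<in>carrier D. \<Sum>y\<in>T x. r x y * \<phi> (h y)) \<in> continuous_linear (complex_power J) P"
  proof (rule continuous_linear_into_power[OF tvs_complex_power])
    fix x assume x: "x \<in> carrier D"
    have "(\<lambda>\<phi>. \<Sum>y\<in>T x. r x y * \<phi> (h y)) \<in> continuous_linear (complex_power J) complex_algebra"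
      by (rule continuous_linear_sum[OF T(1)[OF x]], rule coordinate_continuous_linear)
        (use T(2)[OF x] in \<open>auto simp: J_def\<close>)
    then show "(\<lambda>\<phi>. (\<lambda>x\<in>carrier D. \<Sum>y\<in>T x. r x y * \<phi> (h y)) x) \<in> continuous_linear (complex_power J) complex_algebra"
      using x by simp
  qed auto
  from continuous_linear_compose[OF this \<Phi>'(1)] have \<sigma>A: "\<sigma> \<in> continuous_linear (complex_power J) A"
    by (simp add: \<sigma>_def[abs_def])
  have \<Phi>\<sigma>: "\<Phi> (\<sigma> \<phi>) = (\<lambda>x\<in>carrier D. \<Sum>y\<in>T x. r x y * \<phi> (h y))" for \<phi> by (simp add: \<sigma>_def \<Phi>'(3))
  have \<sigma>S: "\<sigma> \<phi> \<in> primitives" if "\<phi> \<in> extensional J" for \<phi>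
    using continuous_linearD(3)[OF \<sigma>A] that build by (simp add: primitives_def \<Phi>\<sigma>)
  have \<sigma>: "\<sigma> \<in> continuous_linear (complex_power J) ?L"
    using \<sigma>A \<sigma>S
    by (auto simp: continuous_linear_def linear_maps_iff PiE_def intro!: continuous_map_into_subtopology)
  have "\<rho> \<in> top_linear_iso ?L (complex_power J)"
  proof (rule top_linear_isoI[OF \<rho> \<sigma> tvsD(2)[OF tvs_primitives] tvsD(2)[OF tvs_complex_power]])
    fix a assume "a \<in> carrier ?L"
    then have a: "a \<in> carrier A" "\<Phi> a \<in> additive_homs" by (auto simp: primitives_def)
    have "\<Phi> (\<sigma> (\<rho> a)) = \<Phi> a"
    proof (rule extensionalityI[OF _ \<Phi>_ext[OF a(1)]])
      show "\<Phi> (\<sigma> (\<rho> a)) \<in> extensional (carrier D)" by (simp add: \<Phi>\<sigma>)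
      fix x assume x: "x \<in> carrier D"
      have "(\<Sum>y\<in>T x. r x y * \<rho> a (h y)) = (\<Sum>y\<in>T x. r x y * \<Phi> a y)"
      proof (rule sum.cong[OF refl])
        fix y assume "y \<in> T x"
        then have "y \<in> Y" using T(2)[OF x] by auto
        then show "r x y * \<rho> a (h y) = r x y * \<Phi> a y" using gh[of y] by (simp add: \<rho>_def J_def)
      qed
      then show "\<Phi> (\<sigma> (\<rho> a)) x = \<Phi> a x" using expand[OF a(2) x] x by (simp add: \<Phi>\<sigma>)
    qed
    moreover have "\<sigma> (\<rho> a) \<in> carrier A" using \<sigma>S primitives_closed(1) by (auto simp: \<rho>_def)
    ultimately show "\<sigma> (\<rho> a) = a" using \<Phi>_eqI a(1) by blast
  next
    fix w assume w: "w \<in> carrier (complex_power J)"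
    show "\<rho> (\<sigma> w) = w"
    proof (rule extensionalityI[of _ J])
      fix j assume j: "j \<in> J"
      have "\<Phi> (\<sigma> w) (g j) = (\<Sum>z\<in>T (g j). r (g j) z * w (h z))" using g[OF j] Y by (auto simp: \<Phi>\<sigma>)
      also have "\<dots> = w (h (g j))" by (rule basis[OF g(1)[OF j]])
      finally show "\<rho> (\<sigma> w) j = w j" using j g(2)[OF j] by (simp add: \<rho>_def)
    qed (use w in \<open>auto simp: \<rho>_def\<close>)
  qed
  then show ?thesis using tvs_primitives unfolding weakly_complete_space_def by blast
qed

text \<open>\<open>A\<close> is commutative, so the bracket is identically zero and the content lies
  in weak completeness.\<close>

lemma primitive_lie_algebra: "weakly_complete_lie_algebra (primitive_lie A E t \<gamma>)"
  unfolding primitive_lie_eq weakly_complete_lie_algebra_def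
proof (intro conjI weakly_complete_primitives ballI)
  let ?L = "commutator_lie A primitives"
  have z: "x \<otimes>\<^bsub>?L\<^esub> y = \<zero>\<^bsub>A\<^esub>" if "x \<in> primitives" "y \<in> primitives" for x y
    using primitive_bracket[OF that] by simp
  show "(\<lambda>x y. x \<otimes>\<^bsub>?L\<^esub> y) \<in> continuous_bilinear ?L ?L ?L"
    unfolding continuous_bilinear_def
  proof (intro CollectI conjI ballI)
    have sm0: "c \<odot>\<^bsub>A\<^esub> \<zero>\<^bsub>A\<^esub> = \<zero>\<^bsub>A\<^esub>" for c
      by (rule \<Phi>_eqI) (auto simp: \<Phi>_smult \<Phi>_zero tvsD(5)[OF tvsA] fun_eq_iff)
    fix x assume "x \<in> carrier ?L"
    then show "(\<otimes>\<^bsub>?L\<^esub>) x \<in> linear_maps ?L ?L" "(\<lambda>v. v \<otimes>\<^bsub>?L\<^esub> x) \<in> linear_maps ?L ?L"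
      unfolding linear_maps_iff using z primitives_closed sm0 primitive_bracket by auto
  next
    have "continuous_map (prod_topology (vtop ?L) (vtop ?L)) (vtop ?L) (\<lambda>_. \<zero>\<^bsub>A\<^esub>)"
      using primitives_closed(1,2) tA by auto
    then show "continuous_map (prod_topology (vtop ?L) (vtop ?L)) (vtop ?L) (\<lambda>(v, w). v \<otimes>\<^bsub>?L\<^esub> w)"
      by (rule continuous_map_eq) (use primitive_bracket in auto)
  qed
  fix x assume x: "x \<in> carrier ?L"
  then show "x \<otimes>\<^bsub>?L\<^esub> x = \<zero>\<^bsub>?L\<^esub>" using z by simp
  fix y w assume "y \<in> carrier ?L" "w \<in> carrier ?L"
  then show "x \<otimes>\<^bsub>?L\<^esub> (y \<otimes>\<^bsub>?L\<^esub> w) \<oplus>\<^bsub>?L\<^esub> y \<otimes>\<^bsub>?L\<^esub> (w \<otimes>\<^bsub>?L\<^esub> x) \<oplus>\<^bsub>?L\<^esub> w \<otimes>\<^bsub>?L\<^esub> (x \<otimes>\<^bsub>?L\<^esub> y) = \<zero>\<^bsub>?L\<^esub>"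
    using x primitive_bracket primitives_closed(2) by simp
qed

lemma primitive_iso:
  "\<Phi> ` carrier (primitive_lie A E t \<gamma>) = additive_homs"
  "\<Phi> \<in> lie_iso (primitive_lie A E t \<gamma>) (commutator_lie P additive_homs)"
proof -
  show img: "\<Phi> ` carrier (primitive_lie A E t \<gamma>) = additive_homs"
    unfolding primitive_lie_eq using \<Phi>_preimage[OF additive_homs_ext] by (simp add: primitives_def)
  let ?L = "commutator_lie A primitives" and ?M = "commutator_lie P additive_homs"
  interpret P: abelian_group P by (rule tvsD(3)[OF tvs_complex_power])
  have "\<Phi> \<in> linear_maps ?L ?M"
    unfolding linear_maps_iff using \<Phi>_add \<Phi>_smult by (auto simp: primitives_def)
  moreover have "homeomorphic_map (vtop ?L) (vtop ?M) \<Phi>"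
    using \<Phi>_homeo_preimage[OF additive_homs_ext] by (simp add: primitives_def)
  moreover have "\<Phi> (x \<otimes>\<^bsub>?L\<^esub> y) = \<Phi> x \<otimes>\<^bsub>?M\<^esub> \<Phi> y" if "x \<in> primitives" "y \<in> primitives" for x y
  proof -
    have "\<Phi> x \<otimes>\<^bsub>P\<^esub> \<Phi> y \<in> carrier P" by simp
    then have "\<Phi> x \<otimes>\<^bsub>P\<^esub> \<Phi> y \<ominus>\<^bsub>P\<^esub> \<Phi> x \<otimes>\<^bsub>P\<^esub> \<Phi> y = \<zero>\<^bsub>P\<^esub>" unfolding a_minus_def by (rule P.r_neg)
    moreover have "\<Phi> y \<otimes>\<^bsub>P\<^esub> \<Phi> x = \<Phi> x \<otimes>\<^bsub>P\<^esub> \<Phi> y" by (simp add: mult.commute)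
    ultimately have "\<Phi> x \<otimes>\<^bsub>?M\<^esub> \<Phi> y = \<zero>\<^bsub>P\<^esub>" by (simp only: commutator_lie_simps)
    moreover have "\<Phi> (x \<otimes>\<^bsub>?L\<^esub> y) = \<zero>\<^bsub>P\<^esub>" using primitive_bracket[OF that] \<Phi>_zero by simp
    ultimately show ?thesis by simp
  qed
  ultimately show "\<Phi> \<in> lie_iso (primitive_lie A E t \<gamma>) ?M"
    unfolding primitive_lie_eq lie_iso_def top_linear_iso_def by simp
qed

section \<open>The image of the group and its closed real span\<close>

lemma \<Phi>_\<eta>_iso: "(\<Phi> \<circ> \<eta>) \<in> top_group_iso G (hom_group D circle_S1)"
  by (rule top_group_iso_cong[OF ev_iso]) (auto simp: \<Phi>_\<eta>)

lemma \<Phi>_\<eta>_image: "\<Phi> ` \<eta> ` carrier G = carrier (hom_group D circle_S1)"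
proof -
  have "(\<Phi> \<circ> \<eta>) ` carrier G = carrier (hom_group D circle_S1)"
    using \<Phi>_\<eta>_iso by (simp add: top_group_iso_def iso_def bij_betw_def)
  then show ?thesis by (simp add: image_comp)
qed

lemma real_group_algebra_bounds:
  "\<eta> ` carrier G \<subseteq> real_group_algebra G A \<eta>" "real_group_algebra G A \<eta> \<subseteq> carrier A"
proof -
  interpret M: Module.module complex_algebra A by (rule tvsD(1)[OF tvsA])
  have sub: "real_span A (\<eta> ` carrier G) \<subseteq> carrier A"
    using \<eta>_closed tvsD(5)[OF tvsA] by (auto simp: real_span_def intro!: A.finsum_closed)
  have "\<eta> g \<in> real_span A (\<eta> ` carrier G)" if g: "g \<in> carrier G" for g
  proof -
    have "finsum A (\<lambda>s. complex_of_real ((\<lambda>_. 1) s) \<odot>\<^bsub>A\<^esub> s) {\<eta> g} = \<eta> g"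
      using \<eta>_closed[OF g] M.smult_one[of "\<eta> g"] by (simp add: A.finsum_insert)
    then show ?thesis unfolding real_span_def using g by (auto intro!: exI[of _ "{\<eta> g}"] exI[of _ "\<lambda>_. 1"])
  qed
  moreover have "real_span A (\<eta> ` carrier G) \<subseteq> real_group_algebra G A \<eta>"
    unfolding real_group_algebra_def by (rule closure_of_subset) (use sub tA in simp)
  ultimately show "\<eta> ` carrier G \<subseteq> real_group_algebra G A \<eta>" by blast
  show "real_group_algebra G A \<eta> \<subseteq> carrier A"
    unfolding real_group_algebra_def using closure_of_subset_topspace[of "vtop A"] tA by auto
qed

end

theorem theorem5p1:
  fixes G :: "'g top_group"
    and A :: "'a top_algebra" and \<eta> :: "'g \<Rightarrow> 'a"
    and E :: "'e top_algebra" and t :: "'a \<Rightarrow> 'a \<Rightarrow> 'e"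
    and \<gamma> :: "'a \<Rightarrow> 'e" and k :: "'a \<Rightarrow> complex"
  defines "D \<equiv> char_group G"
  defines "P \<equiv> complex_power (carrier D)"
  assumes "compact_abelian_group G"
    and "group_algebra G A \<eta>"
    and "tensor_algebra A A E t"
    and "comultiplication G A \<eta> E t \<gamma>"
    and "coidentity G A \<eta> k"
  shows "\<exists>\<Phi> \<in> top_algebra_iso A P.
    \<comment> \<open>(i)\<close>
    (\<forall>g\<in>carrier G. \<forall>\<xi>\<in>carrier D. \<Phi> (\<eta> g) \<xi> = exp_RmodZ (\<xi> g)) \<and>
    (\<Phi> \<circ> \<eta>) \<in> top_group_iso G (hom_group D circle_S1) \<and>
    \<Phi> ` \<eta> ` carrier G = carrier (hom_group D circle_S1) \<and>
    (\<lambda>\<theta>. \<lambda>\<xi>\<in>carrier D. exp_RmodZ (\<theta> \<xi>))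
      \<in> top_group_iso (hom_group D RmodZ) (hom_group D circle_S1) \<and>
    carrier (hom_group D circle_S1) \<subseteq> \<Phi> ` real_group_algebra G A \<eta> \<and>
    \<Phi> ` real_group_algebra G A \<eta> \<subseteq> \<Phi> ` carrier A \<and>
    \<Phi> ` carrier A = carrier P \<and>
    \<comment> \<open>(ii)\<close>
    (\<exists>\<Psi> \<in> top_linear_iso E (complex_power (carrier D \<times> carrier D)).
      (\<forall>a\<in>carrier A. \<forall>b\<in>carrier A. \<forall>\<xi>\<^sub>1\<in>carrier D. \<forall>\<xi>\<^sub>2\<in>carrier D.
         \<Psi> (t a b) (\<xi>\<^sub>1, \<xi>\<^sub>2) = \<Phi> a \<xi>\<^sub>1 * \<Phi> b \<xi>\<^sub>2) \<and>
      (\<forall>a\<in>carrier A. \<forall>\<xi>\<^sub>1\<in>carrier D. \<forall>\<xi>\<^sub>2\<in>carrier D.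
         \<Psi> (\<gamma> a) (\<xi>\<^sub>1, \<xi>\<^sub>2) = \<Phi> a (\<xi>\<^sub>1 \<otimes>\<^bsub>D\<^esub> \<xi>\<^sub>2))) \<and>
    \<comment> \<open>(iii)\<close>
    \<Phi> ` carrier (grouplike_group A t \<gamma> k) = carrier (hom_group D complex_units) \<and>
    \<Phi> \<in> top_group_iso (grouplike_group A t \<gamma> k) (hom_group D complex_units) \<and>
    \<comment> \<open>(iv)\<close>
    \<Phi> ` carrier (primitive_lie A E t \<gamma>) = carrier (hom_group D complex_additive) \<and>
    weakly_complete_lie_algebra (primitive_lie A E t \<gamma>) \<and>
    \<Phi> \<in> lie_iso (primitive_lie A E t \<gamma>)
          (commutator_lie P (carrier (hom_group D complex_additive)))"
proof -
  interpret compact_ab_group_algebra G A \<eta> by unfold_locales fact+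
  obtain \<Phi> where \<Phi>: "\<Phi> \<in> top_algebra_iso A P" "\<And>g. g \<in> carrier G \<Longrightarrow> \<Phi> (\<eta> g) = ev g"
    using group_algebra_iso unfolding P_def D_def by blast
  have \<Phi>l: "\<Phi> \<in> top_linear_iso A (complex_power (carrier D))"
    using \<Phi>(1) by (simp add: top_algebra_iso_def P_def)
  have "tensor_product A A E t" using assms(5) by (simp add: tensor_algebra_def)
  \<comment> \<open>The same \<Phi> is used on both factors, which makes \<Psi> compatible with it
    in each variable.\<close>
  from tensor_product_complex_power[OF this tvsA tvsA \<Phi>l \<Phi>l] obtain \<Psi>
    where \<Psi>: "\<Psi> \<in> top_linear_iso E (complex_power (carrier D \<times> carrier D))"
      "\<And>a b \<xi> \<zeta>. a \<in> carrier A \<Longrightarrow> b \<in> carrier A \<Longrightarrow> \<xi> \<in> carrier D \<Longrightarrow> \<zeta> \<in> carrier D \<Longrightarrow>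
        \<Psi> (t a b) (\<xi>, \<zeta>) = \<Phi> a \<xi> * \<Phi> b \<zeta>" by metis
  interpret H: compact_ab_hopf G A \<eta> E t \<gamma> k \<Phi> \<Psi>
    by unfold_locales (use assms(5-7) \<Phi> \<Psi> in \<open>auto simp: D_def P_def\<close>)
  have exp_iso: "(\<lambda>\<theta>. \<lambda>\<xi>\<in>carrier D. exp_RmodZ (\<theta> \<xi>))
      \<in> top_group_iso (hom_group D RmodZ) (hom_group D circle_S1)"
    using comm_group_RmodZ H.D.is_group exp_RmodZ_iso topspace_circle
    by (intro hom_group_iso) (auto simp: comm_group_def D_def)
  have image: "\<Phi> ` carrier A = carrier P" using H.\<Phi>_bij by (simp add: bij_betw_def P_def D_def)
  have ev: "\<Phi> (\<eta> g) \<xi> = exp_RmodZ (\<xi> g)" if "g \<in> carrier G" "\<xi> \<in> carrier D" for g \<xi>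
    using \<Phi>(2)[OF that(1)] that(2) by (simp add: ev_def D_def)
  have sub: "carrier (hom_group D circle_S1) \<subseteq> \<Phi> ` real_group_algebra G A \<eta>"
    using H.\<Phi>_\<eta>_image H.real_group_algebra_bounds(1) unfolding D_def by blast
  have comult: "\<exists>\<Psi> \<in> top_linear_iso E (complex_power (carrier D \<times> carrier D)).
      (\<forall>a\<in>carrier A. \<forall>b\<in>carrier A. \<forall>\<xi>\<^sub>1\<in>carrier D. \<forall>\<xi>\<^sub>2\<in>carrier D.
         \<Psi> (t a b) (\<xi>\<^sub>1, \<xi>\<^sub>2) = \<Phi> a \<xi>\<^sub>1 * \<Phi> b \<xi>\<^sub>2) \<and>
      (\<forall>a\<in>carrier A. \<forall>\<xi>\<^sub>1\<in>carrier D. \<forall>\<xi>\<^sub>2\<in>carrier D.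
         \<Psi> (\<gamma> a) (\<xi>\<^sub>1, \<xi>\<^sub>2) = \<Phi> a (\<xi>\<^sub>1 \<otimes>\<^bsub>D\<^esub> \<xi>\<^sub>2))"
    using \<Psi> H.\<Psi>_\<gamma> unfolding D_def by (intro bexI[of _ \<Psi>]) auto
  show ?thesis
    using \<Phi>(1) ev H.\<Phi>_\<eta>_iso H.\<Phi>_\<eta>_image exp_iso sub image_mono[OF H.real_group_algebra_bounds(2), of \<Phi>] image comult
      H.grouplike_iso H.primitive_iso H.primitive_lie_algebra
    unfolding D_def P_def by (intro bexI[of _ \<Phi>] conjI ballI) simp_all
qed

end
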